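(* Let $U,X$ be finite-dimensional complex vector spaces, $m\ge1$, $0=t_0<t_1<\dots<t_m$, $A_j\in\mathrm{End}(X)$ and $B_j\in\mathrm{Hom}(U,X)$ for $j=0,\dots,m$. Let $\mathcal{P}$ be the $(U,X)$-relation consisting of all $(u,x)\in C^\infty_{\mathrm{loc}}(\mathbb{R}_{\ge0},U)\times C^\infty_{\mathrm{loc}}(\mathbb{R}_{\ge0},X)$ such that $$\dot x(t)=\sum_{j=0}^m\big(A_jx(t-t_j)+B_ju(t-t_j)\big)\qquad\text{for all }t\ge t_m,$$ and let $\mathcal{P}_d$ be the discrete-time $(C^0([0,t_m],U),C^0([0,t_m],X))$-relation consisting of all pairs of sequences $(u_d,x_d)$ with $$x_d[k+1]=Px_d[k]+Qu_d[k]+Ru_d[k+1]\qquad\text{for all }k\in\mathbb{Z}_{\ge0},$$ where $P,Q,R$ are the bounded operators associated with the delay equation as defined in the context. The following are equivalent: (a) If $(0,x_d)\in\mathcal{P}_d$ and, for some $\lambda\in\mathbb{C}$ with $|\lambda|\ge1$, $x_d[k+1]=\lambda x_d[k]$ for all $k$, then $x_d=0$. (b) $\mathcal{P}_d$ is stable. (c) $\mathcal{P}_d$ is VIVO. (d) $\mathcal{P}$ is VIVO. (e) $\mathcal{P}$ is smoothly VIVO. (f) $\mathcal{P}$ is stable.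
   Context: The operators $P,Q,R$: there exist functions $p\in C^0_{\mathrm{loc}}(\mathbb{R}_{\ge t_m},\mathrm{End}(X))$, $f\in L^\infty_{\mathrm{loc}}(\mathbb{R}_{\ge t_m}\times[0,t_m],\mathrm{End}(X))$, $g\in L^\infty_{\mathrm{loc}}(\mathbb{R}_{\ge t_m}\times\mathbb{R}_{\ge0},\mathrm{Hom}(U,X))$, with $f,g$ continuous outside $\bigcup_{j=0}^m\{(t,s)\mid s=t_m-t_j\text{ or }s=t-t_j\}$, such that a pair $(u,x)$ of continuous functions $u:\mathbb{R}_{\ge0}\to U$, $x:\mathbb{R}_{\ge0}\to X$ solves the integrated delay equation $$x(t)=e^{A_0(t-t_m)}x(t_m)+\int_{t_m}^te^{A_0(t-s)}\sum_{j=1}^mA_jx(s-t_j)\,ds+\int_{t_m}^te^{A_0(t-s)}\sum_{j=0}^mB_ju(s-t_j)\,ds\quad\forall t\ge t_m$$ if and only if $$x(t)=p(t)x(t_m)+\int_0^{t_m}f(t,s)x(s)\,ds+\int_0^tg(t,s)u(s)\,ds\quad\forall t\ge t_m.$$ Fix such $p,f,g$. Then $P:C^0([0,t_m],X)\to C^0([0,t_m],X)$ and $Q,R:C^0([0,t_m],U)\to C^0([0,t_m],X)$ are $$(Pv)(t)=p(t_m+t)v(t_m)+\int_0^{t_m}f(t_m+t,s)v(s)\,ds,$$ $$(Qv)(t)=\int_0^{t_m}g(t_m+t,s)v(s)\,ds,\qquad(Rv)(t)=\int_0^tg(t_m+t,s+t_m)v(s)\,ds.$$ Relations: let $\mathbb{T}=\mathbb{R}_{\ge0}$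 or $\mathbb{Z}_{\ge0}$. For Fréchet spaces $V,W$ a $(V,W)$-relation is a linear, translation-in-time invariant subspace of $C^\infty_{\mathrm{loc}}(\mathbb{T},V)\times C^\infty_{\mathrm{loc}}(\mathbb{T},W)$ (pairs (input, output)), where $C^\infty_{\mathrm{loc}}(\mathbb{R}_{\ge0},V)$ is the space of smooth functions and $C^\infty_{\mathrm{loc}}(\mathbb{Z}_{\ge0},V)$ the space of all sequences. $f$ is vanishing if $f(t)\to0$ as $t\to\infty$ (in sup norm for $C^0([0,t_m],\cdot)$), and, for $\mathbb{T}=\mathbb{R}_{\ge0}$, smoothly vanishing if $\partial_t^kf(t)\to0$ for every $k\ge0$. A relation is stable if every output $y$ with $(0,y)$ in the relation is vanishing; VIVO [smoothly VIVO] if for every pair $(u,y)$ in it with $u$ vanishing [smoothly vanishing], $y$ is vanishing [smoothly vanishing]. *)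

theory Defs
  imports "HOL-Analysis.Analysis" "HOL-Library.Function_Algebras"
begin

text \<open>
  Finite-dimensional complex vector spaces, the zero space included, with a choice of norm (all
  norms are equivalent). Completeness, the Heine-Borel property and second countability hold
  automatically in finite dimension; they are listed because type-class inference cannot derive
  them.
\<close>

class complex_fd_space = banach + heine_borel + second_countable_topology +
  fixes scaleC :: "complex \<Rightarrow> 'a \<Rightarrow> 'a"  (infixr "*\<^sub>C" 75)
  assumes scaleC_add_right: "c *\<^sub>C (x + y) = c *\<^sub>C x + c *\<^sub>C y"
    and scaleC_add_left: "(c + d) *\<^sub>C x = c *\<^sub>C x + d *\<^sub>C x"
    and scaleC_scaleC: "c *\<^sub>C d *\<^sub>C x = (c * d) *\<^sub>C x"
    and scaleC_one: "1 *\<^sub>C x = x"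
    and scaleR_scaleC: "r *\<^sub>R x = complex_of_real r *\<^sub>C x"
    and norm_scaleC: "norm (c *\<^sub>C x) = cmod c * norm x"
    and finite_spanning_set: "\<exists>E. finite E \<and> (\<forall>x. \<exists>c. x = (\<Sum>e\<in>E. c e *\<^sub>C e))"

lemma vector_space_scaleC: "vector_space (scaleC :: complex \<Rightarrow> 'a \<Rightarrow> 'a::complex_fd_space)"
  by unfold_locales (simp_all add: scaleC_add_right scaleC_add_left scaleC_scaleC scaleC_one)

lemma finite_dimensional_scaleC:
  "\<exists>B. finite_dimensional_vector_space (scaleC :: complex \<Rightarrow> 'a \<Rightarrow> 'a::complex_fd_space) B"
proof -
  interpret vector_space "scaleC :: complex \<Rightarrow> 'a \<Rightarrow> 'a"
    by (rule vector_space_scaleC)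
  obtain E :: "'a set" where E: "finite E" "\<forall>x. \<exists>c. x = (\<Sum>e\<in>E. c e *\<^sub>C e)"
    using finite_spanning_set by blast
  have "x \<in> span E" for x
  proof -
    obtain c where "x = (\<Sum>e\<in>E. c e *\<^sub>C e)"
      using E(2) by blast
    then show ?thesis
      by (simp add: span_sum span_scale span_base)
  qed
  then have "span E = UNIV"
    by blast
  moreover obtain B where B: "B \<subseteq> E" "independent B" "E \<subseteq> span B"
    using maximal_independent_subset by blast
  ultimately have "span B = UNIV"
    using span_minimal[OF B(3) subspace_span] by blast
  then have "finite_dimensional_vector_space scaleC B"
    using B(2) finite_subset[OF B(1) E(1)] by unfold_locales
  then show ?thesis
    by blast
qed

instantiation complex :: complex_fd_space
begin

definition scaleC_complex :: "complex \<Rightarrow> complex \<Rightarrow> complex" where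
  "scaleC_complex = (*)"

instance
proof
  show "\<exists>E. finite E \<and> (\<forall>x::complex. \<exists>c. x = (\<Sum>e\<in>E. c e *\<^sub>C e))"
    by (rule exI[of _ "{1}"]) (auto simp: scaleC_complex_def)
qed (simp_all add: scaleC_complex_def algebra_simps scaleR_conv_of_real norm_mult)

end

text \<open>
  \<open>Hom(V, W)\<close> with the operator norm: the complex-linear maps among the bounded real-linear ones
  (boundedness is automatic in finite dimension).
\<close>

definition HomC :: "('v::complex_fd_space \<Rightarrow>\<^sub>L 'w::complex_fd_space) set" where
  "HomC = {F. Vector_Spaces.linear scaleC scaleC (blinfun_apply F)}"

definition exp_op :: "('x::complex_fd_space \<Rightarrow>\<^sub>L 'x) \<Rightarrow> real \<Rightarrow> 'x \<Rightarrow> 'x" where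
  "exp_op A r x = (\<Sum>n. (r ^ n / fact n) *\<^sub>R ((blinfun_apply A ^^ n) x))"

section \<open>Function spaces and relations\<close>

text \<open>
  Functions on \<open>[0, T]\<close> or on \<open>[0, \<infinity>)\<close> are represented by functions on the reals that are zero
  outside that interval, so that equality of representatives is equality of functions; their sums and zero are pointwise.
\<close>

definition C0 :: "real \<Rightarrow> (real \<Rightarrow> 'v::real_normed_vector) set" where
  "C0 T = {v. continuous_on {0..T} v \<and> (\<forall>t. t \<notin> {0..T} \<longrightarrow> v t = 0)}"

definition sup_norm :: "real \<Rightarrow> (real \<Rightarrow> 'v::real_normed_vector) \<Rightarrow> real" where
  "sup_norm T v = (SUP t\<in>{0..T}. norm (v t))"

text \<open>Derivatives on \<open>[0, \<infinity>)\<close> are one-sided at 0.\<close>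

definition nderiv :: "nat \<Rightarrow> (real \<Rightarrow> 'v::real_normed_vector) \<Rightarrow> real \<Rightarrow> 'v" where
  "nderiv k f = ((\<lambda>h t. vector_derivative h (at t within {0..})) ^^ k) f"

definition Cinf :: "(real \<Rightarrow> 'v::real_normed_vector) set" where
  "Cinf = {f. (\<forall>t<0. f t = 0) \<and>
              (\<forall>k. \<forall>t\<ge>0. nderiv k f differentiable (at t within {0..}))}"

definition vanishing :: "(real \<Rightarrow> 'v::real_normed_vector) \<Rightarrow> bool" where
  "vanishing f \<longleftrightarrow> (f \<longlongrightarrow> 0) at_top"

definition smoothly_vanishing :: "(real \<Rightarrow> 'v::real_normed_vector) \<Rightarrow> bool" where
  "smoothly_vanishing f \<longleftrightarrow> (\<forall>k. (nderiv k f \<longlongrightarrow> 0) at_top)"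

definition vanishing_seq :: "real \<Rightarrow> (nat \<Rightarrow> real \<Rightarrow> 'v::real_normed_vector) \<Rightarrow> bool" where
  "vanishing_seq T v \<longleftrightarrow> (\<lambda>k. sup_norm T (v k)) \<longlonglongrightarrow> 0"

text \<open>
  Relations are sets of (input, output) pairs. The sense in which signals vanish is a parameter:
  it depends on the time domain, and on whether plain or smooth vanishing is meant.
\<close>

definition rel_stable :: "(('t \<Rightarrow> 'w) \<Rightarrow> bool) \<Rightarrow> (('t \<Rightarrow> 'v::zero) \<times> ('t \<Rightarrow> 'w)) set \<Rightarrow> bool" where
  "rel_stable van \<R> \<longleftrightarrow> (\<forall>y. ((\<lambda>_. 0), y) \<in> \<R> \<longrightarrow> van y)"

definition VIVO ::
  "(('t \<Rightarrow> 'v) \<Rightarrow> bool) \<Rightarrow> (('t \<Rightarrow> 'w) \<Rightarrow> bool) \<Rightarrow> (('t \<Rightarrow> 'v) \<times> ('t \<Rightarrow> 'w)) set \<Rightarrow> bool" where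
  "VIVO van_in van_out \<R> \<longleftrightarrow> (\<forall>(u, y)\<in>\<R>. van_in u \<longrightarrow> van_out y)"

definition no_unstable_modes ::
  "((nat \<Rightarrow> real \<Rightarrow> 'u::complex_fd_space) \<times> (nat \<Rightarrow> real \<Rightarrow> 'x::complex_fd_space)) set \<Rightarrow> bool" where
  "no_unstable_modes \<R> \<longleftrightarrow> (\<forall>x. ((\<lambda>_. 0), x) \<in> \<R> \<longrightarrow>
     (\<exists>z. cmod z \<ge> 1 \<and> (\<forall>k. x (Suc k) = (\<lambda>t. z *\<^sub>C x k t))) \<longrightarrow> x = (\<lambda>_. 0))"

section \<open>The delay equation and its solution kernels\<close>

definition delay_relation ::
  "nat \<Rightarrow> (nat \<Rightarrow> real) \<Rightarrow> (nat \<Rightarrow> 'x::complex_fd_space \<Rightarrow>\<^sub>L 'x) \<Rightarrow>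
   (nat \<Rightarrow> 'u::complex_fd_space \<Rightarrow>\<^sub>L 'x) \<Rightarrow> ((real \<Rightarrow> 'u) \<times> (real \<Rightarrow> 'x)) set" where
  "delay_relation m \<tau> A B = {(u, x). u \<in> Cinf \<and> x \<in> Cinf \<and>
     (\<forall>t\<ge>\<tau> m. (x has_vector_derivative (\<Sum>j\<le>m. A j (x (t - \<tau> j)) + B j (u (t - \<tau> j))))
                (at t within {0..}))}"

definition integrated_delay_eq ::
  "nat \<Rightarrow> (nat \<Rightarrow> real) \<Rightarrow> (nat \<Rightarrow> 'x::complex_fd_space \<Rightarrow>\<^sub>L 'x) \<Rightarrow>
   (nat \<Rightarrow> 'u::complex_fd_space \<Rightarrow>\<^sub>L 'x) \<Rightarrow> (real \<Rightarrow> 'u) \<Rightarrow> (real \<Rightarrow> 'x) \<Rightarrow> bool" where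
  "integrated_delay_eq m \<tau> A B u x \<longleftrightarrow> (\<forall>t\<ge>\<tau> m.
     x t = exp_op (A 0) (t - \<tau> m) (x (\<tau> m))
       + (LINT s:{\<tau> m..t}|lborel. exp_op (A 0) (t - s) (\<Sum>j=1..m. A j (x (s - \<tau> j))))
       + (LINT s:{\<tau> m..t}|lborel. exp_op (A 0) (t - s) (\<Sum>j=0..m. B j (u (s - \<tau> j)))))"

definition Linf_loc :: "(real \<times> real) set \<Rightarrow> (real \<times> real \<Rightarrow> 'v::real_normed_vector) \<Rightarrow> bool" where
  "Linf_loc D F \<longleftrightarrow> F \<in> borel_measurable (lebesgue_on D) \<and>
     (\<forall>K\<subseteq>D. compact K \<longrightarrow> (\<exists>C. AE z in lebesgue. z \<in> K \<longrightarrow> norm (F z) \<le> C))"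

definition break_lines :: "nat \<Rightarrow> (nat \<Rightarrow> real) \<Rightarrow> (real \<times> real) set" where
  "break_lines m \<tau> = (\<Union>j\<le>m. {(t, s). s = \<tau> m - \<tau> j \<or> s = t - \<tau> j})"

definition solution_kernels ::
  "nat \<Rightarrow> (nat \<Rightarrow> real) \<Rightarrow> (nat \<Rightarrow> 'x::complex_fd_space \<Rightarrow>\<^sub>L 'x) \<Rightarrow>
   (nat \<Rightarrow> 'u::complex_fd_space \<Rightarrow>\<^sub>L 'x) \<Rightarrow> (real \<Rightarrow> 'x \<Rightarrow>\<^sub>L 'x) \<Rightarrow>
   (real \<times> real \<Rightarrow> 'x \<Rightarrow>\<^sub>L 'x) \<Rightarrow> (real \<times> real \<Rightarrow> 'u \<Rightarrow>\<^sub>L 'x) \<Rightarrow> bool" where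
  "solution_kernels m \<tau> A B p f g \<longleftrightarrow>
     p ` {\<tau> m..} \<subseteq> HomC \<and> continuous_on {\<tau> m..} p \<and>
     f ` ({\<tau> m..} \<times> {0..\<tau> m}) \<subseteq> HomC \<and> Linf_loc ({\<tau> m..} \<times> {0..\<tau> m}) f \<and>
     continuous_on ({\<tau> m..} \<times> {0..\<tau> m} - break_lines m \<tau>) f \<and>
     g ` ({\<tau> m..} \<times> {0..}) \<subseteq> HomC \<and> Linf_loc ({\<tau> m..} \<times> {0..}) g \<and>
     continuous_on ({\<tau> m..} \<times> {0..} - break_lines m \<tau>) g \<and>
     (\<forall>u x. continuous_on {0..} u \<longrightarrow> continuous_on {0..} x \<longrightarrow>
        (integrated_delay_eq m \<tau> A B u x \<longleftrightarrow>
         (\<forall>t\<ge>\<tau> m. x t = p t (x (\<tau> m))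
            + (LINT s:{0..\<tau> m}|lborel. f (t, s) (x s))
            + (LINT s:{0..t}|lborel. g (t, s) (u s)))))"

definition opP ::
  "real \<Rightarrow> (real \<Rightarrow> 'x::complex_fd_space \<Rightarrow>\<^sub>L 'x) \<Rightarrow> (real \<times> real \<Rightarrow> 'x \<Rightarrow>\<^sub>L 'x) \<Rightarrow>
   (real \<Rightarrow> 'x) \<Rightarrow> (real \<Rightarrow> 'x)" where
  "opP T p f v = (\<lambda>t. if t \<in> {0..T}
     then p (T + t) (v T) + (LINT s:{0..T}|lborel. f (T + t, s) (v s)) else 0)"

definition opQ ::
  "real \<Rightarrow> (real \<times> real \<Rightarrow> 'u::complex_fd_space \<Rightarrow>\<^sub>L 'x::complex_fd_space) \<Rightarrow>
   (real \<Rightarrow> 'u) \<Rightarrow> (real \<Rightarrow> 'x)" where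
  "opQ T g v = (\<lambda>t. if t \<in> {0..T}
     then (LINT s:{0..T}|lborel. g (T + t, s) (v s)) else 0)"

definition opR ::
  "real \<Rightarrow> (real \<times> real \<Rightarrow> 'u::complex_fd_space \<Rightarrow>\<^sub>L 'x::complex_fd_space) \<Rightarrow>
   (real \<Rightarrow> 'u) \<Rightarrow> (real \<Rightarrow> 'x)" where
  "opR T g v = (\<lambda>t. if t \<in> {0..T}
     then (LINT s:{0..t}|lborel. g (T + t, s + T) (v s)) else 0)"

definition discrete_relation ::
  "real \<Rightarrow> (real \<Rightarrow> 'x::complex_fd_space \<Rightarrow>\<^sub>L 'x) \<Rightarrow> (real \<times> real \<Rightarrow> 'x \<Rightarrow>\<^sub>L 'x) \<Rightarrow>
   (real \<times> real \<Rightarrow> 'u::complex_fd_space \<Rightarrow>\<^sub>L 'x) \<Rightarrow>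
   ((nat \<Rightarrow> real \<Rightarrow> 'u) \<times> (nat \<Rightarrow> real \<Rightarrow> 'x)) set" where
  "discrete_relation T p f g = {(u, x). (\<forall>k. u k \<in> C0 T) \<and> (\<forall>k. x k \<in> C0 T) \<and>
     (\<forall>k. x (Suc k) = opP T p f (x k) + opQ T g (u k) + opR T g (u (Suc k)))}"

end

theory Submission
  imports Defs "HOL-Complex_Analysis.Great_Picard" "HOL-Real_Asymp.Real_Asymp"
begin

text \<open>
  Cutting a solution of the delay equation into segments of length \<open>T = t\<^sub>m\<close> turns the equation into
  \<open>x[k+1] = P x[k] + Q u[k] + R u[k+1]\<close>. The operator \<open>P\<close> is compact: off finitely many lines its
  kernel is bounded and continuous, so \<open>P\<close> maps bounded sets to equicontinuous ones. If \<open>P\<close> has no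
  eigenvalue outside the open unit disk, then its powers decay exponentially. Indeed, let \<open>\<rho>\<close> be the
  infimum of the growth rates of \<open>P\<close> and suppose \<open>\<rho> \<ge> 1\<close>. Compactness bounds \<open>(I - w P)\<^sup>-\<^sup>1\<close> by some \<open>M\<close>
  uniformly for \<open>\<bar>w\<bar> < 1/\<rho>\<close>, and the Cauchy estimate for the coefficients \<open>(n + 1) P\<^sup>n\<close> of its square
  yields \<open>(n + 1) \<parallel>P\<^sup>n\<parallel> \<le> M\<^sup>2 \<rho>\<^sup>n\<close>, so the growth rate is smaller than \<open>\<rho>\<close>. Exponential decay gives VIVO
  in discrete time and hence for the delay equation; differentiating the equation gives smooth VIVO.
  Conversely, an eigenfunction of \<open>P\<close> with eigenvalue \<open>z\<close> extends to a solution with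
  \<open>x(t + T) = z x(t)\<close>. Since solutions gain a derivative after each delay, this relation makes \<open>x\<close>
  smooth from the start, so stability of the delay equation excludes \<open>\<bar>z\<bar> \<ge> 1\<close>.
\<close>

section \<open>Compact operators without unstable eigenvalues\<close>

text \<open>Cauchy's estimate for the resolvent itself would only bound the norm of P^n by M
  \<rho>^n, which is compatible with \<rho> being the infimum. Squaring the resolvent gains the
  factor n + 1, and a single power with n + 1 at least twice the square of M then pushes the rate
  strictly below \<rho>. Two matters of representation shape the rest. \<open>C0 T\<close> is a set
  of functions and not a Banach type, so P is transported to the bounded continuous functions on the
  line; that space is infinite-dimensional, hence its complex scaling \<open>sc\<close> is carried
  as a locale parameter over a real Banach type. Moreover, the kernels are known only through an
  equivalence for functions already given on all of [0, \<infinity>): that an initial function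
  extends to a solution, whose next segment P then produces, has to be established from the
  equation.\<close>

locale complex_scaling =
  fixes sc :: "complex \<Rightarrow> 'a::banach \<Rightarrow> 'a"
  assumes sc_add_right: "sc c (x + y) = sc c x + sc c y"
    and sc_add_left: "sc (c + d) x = sc c x + sc d x"
    and sc_sc: "sc c (sc d x) = sc (c * d) x"
    and scaleR_sc: "r *\<^sub>R x = sc (complex_of_real r) x"
    and norm_sc: "norm (sc c x) = cmod c * norm x"
begin

lemma sc_one [simp]: "sc 1 x = x"
  using scaleR_sc[of 1 x] by simp

lemma sc_zero_left [simp]: "sc 0 x = 0"
  using scaleR_sc[of 0 x] by simp

lemma bounded_bilinear_sc: "bounded_bilinear sc"
proof
  show "sc (r *\<^sub>R c) x = r *\<^sub>R sc c x" for r c x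
    by (simp add: scaleR_sc[of r "sc c x"] sc_sc scaleR_conv_of_real)
  show "sc c (r *\<^sub>R x) = r *\<^sub>R sc c x" for r c x
    by (simp add: scaleR_sc[of r] sc_sc mult.commute)
  show "\<exists>K. \<forall>a b. norm (sc a b) \<le> norm a * norm b * K"
    by (rule exI[of _ 1]) (simp add: norm_sc)
qed (simp_all add: sc_add_right sc_add_left)

lemmas sc_sum_right = bounded_bilinear.sum_right[OF bounded_bilinear_sc]
lemmas sc_sum_left = bounded_bilinear.sum_left[OF bounded_bilinear_sc]
lemmas sc_diff_right = bounded_bilinear.diff_right[OF bounded_bilinear_sc]
lemmas sc_tendsto = bounded_bilinear.tendsto[OF bounded_bilinear_sc]
lemmas sc_bounded_linear = bounded_bilinear.bounded_linear_right[OF bounded_bilinear_sc]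

text \<open>Cauchy's estimate, by averaging the power series over roots of unity of large order.\<close>

lemma power_series_coeff_bound:
  assumes summ: "summable (\<lambda>n. norm (a n))"
    and bd: "\<And>w. cmod w = 1 \<Longrightarrow> norm (\<Sum>n. sc (w ^ n) (a n)) \<le> M"
  shows "norm (a n) \<le> M"
proof (rule field_le_epsilon)
  fix e :: real assume "0 < e"
  define tail where "tail N = (\<Sum>k. norm (a (k + N)))" for N
  have "tail \<longlonglongrightarrow> 0"
    unfolding tail_def using suminf_exist_split2[OF summ] .
  then have "eventually (\<lambda>N. tail N < e) sequentially"
    using \<open>0 < e\<close> by (simp add: order_tendsto_iff)
  then obtain N0 where N0: "\<And>N. N \<ge> N0 \<Longrightarrow> tail N < e"
    by (auto simp: eventually_sequentially)
  \<comment> \<open>N exceeds n so that the coefficient survives the truncation, and is large enough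
    for the discarded tail to cost less than e.\<close>
  define N where "N = max N0 (Suc n)"
  have N: "N > n" "tail N < e" "N > 0"
    using N0[of N] by (auto simp: N_def)
  define \<omega> where "\<omega> = exp (2 * of_real pi * \<i> / of_nat N)"
  have \<omega>N: "\<omega> ^ N = 1"
    using complex_root_unity[of N 1] N by (simp add: \<omega>_def)
  have \<omega>1: "\<omega> ^ d \<noteq> 1" if "0 < d" "d < N" for d
    using complex_root_unity_eq_1[of N d] that N
    by (auto simp: \<omega>_def exp_of_nat_mult[symmetric] mult_ac dest: nat_dvd_not_less)
  have cmod\<omega>: "cmod \<omega> = 1"
    by (simp add: \<omega>_def norm_exp_eq_Re)
  define p where "p w = (\<Sum>k<N. sc (w ^ k) (a k))" for w
  have p_bound: "norm (p w) \<le> M + e" if w: "cmod w = 1" for w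
  proof -
    have s: "summable (\<lambda>k. norm (sc (w ^ k) (a k)))"
      using summ by (simp add: norm_sc norm_power w)
    have "(\<Sum>k. sc (w ^ k) (a k)) = (\<Sum>k. sc (w ^ (k + N)) (a (k + N))) + p w"
      unfolding p_def by (rule suminf_split_initial_segment[OF summable_norm_cancel[OF s]])
    then have "norm (p w) \<le> norm (\<Sum>k. sc (w ^ k) (a k)) + norm (\<Sum>k. sc (w ^ (k + N)) (a (k + N)))"
      by (metis add_diff_cancel_left' norm_triangle_ineq4)
    also have "norm (\<Sum>k. sc (w ^ (k + N)) (a (k + N))) \<le> (\<Sum>k. norm (sc (w ^ (k + N)) (a (k + N))))"
      using s by (intro summable_norm) (rule summable_ignore_initial_segment)
    also have "\<dots> = tail N"
      by (simp add: tail_def norm_sc norm_power w)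
    finally show ?thesis
      using bd[OF w] N by linarith
  qed
  \<comment> \<open>Discrete Fourier inversion. Because \<open>\<omega> ^ N = 1\<close>, the weight
    with exponent \<open>j * (N - n)\<close> is the inverse of \<open>\<omega> ^ (j * n)\<close>,
    with natural exponents throughout; summing over j filters out the coefficient of index
    n.\<close>
  have average: "(\<Sum>j<N. sc (\<omega> ^ (j * (N - n))) (p (\<omega> ^ j))) = real N *\<^sub>R a n"
  proof -
    have "(\<Sum>j<N. sc (\<omega> ^ (j * (N - n))) (p (\<omega> ^ j)))
        = (\<Sum>k<N. sc (\<Sum>j<N. (\<omega> ^ (N - n + k)) ^ j) (a k))"
      unfolding p_def sc_sum_right sc_sc sc_sum_left
      by (subst sum.swap) (simp add: power_mult[symmetric] power_add[symmetric] algebra_simps)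
    also have "\<dots> = (\<Sum>k<N. if k = n then real N *\<^sub>R a n else 0)"
    proof (rule sum.cong[OF refl])
      fix k assume k: "k \<in> {..<N}"
      show "sc (\<Sum>j<N. (\<omega> ^ (N - n + k)) ^ j) (a k) = (if k = n then real N *\<^sub>R a n else 0)"
      proof (cases "k = n")
        case True
        then show ?thesis
          using N \<omega>N by (simp add: scaleR_sc)
      next
        case False
        have "\<omega> ^ (N - n + k) \<noteq> 1"
        proof (cases "k < n")
          case True
          then show ?thesis
            using \<omega>1[of "N - n + k"] N by simp
        next
          case False
          then have "\<omega> ^ (N - n + k) = \<omega> ^ N * \<omega> ^ (k - n)"
            using N by (simp add: power_add[symmetric])
          then show ?thesis
            using \<omega>1[of "k - n"] \<omega>N False \<open>k \<noteq> n\<close> k by simp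
        qed
        moreover have "(\<omega> ^ (N - n + k)) ^ N = 1"
          by (metis \<omega>N mult.commute power_mult power_one)
        ultimately have "(\<Sum>j<N. (\<omega> ^ (N - n + k)) ^ j) = 0"
          by (simp add: geometric_sum)
        then show ?thesis
          using False by simp
      qed
    qed
    finally show ?thesis
      using N by simp
  qed
  have "real N * norm (a n) = norm (\<Sum>j<N. sc (\<omega> ^ (j * (N - n))) (p (\<omega> ^ j)))"
    using average by simp
  also have "\<dots> \<le> (\<Sum>j<N. M + e)"
  proof (rule sum_norm_le)
    fix j
    show "norm (sc (\<omega> ^ (j * (N - n))) (p (\<omega> ^ j))) \<le> M + e"
      using p_bound[of "\<omega> ^ j"] by (simp add: norm_sc norm_power cmod\<omega>)
  qed
  finally show "norm (a n) \<le> M + e"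
    using N by simp
qed

end

locale compact_operator = complex_scaling sc
  for sc :: "complex \<Rightarrow> 'a::banach \<Rightarrow> 'a" +
  fixes K :: "'a \<Rightarrow> 'a"
  assumes K_bounded_linear: "bounded_linear K"
    and K_sc: "K (sc c x) = sc c (K x)"
    and K_compact: "(\<And>n::nat. norm (y n) \<le> 1) \<Longrightarrow> \<exists>l r. strict_mono r \<and> (\<lambda>n. K (y (r n))) \<longlonglongrightarrow> l"
begin

text \<open>The operator norm of \<open>K ^^ n\<close> is O(r^n); the infimum of such r is the
  spectral radius. Positivity of r makes 0 a lower bound of the rates and permits division by
  r.\<close>

definition growth :: "real \<Rightarrow> bool" where
  "growth r \<longleftrightarrow> 0 < r \<and> (\<exists>C. \<forall>n x. norm ((K ^^ n) x) \<le> C * r ^ n * norm x)"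

lemma growth_pos: "growth r \<Longrightarrow> 0 < r"
  by (simp add: growth_def)

lemma K_pow_bounded_linear: "bounded_linear (K ^^ n)"
proof (induction n)
  case 0
  then show ?case by (simp add: id_def bounded_linear_ident)
next
  case (Suc n)
  then show ?case
    using bounded_linear_compose[OF K_bounded_linear] by (simp add: o_def)
qed

lemmas K_pow_linear = bounded_linear.linear[OF K_pow_bounded_linear]

text \<open>A bound for a single power suffices: split n into a multiple of N and a remainder below
  N. The full blocks contribute the rate c, the remainder only a bounded factor.\<close>

lemma growthI:
  assumes "0 < c" "0 < N" "\<And>x. norm ((K ^^ N) x) \<le> c ^ N * norm x"
  shows "growth c"
proof -
  obtain L where L: "\<And>x. norm (K x) \<le> L * norm x" "L > 0"
    using bounded_linear.pos_bounded[OF K_bounded_linear] by (metis mult.commute)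
  have short: "norm ((K ^^ i) x) \<le> L ^ i * norm x" for i x
  proof (induction i)
    case (Suc i)
    have "norm ((K ^^ Suc i) x) \<le> L * norm ((K ^^ i) x)"
      using L(1) by simp
    also have "\<dots> \<le> L * (L ^ i * norm x)"
      using Suc L(2) by simp
    finally show ?case by (simp add: mult_ac)
  qed simp
  have long: "norm ((K ^^ (N * k)) x) \<le> c ^ (N * k) * norm x" for k x
  proof (induction k)
    case (Suc k)
    have "norm ((K ^^ (N * Suc k)) x) = norm ((K ^^ N) ((K ^^ (N * k)) x))"
      by (simp add: funpow_add)
    also have "\<dots> \<le> c ^ N * norm ((K ^^ (N * k)) x)"
      by (rule assms)
    also have "\<dots> \<le> c ^ N * (c ^ (N * k) * norm x)"
      using Suc assms by simp
    finally show ?case by (simp add: power_add mult_ac)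
  qed simp
  \<comment> \<open>The remainder i costs \<open>(L / c) ^ i\<close>; the maximum with 1 makes the
    powers increase in i, so that the exponent N dominates all of them.\<close>
  have "norm ((K ^^ n) x) \<le> (max 1 (L / c)) ^ N * c ^ n * norm x" for n x
  proof -
    define i where "i = n mod N"
    have i: "i < N" "n = N * (n div N) + i"
      using assms by (auto simp: i_def)
    have "norm ((K ^^ n) x) = norm ((K ^^ (N * (n div N))) ((K ^^ i) x))"
      using i(2) by (metis funpow_add o_apply)
    also have "\<dots> \<le> c ^ (N * (n div N)) * (L ^ i * norm x)"
      using long short assms by (smt (verit) mult_left_mono zero_le_power)
    also have "\<dots> = (L / c) ^ i * (c ^ (N * (n div N)) * c ^ i) * norm x"
      using assms by (simp add: power_divide)
    also have "\<dots> = (L / c) ^ i * c ^ n * norm x"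
      using i(2) by (metis power_add)
    also have "\<dots> \<le> (max 1 (L / c)) ^ N * c ^ n * norm x"
    proof (intro mult_right_mono)
      have "(L / c) ^ i \<le> (max 1 (L / c)) ^ i"
        using L(2) assms by (intro power_mono) auto
      also have "\<dots> \<le> (max 1 (L / c)) ^ N"
        using i(1) by (intro power_increasing) auto
      finally show "(L / c) ^ i \<le> (max 1 (L / c)) ^ N" .
    qed (use assms in auto)
    finally show ?thesis .
  qed
  then show ?thesis
    unfolding growth_def using assms by blast
qed

section \<open>Neumann series for the inverse of I - w K, with w as a reciprocal spectral
  value\<close>

definition resolvent :: "complex \<Rightarrow> 'a \<Rightarrow> 'a" where
  "resolvent w x = (\<Sum>n. sc (w ^ n) ((K ^^ n) x))"

text \<open>The weights n + 1 are the coefficients of the squared Neumann series; the dominating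
  series is the derivative of the geometric series.\<close>

lemma summable_weighted:
  assumes "growth r" "cmod w * r < 1"
  shows "summable (\<lambda>n. norm (sc (of_nat (Suc n) * w ^ n) ((K ^^ n) x)))"
proof -
  obtain C where C: "\<And>n x. norm ((K ^^ n) x) \<le> C * r ^ n * norm x" and "0 < r"
    using assms by (auto simp: growth_def)
  have s: "summable (\<lambda>n. real (Suc n) * (cmod w * r) ^ n)"
    using assms \<open>0 < r\<close> geometric_deriv_sums[of "cmod w * r"] by (auto simp: sums_iff)
  show ?thesis
  proof (rule summable_comparison_test'[OF summable_mult[OF s, of "C * norm x"]])
    fix n
    have "norm (norm (sc (of_nat (Suc n) * w ^ n) ((K ^^ n) x))) = real (Suc n) * cmod w ^ n * norm ((K ^^ n) x)"
      by (simp only: norm_sc norm_mult norm_power norm_of_nat real_norm_def abs_mult abs_norm_cancel)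
         (simp add: abs_mult)
    also have "\<dots> \<le> real (Suc n) * cmod w ^ n * (C * r ^ n * norm x)"
      by (intro mult_left_mono C) auto
    finally show "norm (norm (sc (of_nat (Suc n) * w ^ n) ((K ^^ n) x))) \<le> C * norm x * (real (Suc n) * (cmod w * r) ^ n)"
      by (simp add: power_mult_distrib mult_ac)
  qed
qed

lemma summable_resolvent:
  assumes "growth r" "cmod w * r < 1"
  shows "summable (\<lambda>n. norm (sc (w ^ n) ((K ^^ n) x)))"
proof (rule summable_comparison_test'[OF summable_weighted[OF assms, of x]])
  fix n
  have "1 * cmod w ^ n * norm ((K ^^ n) x) \<le> real (Suc n) * cmod w ^ n * norm ((K ^^ n) x)"
    by (intro mult_right_mono) auto
  then show "norm (norm (sc (w ^ n) ((K ^^ n) x))) \<le> norm (sc (of_nat (Suc n) * w ^ n) ((K ^^ n) x))"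
    by (simp only: norm_sc norm_mult norm_power norm_of_nat real_norm_def abs_mult abs_norm_cancel)
       (simp add: abs_mult)
qed

lemma resolvent_sums:
  assumes "growth r" "cmod w * r < 1"
  shows "(\<lambda>n. sc (w ^ n) ((K ^^ n) x)) sums resolvent w x"
  unfolding resolvent_def
  by (rule summable_sums[OF summable_norm_cancel[OF summable_resolvent[OF assms]]])

lemma sc_K_bounded_linear: "bounded_linear (\<lambda>y. sc w (K y))"
  using bounded_linear_compose[OF sc_bounded_linear K_bounded_linear] .

lemma resolvent_right:
  assumes "growth r" "cmod w * r < 1"
  shows "resolvent w x - sc w (K (resolvent w x)) = x"
proof -
  have "(\<lambda>n. sc w (K (sc (w ^ n) ((K ^^ n) x)))) sums sc w (K (resolvent w x))"
    by (rule bounded_linear.sums[OF sc_K_bounded_linear resolvent_sums[OF assms]])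
  then have "(\<lambda>n. sc (w ^ Suc n) ((K ^^ Suc n) x)) sums sc w (K (resolvent w x))"
    by (simp add: K_sc sc_sc)
  moreover have "(\<lambda>n. sc (w ^ Suc n) ((K ^^ Suc n) x)) sums (resolvent w x - x)"
    using resolvent_sums[OF assms, of x] sums_Suc_iff[of "\<lambda>n. sc (w ^ n) ((K ^^ n) x)"]
    by (simp del: funpow.simps(2) power_Suc)
  ultimately show ?thesis
    using sums_unique2 by (metis add_diff_cancel_left' diff_add_cancel)
qed

lemma resolvent_diff: 
  assumes "growth r" "cmod w * r < 1"
  shows "resolvent w (x - y) = resolvent w x - resolvent w y"
proof -
  have "(\<lambda>n. sc (w ^ n) ((K ^^ n) x) - sc (w ^ n) ((K ^^ n) y)) sums (resolvent w x - resolvent w y)"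
    by (rule sums_diff[OF resolvent_sums[OF assms] resolvent_sums[OF assms]])
  then have "(\<lambda>n. sc (w ^ n) ((K ^^ n) (x - y))) sums (resolvent w x - resolvent w y)"
    by (simp add: sc_diff_right[symmetric] linear_diff[OF K_pow_linear])
  then show ?thesis
    using resolvent_sums[OF assms] sums_unique2 by blast
qed

text \<open>Follows from the right inverse because \<open>K\<close> commutes with its own powers. In
  \<open>resolvent_square\<close> it recovers a vector z from \<open>z - sc w (K z)\<close>.\<close>

lemma resolvent_left:
  assumes "growth r" "cmod w * r < 1"
  shows "resolvent w (x - sc w (K x)) = x"
proof -
  have "(\<lambda>n. sc w (K (sc (w ^ n) ((K ^^ n) x)))) sums sc w (K (resolvent w x))"
    by (rule bounded_linear.sums[OF sc_K_bounded_linear resolvent_sums[OF assms]])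
  moreover have "sc w (K (sc (w ^ n) ((K ^^ n) x))) = sc (w ^ n) ((K ^^ n) (sc w (K x)))" for n
  proof -
    have "(K ^^ n) (sc w y) = sc w ((K ^^ n) y)" for y
      by (induction n) (simp_all add: K_sc)
    then show ?thesis
      by (simp add: K_sc sc_sc funpow_swap1 mult.commute)
  qed
  ultimately have "(\<lambda>n. sc (w ^ n) ((K ^^ n) (sc w (K x)))) sums sc w (K (resolvent w x))"
    by simp
  then have "resolvent w (sc w (K x)) = sc w (K (resolvent w x))"
    using resolvent_sums[OF assms] sums_unique2 by blast
  then show ?thesis
    using resolvent_right[OF assms] by (simp add: resolvent_diff[OF assms])
qed

text \<open>Avoids a Cauchy product: applying I - w K to the weighted series telescopes the weights,
  (n + 1) - n = 1, and leaves the Neumann series. The left inverse then recovers the weighted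
  sum.\<close>

lemma resolvent_square:
  assumes "growth r" "cmod w * r < 1"
  shows "(\<Sum>n. sc (of_nat (Suc n) * w ^ n) ((K ^^ n) x)) = resolvent w (resolvent w x)"
proof -
  define z where "z = (\<Sum>n. sc (of_nat (Suc n) * w ^ n) ((K ^^ n) x))"
  have z: "(\<lambda>n. sc (of_nat (Suc n) * w ^ n) ((K ^^ n) x)) sums z"
    unfolding z_def by (rule summable_sums[OF summable_norm_cancel[OF summable_weighted[OF assms]]])
  have "(\<lambda>n. sc w (K (sc (of_nat (Suc n) * w ^ n) ((K ^^ n) x)))) sums sc w (K z)"
    by (rule bounded_linear.sums[OF sc_K_bounded_linear z])
  then have "(\<lambda>n. sc (of_nat (Suc n) * w ^ Suc n) ((K ^^ Suc n) x)) sums sc w (K z)"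
    by (simp add: K_sc sc_sc mult_ac)
  \<comment> \<open>The term of index 0 that the shift adds has weight 0, so the sum is
    unchanged.\<close>
  then have "(\<lambda>n. sc (of_nat n * w ^ n) ((K ^^ n) x)) sums sc w (K z)"
    using sums_Suc_iff[of "\<lambda>n. sc (of_nat n * w ^ n) ((K ^^ n) x)" "sc w (K z)"]
    by (simp del: funpow.simps(2) power_Suc of_nat_Suc)
  from sums_diff[OF z this]
  have "(\<lambda>n. sc (w ^ n) ((K ^^ n) x)) sums (z - sc w (K z))"
    by (simp add: distrib_right sc_add_left)
  then have "z - sc w (K z) = resolvent w x"
    using resolvent_sums[OF assms] sums_unique2 by blast
  then show ?thesis
    using resolvent_left[OF assms, of z] by (simp add: z_def)
qed

text \<open>An unbounded resolvent produces approximate eigenvectors, which compactness turns into an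
  eigenvector.\<close>

lemma resolvent_bound:
  assumes \<rho>: "1 \<le> \<rho>" "\<And>r. \<rho> < r \<Longrightarrow> growth r"
    and no_ev: "\<And>z y. cmod z \<ge> 1 \<Longrightarrow> K y = sc z y \<Longrightarrow> y = 0"
  obtains M where "M > 0" "\<And>w x. cmod w * \<rho> < 1 \<Longrightarrow> norm (resolvent w x) \<le> M * norm x"
proof -
  have "\<exists>M>0. \<forall>w x. cmod w * \<rho> < 1 \<longrightarrow> norm (resolvent w x) \<le> M * norm x"
  proof (rule ccontr)
    assume "\<not> ?thesis"
    then have "\<exists>w x. cmod w * \<rho> < 1 \<and> norm (resolvent w x) > real (Suc n) * norm x" for n
      by (metis not_le of_nat_0_less_iff zero_less_Suc)
    then obtain W X where W: "\<And>n. cmod (W n) * \<rho> < 1"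
      and X: "\<And>n. norm (resolvent (W n) (X n)) > real (Suc n) * norm (X n)"
      by metis
    define c where "c n = norm (resolvent (W n) (X n))" for n
    have c: "c n > 0" for n
      using X[of n] unfolding c_def by (metis less_le_trans mult_nonneg_nonneg norm_ge_zero of_nat_0_le_iff not_less)
    define Y where "Y n = inverse (c n) *\<^sub>R resolvent (W n) (X n)" for n
    have Y: "norm (Y n) = 1" for n
      using c[of n] by (simp add: Y_def c_def)
    have eq: "Y n - sc (W n) (K (Y n)) = inverse (c n) *\<^sub>R X n" for n
    proof -
      \<comment> \<open>Growth is available only for rates strictly above \<rho>; the strict
        inequality for \<open>W n\<close> leaves room for one.\<close>
      obtain r where r: "\<rho> < r" "cmod (W n) * r < 1"
      proof -
        have "((\<lambda>r. cmod (W n) * r) \<longlongrightarrow> cmod (W n) * \<rho>) (at_right \<rho>)"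
          by (intro tendsto_intros)
        then have "eventually (\<lambda>r. cmod (W n) * r < 1) (at_right \<rho>)"
          using W[of n] by (simp add: order_tendsto_iff)
        then have "eventually (\<lambda>r. cmod (W n) * r < 1 \<and> \<rho> < r) (at_right \<rho>)"
          by (simp add: eventually_conj eventually_at_right_less)
        then show ?thesis
          using that eventually_happens'[OF trivial_limit_at_right_real] by blast
      qed
      have "sc (W n) (K (Y n)) = inverse (c n) *\<^sub>R sc (W n) (K (resolvent (W n) (X n)))"
        unfolding Y_def using linear_cmul[OF bounded_linear.linear[OF sc_K_bounded_linear]] .
      then show ?thesis
        using resolvent_right[OF \<rho>(2)[OF r(1)] r(2), of "X n"]
        by (simp add: Y_def scaleR_right_diff_distrib[symmetric])
    qed
    have small: "(\<lambda>n. inverse (c n) *\<^sub>R X n) \<longlonglongrightarrow> 0"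
    proof (rule tendsto_norm_zero_cancel, rule tendsto_sandwich[OF _ _ tendsto_const LIMSEQ_inverse_real_of_nat])
      show "\<forall>\<^sub>F n in sequentially. norm (inverse (c n) *\<^sub>R X n) \<le> inverse (real (Suc n))"
      proof (intro always_eventually allI)
        fix n
        have "real (Suc n) * norm (X n) \<le> c n"
          using X[of n] by (simp add: c_def)
        then show "norm (inverse (c n) *\<^sub>R X n) \<le> inverse (real (Suc n))"
          using c[of n] by (simp add: divide_simps mult_ac del: of_nat_Suc)
      qed
    qed simp
    obtain l r where r: "strict_mono r" "(\<lambda>n. K (Y (r n))) \<longlonglongrightarrow> l"
      using K_compact[of Y] Y by auto
    \<comment> \<open>Here \<open>1 \<le> \<rho>\<close> enters: limit points of W have modulus at
      most 1, so their inverses are among the excluded eigenvalues.\<close>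
    have "W (r n) \<in> cball 0 1" for n
    proof -
      have "cmod (W (r n)) * 1 \<le> cmod (W (r n)) * \<rho>"
        using \<rho>(1) by (intro mult_left_mono) auto
      then show ?thesis
        using W[of "r n"] by simp
    qed
    then obtain w s where s: "w \<in> cball 0 1" "strict_mono s" "(W \<circ> r \<circ> s) \<longlonglongrightarrow> w"
      using compact_cball[of "0::complex" 1, unfolded compact_def, rule_format, of "W \<circ> r"] by auto
    have Kl: "(\<lambda>n. K (Y (r (s n)))) \<longlonglongrightarrow> l"
      using LIMSEQ_subseq_LIMSEQ[OF r(2) s(2)] by (simp add: o_def)
    have rs: "strict_mono (r \<circ> s)"
      using r(1) s(2) by (rule strict_mono_o)
    \<comment> \<open>Solving \<open>eq\<close> for Y writes it as a sum of two convergent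
      sequences. Hence Y itself converges, not only its image under K, and its limit keeps norm
      1.\<close>
    have "(\<lambda>n. inverse (c (r (s n))) *\<^sub>R X (r (s n)) + sc (W (r (s n))) (K (Y (r (s n))))) \<longlonglongrightarrow> 0 + sc w l"
      using LIMSEQ_subseq_LIMSEQ[OF small rs] Kl s(3)
      by (intro tendsto_add sc_tendsto) (simp_all add: o_def)
    then have Ylim: "(\<lambda>n. Y (r (s n))) \<longlonglongrightarrow> sc w l"
      unfolding eq[symmetric] by simp
    have "(\<lambda>n. norm (Y (r (s n)))) \<longlonglongrightarrow> norm (sc w l)"
      using Ylim by (rule tendsto_norm)
    then have n1: "norm (sc w l) = 1"
      unfolding Y by (simp add: LIMSEQ_const_iff)
    then have w0: "w \<noteq> 0"
      by auto
    have "(\<lambda>n. K (Y (r (s n)))) \<longlonglongrightarrow> K (sc w l)"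
      using Ylim by (rule bounded_linear.tendsto[OF K_bounded_linear])
    then have "K (sc w l) = l"
      using Kl LIMSEQ_unique by blast
    then have "K (sc w l) = sc (inverse w) (sc w l)"
      using w0 by (simp add: sc_sc)
    moreover have "cmod (inverse w) \<ge> 1"
      using s(1) w0 by (simp add: norm_inverse one_le_inverse)
    ultimately show False
      using no_ev[of "inverse w" "sc w l"] n1 by simp
  qed
  then show ?thesis
    using that by blast
qed

theorem exponentially_stable:
  assumes no_ev: "\<And>z y. cmod z \<ge> 1 \<Longrightarrow> K y = sc z y \<Longrightarrow> y = 0"
  obtains q where "q < 1" "growth q"
proof -
  define \<rho> where "\<rho> = Inf (Collect growth)"
  have nonempty: "Collect growth \<noteq> {}"
  proof -
    obtain L where "L > 0" "\<And>x. norm (K x) \<le> norm x * L"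
      using bounded_linear.pos_bounded[OF K_bounded_linear] by blast
    then have "growth L"
      using growthI[of L 1] by (simp add: mult.commute)
    then show ?thesis by blast
  qed
  have bdd: "bdd_below (Collect growth)"
    by (rule bdd_belowI[of _ 0]) (auto simp: growth_def)
  have "\<rho> < 1"
  proof (rule ccontr)
    assume "\<not> \<rho> < 1"
    then have \<rho>: "1 \<le> \<rho>" by simp
    \<comment> \<open>The infimum itself is not known to be a growth rate, so only rates strictly
      above it are used.\<close>
    have above: "growth r" if "\<rho> < r" for r
    proof -
      have "\<exists>r'. growth r' \<and> r' < r"
        using cInf_lessD[OF nonempty, of r] that by (simp add: \<rho>_def)
      then obtain r' where r': "growth r'" "r' < r"
        by blast
      obtain C where C: "\<And>n x. norm ((K ^^ n) x) \<le> C * r' ^ n * norm x"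
        using r' by (auto simp: growth_def)
      have "norm ((K ^^ n) x) \<le> \<bar>C\<bar> * r ^ n * norm x" for n x
      proof -
        have "C * r' ^ n \<le> \<bar>C\<bar> * r ^ n"
          using r' growth_pos[OF r'(1)] by (intro mult_mono power_mono) auto
        then show ?thesis
          using C[of n x] by (meson mult_right_mono norm_ge_zero order_trans)
      qed
      then show ?thesis
        using r' growth_pos[OF r'(1)] by (auto simp: growth_def)
    qed
    obtain M where M: "M > 0" "\<And>w x. cmod w * \<rho> < 1 \<Longrightarrow> norm (resolvent w x) \<le> M * norm x"
      using resolvent_bound[of \<rho>, OF \<rho> above] no_ev by blast
    have decay: "real (Suc n) * norm ((K ^^ n) x) \<le> M\<^sup>2 * \<rho> ^ n * norm x" for n x
    proof -
      \<comment> \<open>On the circle of radius 1/r with r > \<rho> the series converges absolutely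
        and the resolvent bound applies. Since M does not depend on r, the limit r -> \<rho> can be
        taken afterwards.\<close>
      have step: "real (Suc n) * norm ((K ^^ n) x) \<le> M\<^sup>2 * r ^ n * norm x" if r: "\<rho> < r" for r
      proof -
        obtain r' where r': "\<rho> < r'" "r' < r"
          using dense[OF r] by blast
        have pos: "0 < r" "0 < r'" using \<rho> r' by linarith+
        \<comment> \<open>Rescaling by 1/r turns the circle of radius 1/r into the unit circle on
          which \<open>power_series_coeff_bound\<close> averages.\<close>
        define a where "a k = sc (of_nat (Suc k) * complex_of_real (1 / r) ^ k) ((K ^^ k) x)" for k
        have lt: "cmod (complex_of_real (1 / r)) * r' < 1"
          using r' pos by (simp add: field_simps norm_divide)
        have "norm (a n) \<le> M * (M * norm x)"
        proof (rule power_series_coeff_bound)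
          show "summable (\<lambda>k. norm (a k))"
            unfolding a_def using summable_weighted[OF above[OF r'(1)] lt] .
          fix w :: complex assume w: "cmod w = 1"
          define v where "v = w * complex_of_real (1 / r)"
          have v: "cmod v * r' < 1" "cmod v * \<rho> < 1"
            using r' r pos w \<rho> by (simp_all add: v_def norm_mult norm_divide field_simps)
          have "(\<Sum>k. sc (w ^ k) (a k)) = (\<Sum>k. sc (of_nat (Suc k) * v ^ k) ((K ^^ k) x))"
            unfolding a_def v_def sc_sc by (simp only: power_mult_distrib mult_ac)
          also have "\<dots> = resolvent v (resolvent v x)"
            by (rule resolvent_square[OF above[OF r'(1)] v(1)])
          also have "norm \<dots> \<le> M * norm (resolvent v x)"
            by (rule M(2)[OF v(2)])
          also have "\<dots> \<le> M * (M * norm x)"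
            using M(1) M(2)[OF v(2)] by simp
          finally show "norm (\<Sum>k. sc (w ^ k) (a k)) \<le> M * (M * norm x)" .
        qed
        moreover have "norm (a n) = real (Suc n) * norm ((K ^^ n) x) / r ^ n"
          using pos unfolding a_def norm_sc norm_mult norm_of_nat norm_power
          by (simp add: norm_divide power_divide)
        ultimately show ?thesis
          using pos by (simp add: field_simps power2_eq_square)
      qed
      have "((\<lambda>r. M\<^sup>2 * r ^ n * norm x) \<longlongrightarrow> M\<^sup>2 * \<rho> ^ n * norm x) (at_right \<rho>)"
        by (intro tendsto_intros)
      then show ?thesis
      proof (rule tendsto_lowerbound)
        show "\<forall>\<^sub>F r in at_right \<rho>. real (Suc n) * norm ((K ^^ n) x) \<le> M\<^sup>2 * r ^ n * norm x"
          using eventually_at_right_less[of \<rho>] by eventually_elim (rule step)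
      qed simp
    qed
    \<comment> \<open>For such N the estimate \<open>decay\<close> bounds the norm of
      \<open>K ^^ N\<close> by half of \<open>\<rho> ^ N\<close>; the N-th root of 1/2 is then the
      gain in the rate.\<close>
    obtain N where N: "2 * M\<^sup>2 \<le> real (Suc N)" "N > 0"
    proof -
      obtain N0 :: nat where "2 * M\<^sup>2 \<le> real N0"
        using real_arch_simple by blast
      then show ?thesis
        using that[of "Suc N0"] by simp
    qed
    define c where "c = \<rho> * root N (1 / 2)"
    have cN: "c ^ N = \<rho> ^ N / 2"
      using N by (simp add: c_def power_mult_distrib)
    have "norm ((K ^^ N) x) \<le> c ^ N * norm x" for x
    proof -
      have "2 * M\<^sup>2 * norm ((K ^^ N) x) \<le> real (Suc N) * norm ((K ^^ N) x)"
        using N by (intro mult_right_mono) auto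
      also have "\<dots> \<le> M\<^sup>2 * \<rho> ^ N * norm x"
        by (rule decay)
      finally have "M\<^sup>2 * (2 * norm ((K ^^ N) x)) \<le> M\<^sup>2 * (\<rho> ^ N * norm x)"
        by (simp add: mult_ac)
      then have "2 * norm ((K ^^ N) x) \<le> \<rho> ^ N * norm x"
        using M(1) by simp
      then show ?thesis
        by (simp add: cN)
    qed
    moreover have "0 < c"
      using \<rho> N by (simp add: c_def)
    ultimately have "growth c"
      using growthI N by blast
    then have "\<rho> \<le> c"
      unfolding \<rho>_def using bdd by (intro cInf_lower) auto
    moreover have "root N (1 / 2) < 1"
      using N by simp
    ultimately show False
      using \<rho> by (simp add: c_def)
  qed
  then have "\<exists>q. growth q \<and> q < 1"
    using cInf_lessD[OF nonempty, of 1] by (simp add: \<rho>_def)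
  then obtain q where "growth q" "q < 1"
    by blast
  then show ?thesis
    using that by blast
qed

text \<open>Discrete variation of constants: the orbit is the free orbit plus a convolution of the
  perturbation with powers of \<open>K\<close>. The norms are dominated by a scalar convolution that
  obeys a first-order recursion with factor q < 1.\<close>

theorem perturbed_orbit_tendsto_zero:
  assumes q: "q < 1" "growth q"
    and x: "\<And>n. x (Suc n) = K (x n) + w n" and w: "w \<longlonglongrightarrow> 0"
  shows "x \<longlonglongrightarrow> 0"
proof -
  obtain C where C: "\<And>n y. norm ((K ^^ n) y) \<le> C * q ^ n * norm y" and q0: "0 < q"
    using q by (auto simp: growth_def)
  define c where "c n = (\<Sum>j<n. q ^ (n - 1 - j) * norm (w j))" for n
  have c_Suc: "c (Suc n) = q * c n + norm (w n)" for n
  proof -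
    have "(\<Sum>j<n. q ^ (n - j) * norm (w j)) = q * c n"
      unfolding c_def sum_distrib_left
    proof (rule sum.cong[OF refl])
      fix j assume "j \<in> {..<n}"
      then have "n - j = Suc (n - 1 - j)" by auto
      then show "q ^ (n - j) * norm (w j) = q * (q ^ (n - 1 - j) * norm (w j))"
        by simp
    qed
    then show ?thesis by (simp add: c_def)
  qed
  have c0: "c n \<ge> 0" for n
    using q0 by (auto simp: c_def intro!: sum_nonneg)
  have variation: "x n = (K ^^ n) (x 0) + (\<Sum>j<n. (K ^^ (n - 1 - j)) (w j))" for n
  proof (induction n)
    case (Suc n)
    have "K (\<Sum>j<n. (K ^^ (n - 1 - j)) (w j)) = (\<Sum>j<n. (K ^^ (n - j)) (w j))"
      unfolding linear_sum[OF bounded_linear.linear[OF K_bounded_linear]]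
    proof (rule sum.cong[OF refl])
      fix j assume "j \<in> {..<n}"
      then have "n - j = Suc (n - 1 - j)" by auto
      then show "K ((K ^^ (n - 1 - j)) (w j)) = (K ^^ (n - j)) (w j)"
        by simp
    qed
    then show ?case
      using x[of n] Suc by (simp add: linear_add[OF bounded_linear.linear[OF K_bounded_linear]])
  qed simp
  have bound: "norm (x n) \<le> C * (q ^ n * norm (x 0) + c n)" for n
  proof -
    have "norm (x n) \<le> norm ((K ^^ n) (x 0)) + (\<Sum>j<n. norm ((K ^^ (n - 1 - j)) (w j)))"
      unfolding variation[of n] by (intro norm_triangle_le add_mono norm_sum order_refl)
    also have "\<dots> \<le> C * q ^ n * norm (x 0) + (\<Sum>j<n. C * q ^ (n - 1 - j) * norm (w j))"
      by (intro add_mono C sum_mono)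
    finally show ?thesis
      by (simp add: c_def sum_distrib_left algebra_simps)
  qed
  have "c \<longlonglongrightarrow> 0"
  proof (rule LIMSEQ_I)
    fix e :: real assume e: "0 < e"
    \<comment> \<open>d is the fixed point of s \<mapsto> q s + d (1 - q). Once the perturbation
      stays below d (1 - q), the part of the bound on c beyond d shrinks by the factor q at each
      step.\<close>
    define d where "d = e / 2"
    have "0 < d * (1 - q)" "0 < d" using e q by (auto simp: d_def)
    then obtain N where N: "\<And>n. n \<ge> N \<Longrightarrow> norm (w n) < d * (1 - q)"
      using LIMSEQ_D[OF w, of "d * (1 - q)"] by auto
    have tail: "c (N + n) \<le> q ^ n * c N + d" for n
    proof (induction n)
      case (Suc n)
      have "c (N + Suc n) \<le> q * (q ^ n * c N + d) + d * (1 - q)"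
        using c_Suc[of "N + n"] N[of "N + n"] mult_left_mono[OF Suc, of q] q0
        by (simp add: add_mono)
      then show ?case by (simp add: algebra_simps)
    qed (use \<open>0 < d\<close> in simp)
    have "(\<lambda>n. q ^ n * c N + d) \<longlonglongrightarrow> 0 * c N + d"
      using q q0 by (intro tendsto_intros LIMSEQ_realpow_zero) auto
    then have "\<forall>\<^sub>F n in sequentially. q ^ n * c N + d < e"
      using e by (auto simp: order_tendsto_iff d_def)
    then obtain N' where N': "\<And>n. n \<ge> N' \<Longrightarrow> q ^ n * c N + d < e"
      by (auto simp: eventually_sequentially)
    show "\<exists>no. \<forall>n\<ge>no. norm (c n - 0) < e"
    proof (intro exI allI impI)
      fix n assume "n \<ge> N + N'"
      then have "n - N \<ge> N'" "N + (n - N) = n"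
        by auto
      then have "c n < e"
        using tail[of "n - N"] N'[of "n - N"] by simp
      then show "norm (c n - 0) < e"
        using c0[of n] by simp
    qed
  qed
  then have "(\<lambda>n. C * (q ^ n * norm (x 0) + c n)) \<longlonglongrightarrow> C * (0 * norm (x 0) + 0)"
    using q q0 by (intro tendsto_intros LIMSEQ_realpow_zero) auto
  then have "(\<lambda>n. C * (q ^ n * norm (x 0) + c n)) \<longlonglongrightarrow> 0"
    by simp
  then show ?thesis
    by (rule Lim_null_comparison[OF always_eventually, rotated]) (simp add: bound)
qed

end

section \<open>The operator exponential and variation of constants\<close>

lemma AE_not_in_finite: "finite Z \<Longrightarrow> AE s in lborel. (s::real) \<notin> Z"
  using AE_not_in[OF finite_imp_null_set_lborel] .

text \<open>Valid for every h, since a non-integrable function has integral 0 by convention. The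
  finite set Z later holds the break points of a kernel section.\<close>

lemma set_integral_norm_le:
  fixes h :: "real \<Rightarrow> 'a::{banach, second_countable_topology}"
  assumes "a \<le> b" "0 \<le> e" "finite Z" "\<And>s. s \<in> {a..b} - Z \<Longrightarrow> norm (h s) \<le> e"
  shows "norm (LINT s:{a..b}|lborel. h s) \<le> e * (b - a)"
proof -
  have "norm (LINT s:{a..b}|lborel. h s) \<le> (\<integral>s. norm (indicator {a..b} s *\<^sub>R h s) \<partial>lborel)"
    unfolding set_lebesgue_integral_def by (rule integral_norm_bound)
  also have "\<dots> \<le> (\<integral>s. indicator {a..b} s * e \<partial>lborel)"
  proof (rule integral_mono_AE')
    have "integrable lborel (\<lambda>s. indicator {a..b} s :: real)"
      using assms(1) by (simp add: integrable_indicator_iff)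
    then show "integrable lborel (\<lambda>s. indicator {a..b} s * e)"
      by simp
    show "AE s in lborel. norm (indicator {a..b} s *\<^sub>R h s) \<le> indicator {a..b} s * e"
      using AE_not_in_finite[OF assms(3)]
      by eventually_elim (use assms in \<open>auto simp: indicator_def\<close>)
  qed (use assms in auto)
  also have "\<dots> = e * (b - a)"
    using assms by simp
  finally show ?thesis .
qed

lemma set_integrable_piecewise:
  fixes h :: "real \<Rightarrow> 'a::{banach, second_countable_topology}"
  assumes Z: "finite Z" and cont: "continuous_on ({a..b} - Z) h"
    and bound: "\<And>s. s \<in> {a..b} - Z \<Longrightarrow> norm (h s) \<le> C"
  shows "set_integrable lborel {a..b} h"
  unfolding set_integrable_def
proof (rule Bochner_Integration.integrable_bound)
  have "emeasure lborel {a..b} < top"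
    by (cases "a \<le> b") auto
  then have "integrable lborel (\<lambda>s. indicator {a..b} s :: real)"
    by (simp add: integrable_indicator_iff)
  then show "integrable lborel (\<lambda>s. indicator {a..b} s * C)"
    by simp
  have "{a..b} - Z \<in> sets borel"
    by (rule sets.Diff[OF borel_closed[OF closed_atLeastAtMost] borel_closed[OF finite_imp_closed[OF Z]]])
  then have "(\<lambda>s. indicator ({a..b} - Z) s *\<^sub>R h s) \<in> borel_measurable borel"
    using cont by (rule borel_measurable_continuous_on_indicator)
  then have "(\<lambda>s. indicator {a..b} s *\<^sub>R h s) \<in> borel_measurable borel"
    by (rule measurable_discrete_difference[where X = Z])
      (use Z in \<open>auto simp: indicator_def uncountable_infinite countable_finite\<close>)
  then show "(\<lambda>s. indicator {a..b} s *\<^sub>R h s) \<in> borel_measurable lborel"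
    by simp
  show "AE s in lborel. norm (indicator {a..b} s *\<^sub>R h s) \<le> norm (indicator {a..b} s * C)"
    using AE_not_in_finite[OF Z]
    by eventually_elim (use bound in \<open>fastforce simp: indicator_def\<close>)
qed

lemma set_integral_split:
  fixes h :: "real \<Rightarrow> 'a::{banach, second_countable_topology}"
  assumes "a \<le> b" "b \<le> c" "set_integrable lborel {a..c} h"
  shows "(LINT s:{a..c}|lborel. h s) = (LINT s:{a..b}|lborel. h s) + (LINT s:{b..c}|lborel. h s)"
proof -
  have "interval_lebesgue_integrable lborel a c h"
    unfolding interval_lebesgue_integrable_def
    using assms by (auto intro: set_integrable_subset)
  then have "(LBINT s=a..b. h s) + (LBINT s=b..c. h s) = (LBINT s=a..c. h s)"
    using assms by (intro interval_integral_sum) (simp add: min_def max_def)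
  then show ?thesis
    using assms by (simp add: interval_integral_Icc)
qed

text \<open>Near t the error of the linear approximation is an integral of \<open>h s - h t\<close>,
  whose integrand is uniformly small. Derivatives are taken within the half-line, so the endpoint a
  is covered.\<close>

lemma set_integral_has_vector_derivative:
  fixes h :: "real \<Rightarrow> 'a::{banach, second_countable_topology}"
  assumes h: "continuous_on {a..} h" and t: "a \<le> t"
  shows "((\<lambda>t. LINT s:{a..t}|lborel. h s) has_vector_derivative h t) (at t within {a..})"
  unfolding has_vector_derivative_def has_derivative_within_alt
proof (intro conjI allI impI)
  fix e :: real assume e: "0 < e"
  obtain d where d: "0 < d" "\<And>s. s \<in> {a..} \<Longrightarrow> dist s t < d \<Longrightarrow> dist (h s) (h t) < e"
    using h t e unfolding continuous_on_iff by (metis atLeast_iff)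
  have int: "set_integrable lborel {b..c} h" if "a \<le> b" for b c
    using that by (intro borel_integrable_atLeastAtMost' continuous_on_subset[OF h] subsetI) auto
  have near: "norm ((LINT s:{b..c}|lborel. h s) - (c - b) *\<^sub>R h t) \<le> e * (c - b)"
    if "a \<le> b" "b \<le> c" "\<And>s. s \<in> {b..c} \<Longrightarrow> \<bar>s - t\<bar> < d" for b c
  proof -
    have "(LINT s:{b..c}|lborel. h s - h t) = (LINT s:{b..c}|lborel. h s) - (LINT s:{b..c}|lborel. h t)"
      by (rule set_integral_diff(2)[OF int[OF that(1)] borel_integrable_atLeastAtMost']) simp
    moreover have "(LINT s:{b..c}|lborel. h t) = (c - b) *\<^sub>R h t"
      using that by (simp add: set_lebesgue_integral_def)
    moreover have "norm (LINT s:{b..c}|lborel. h s - h t) \<le> e * (c - b)"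
    proof (rule set_integral_norm_le[where Z = "{}"])
      fix s assume "s \<in> {b..c} - {}"
      then show "norm (h s - h t) \<le> e"
        using d(2)[of s] that by (force simp: dist_norm)
    qed (use that e in auto)
    ultimately show ?thesis
      by simp
  qed
  show "\<exists>d>0. \<forall>y\<in>{a..}. norm (y - t) < d \<longrightarrow>
      norm ((LINT s:{a..y}|lborel. h s) - (LINT s:{a..t}|lborel. h s) - (y - t) *\<^sub>R h t) \<le> e * norm (y - t)"
  proof (intro exI[of _ d] conjI ballI impI)
    fix y assume y: "y \<in> {a..}" "norm (y - t) < d"
    show "norm ((LINT s:{a..y}|lborel. h s) - (LINT s:{a..t}|lborel. h s) - (y - t) *\<^sub>R h t) \<le> e * norm (y - t)"
    proof (cases "t \<le> y")
      case True
      then show ?thesis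
        using near[of t y] set_integral_split[of a t y h] int t y by auto
    next
      case False
      \<comment> \<open>Set integrals carry no orientation, so increments to the left of t are
        estimated separately and enter with the opposite sign.\<close>
      then have "norm ((LINT s:{y..t}|lborel. h s) - (t - y) *\<^sub>R h t) \<le> e * (t - y)"
        using near[of y t] y by auto
      moreover have "(LINT s:{a..y}|lborel. h s) - (LINT s:{a..t}|lborel. h s) - (y - t) *\<^sub>R h t
          = - ((LINT s:{y..t}|lborel. h s) - (t - y) *\<^sub>R h t)"
        using set_integral_split[of a y t h] int False y by (simp add: algebra_simps)
      ultimately show ?thesis
        using False by (simp only: norm_minus_cancel) simp
    qed
  qed (rule d)
qed (rule bounded_linear_scaleR_left)

section \<open>Series of exponential type\<close>

lemma exp_series_summable:
  fixes P :: "nat \<Rightarrow> 'b::banach"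
  assumes "\<And>n. norm (P n) \<le> C * L ^ n" "\<bar>t\<bar> \<le> R"
  shows "norm ((t ^ n / fact n) *\<^sub>R P n) \<le> C * ((R * L) ^ n / fact n)"
    and "summable (\<lambda>n. C * ((R * L) ^ n / fact n))"
proof -
  have "norm ((t ^ n / fact n) *\<^sub>R P n) = (\<bar>t\<bar> ^ n / fact n) * norm (P n)"
    by (simp add: power_abs)
  also have "\<dots> \<le> (R ^ n / fact n) * (C * L ^ n)"
    using assms by (intro mult_mono divide_right_mono power_mono) auto
  finally show "norm ((t ^ n / fact n) *\<^sub>R P n) \<le> C * ((R * L) ^ n / fact n)"
    by (simp add: power_mult_distrib mult_ac)
  show "summable (\<lambda>n. C * ((R * L) ^ n / fact n))"
    using summable_exp[of "R * L"] by (intro summable_mult) (simp add: field_simps)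
qed

text \<open>Formulated for any sequence of geometric growth, because this class is closed under
  differentiation: the derivative is the same series for the shifted sequence. Uniform convergence
  on a bounded interval justifies differentiating termwise.\<close>

lemma exp_series_has_vector_derivative:
  fixes P :: "nat \<Rightarrow> 'b::banach"
  assumes P: "\<And>n. norm (P n) \<le> C * L ^ n"
  shows "((\<lambda>t. \<Sum>n. (t ^ n / fact n) *\<^sub>R P n) has_vector_derivative
    (\<Sum>n. (t ^ n / fact n) *\<^sub>R P (Suc n))) (at t)"
proof -
  define R where "R = \<bar>t\<bar> + 1"
  define S where "S = {-R<..<R}"
  have S: "open S" "convex S" "t \<in> S" "\<And>x. x \<in> S \<Longrightarrow> \<bar>x\<bar> \<le> R"
    by (auto simp: S_def R_def)
  have P': "norm (P (Suc n)) \<le> (C * L) * L ^ n" for n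
    using P[of "Suc n"] by (simp add: mult_ac)
  have unif: "uniform_limit S (\<lambda>n x. \<Sum>i<n. (x ^ i / fact i) *\<^sub>R P (Suc i))
      (\<lambda>x. \<Sum>i. (x ^ i / fact i) *\<^sub>R P (Suc i)) sequentially"
    by (rule Weierstrass_m_test[OF exp_series_summable(1)[of "\<lambda>n. P (Suc n)", OF P' S(4)]
          exp_series_summable(2)[of "\<lambda>n. P (Suc n)", OF P' S(4)[OF S(3)]]])
  have "\<exists>g. \<forall>x\<in>S. (\<lambda>n. (x ^ n / fact n) *\<^sub>R P n) sums (g x) \<and>
      (g has_derivative (\<lambda>h. h *\<^sub>R (\<Sum>n. (x ^ n / fact n) *\<^sub>R P (Suc n)))) (at x within S)"
  proof (rule has_derivative_series[where f' = "\<lambda>n x h. h *\<^sub>R ((real n * x ^ (n - 1) / fact n) *\<^sub>R P n)"])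
    show "((\<lambda>x. (x ^ n / fact n) *\<^sub>R P n) has_derivative (\<lambda>h. h *\<^sub>R (real n * x ^ (n - 1) / fact n) *\<^sub>R P n))
        (at x within S)" for n x
      by (auto intro!: derivative_eq_intros simp: mult_ac)
    show "\<forall>\<^sub>F n in sequentially. \<forall>x\<in>S. \<forall>h. norm ((\<Sum>i<n. h *\<^sub>R (real i * x ^ (i - 1) / fact i) *\<^sub>R P i)
        - h *\<^sub>R (\<Sum>n. (x ^ n / fact n) *\<^sub>R P (Suc n))) \<le> e * norm h" if "e > 0" for e
    proof -
      obtain N where N: "\<And>n x. n \<ge> N \<Longrightarrow> x \<in> S \<Longrightarrow>
          norm ((\<Sum>i<n. (x ^ i / fact i) *\<^sub>R P (Suc i)) - (\<Sum>i. (x ^ i / fact i) *\<^sub>R P (Suc i))) < e"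
        using uniform_limitD[OF unif \<open>e > 0\<close>] by (auto simp: eventually_sequentially dist_norm)
      \<comment> \<open>The constant term differentiates to 0, so n + 1 terms of the derived series
        are n terms of the shifted one; hence the threshold \<open>Suc N\<close> below.\<close>
      have shift: "(\<Sum>i<Suc n. h *\<^sub>R (real i * x ^ (i - 1) / fact i) *\<^sub>R P i)
          = h *\<^sub>R (\<Sum>i<n. (x ^ i / fact i) *\<^sub>R P (Suc i))" for n h x
      proof -
        have "(\<Sum>i<Suc n. h *\<^sub>R (real i * x ^ (i - 1) / fact i) *\<^sub>R P i)
            = (\<Sum>i<n. h *\<^sub>R (real (Suc i) * x ^ i / fact (Suc i)) *\<^sub>R P (Suc i))"
          by (subst sum.lessThan_Suc_shift) simp
        then show ?thesis
          by (simp add: scaleR_sum_right del: of_nat_Suc)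
      qed
      have "norm ((\<Sum>i<n. h *\<^sub>R (real i * x ^ (i - 1) / fact i) *\<^sub>R P i)
          - h *\<^sub>R (\<Sum>n. (x ^ n / fact n) *\<^sub>R P (Suc n))) \<le> e * norm h"
        if "n \<ge> Suc N" "x \<in> S" for n x h
      proof -
        obtain k where k: "n = Suc k" "k \<ge> N"
          using \<open>n \<ge> Suc N\<close> by (cases n) auto
        have "norm (h *\<^sub>R ((\<Sum>i<k. (x ^ i / fact i) *\<^sub>R P (Suc i)) - (\<Sum>i. (x ^ i / fact i) *\<^sub>R P (Suc i)))) \<le> e * norm h"
          using less_imp_le[OF N[OF k(2) that(2)]] by (simp add: mult_left_mono mult.commute[of e])
        then show ?thesis
          by (simp only: k shift scaleR_diff_right)
      qed
      then show ?thesis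
        unfolding eventually_sequentially by blast
    qed
    show "(\<lambda>n. (t ^ n / fact n) *\<^sub>R P n) sums (\<Sum>n. (t ^ n / fact n) *\<^sub>R P n)"
      by (rule summable_sums[OF summable_comparison_test'[OF exp_series_summable(2,1)[OF P S(4)[OF S(3)]]]])
  qed (use S in auto)
  then obtain g where g: "\<And>x. x \<in> S \<Longrightarrow> (\<lambda>n. (x ^ n / fact n) *\<^sub>R P n) sums (g x)"
    "(g has_derivative (\<lambda>h. h *\<^sub>R (\<Sum>n. (t ^ n / fact n) *\<^sub>R P (Suc n)))) (at t within S)"
    using S(3) by blast
  have "(g has_vector_derivative (\<Sum>n. (t ^ n / fact n) *\<^sub>R P (Suc n))) (at t)"
    using g(2) unfolding has_vector_derivative_def at_within_open[OF S(3,1)] .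
  then show ?thesis
    using S(1,3) by (rule has_vector_derivative_transform_within_open) (rule sums_unique[OF g(1)])
qed

section \<open>The exponential of a bounded operator\<close>

lemma blinfun_compose_assoc: "(F o\<^sub>L G) o\<^sub>L H = F o\<^sub>L (G o\<^sub>L H)"
  by (rule blinfun_eqI) simp

lemmas blinfun_compose_simps =
  bounded_bilinear.scaleR_left[OF bounded_bilinear_blinfun_compose]
  bounded_bilinear.scaleR_right[OF bounded_bilinear_blinfun_compose]
  bounded_bilinear.minus_left[OF bounded_bilinear_blinfun_compose]

definition blinfun_pow :: "('x::real_normed_vector \<Rightarrow>\<^sub>L 'x) \<Rightarrow> nat \<Rightarrow> 'x \<Rightarrow>\<^sub>L 'x" where
  "blinfun_pow A n = ((\<lambda>F. A o\<^sub>L F) ^^ n) id_blinfun"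

lemma blinfun_pow_Suc: "blinfun_pow A (Suc n) = A o\<^sub>L blinfun_pow A n"
  by (simp add: blinfun_pow_def)

lemma blinfun_pow_Suc2: "blinfun_pow A (Suc n) = blinfun_pow A n o\<^sub>L A"
proof (induction n)
  case 0
  have "A o\<^sub>L id_blinfun = id_blinfun o\<^sub>L A"
    by (rule blinfun_eqI) simp
  then show ?case
    by (simp add: blinfun_pow_def)
next
  case (Suc n)
  then show ?case
    by (metis blinfun_compose_assoc blinfun_pow_Suc)
qed

lemma blinfun_pow_apply: "blinfun_pow A n x = (blinfun_apply A ^^ n) x"
  by (induction n) (simp_all add: blinfun_pow_def)

lemma norm_blinfun_pow: "norm (blinfun_pow A n) \<le> 1 * norm A ^ n"
proof (induction n)
  case 0
  then show ?case
    by (simp add: blinfun_pow_def norm_blinfun_id_le)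
next
  case (Suc n)
  have "norm (blinfun_pow A (Suc n)) \<le> norm A * norm (blinfun_pow A n)"
    unfolding blinfun_pow_Suc by (rule norm_blinfun_compose)
  also have "\<dots> \<le> norm A * (1 * norm A ^ n)"
    by (rule mult_left_mono[OF Suc]) simp
  finally show ?case by simp
qed

text \<open>\<open>exp_op\<close> is a pointwise series; the same series in operator norm can be
  composed and differentiated as an operator-valued function of time.\<close>

definition exp_blinfun :: "('x::banach \<Rightarrow>\<^sub>L 'x) \<Rightarrow> real \<Rightarrow> 'x \<Rightarrow>\<^sub>L 'x" where
  "exp_blinfun A t = (\<Sum>n. (t ^ n / fact n) *\<^sub>R blinfun_pow A n)"

lemma exp_blinfun_summable:
  fixes A :: "'x::banach \<Rightarrow>\<^sub>L 'x"
  shows "summable (\<lambda>n. (t ^ n / fact n) *\<^sub>R blinfun_pow A n)"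
proof (rule summable_comparison_test')
  show "norm ((t ^ n / fact n) *\<^sub>R blinfun_pow A n) \<le> 1 * ((\<bar>t\<bar> * norm A) ^ n / fact n)" for n
    using norm_blinfun_pow by (rule exp_series_summable) simp
  show "summable (\<lambda>n. 1 * ((\<bar>t\<bar> * norm A) ^ n / fact n))"
    by (rule exp_series_summable[OF norm_blinfun_pow order_refl])
qed

lemma exp_op_conv_exp_blinfun: "exp_op A t x = exp_blinfun A t x"
proof -
  have "bounded_linear (\<lambda>F. blinfun_apply F x)"
    by (rule blinfun.bounded_linear_left)
  from bounded_linear.suminf[OF this exp_blinfun_summable] show ?thesis
    by (simp add: exp_op_def exp_blinfun_def blinfun_pow_apply blinfun.scaleR_left)
qed

lemma exp_blinfun_zero [simp]: "exp_blinfun A 0 = id_blinfun"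
proof -
  have "(\<lambda>n. (0 ^ n / fact n) *\<^sub>R blinfun_pow A n) sums ((0 ^ 0 / fact 0) *\<^sub>R blinfun_pow A 0)"
    using sums_finite[of "{0}" "\<lambda>n. (0 ^ n / fact n) *\<^sub>R blinfun_pow A n"] by simp
  then show ?thesis
    by (simp add: exp_blinfun_def sums_iff blinfun_pow_def)
qed

lemma compose_exp_blinfun: "A o\<^sub>L exp_blinfun A t = (\<Sum>n. (t ^ n / fact n) *\<^sub>R blinfun_pow A (Suc n))"
proof -
  have "bounded_linear (\<lambda>F. A o\<^sub>L F)"
    by (rule bounded_bilinear.bounded_linear_right[OF bounded_bilinear_blinfun_compose])
  from bounded_linear.suminf[OF this exp_blinfun_summable] show ?thesis
    by (simp add: exp_blinfun_def blinfun_pow_Suc blinfun_compose_simps)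
qed

lemma exp_blinfun_commute: "A o\<^sub>L exp_blinfun A t = exp_blinfun A t o\<^sub>L A"
proof -
  have "bounded_linear (\<lambda>F. F o\<^sub>L A)"
    by (rule bounded_bilinear.bounded_linear_left[OF bounded_bilinear_blinfun_compose])
  from bounded_linear.suminf[OF this exp_blinfun_summable] show ?thesis
    unfolding compose_exp_blinfun by (simp add: exp_blinfun_def blinfun_pow_Suc2 blinfun_compose_simps)
qed

lemma exp_blinfun_has_vector_derivative:
  "(exp_blinfun A has_vector_derivative (A o\<^sub>L exp_blinfun A t)) (at t within S)"
  unfolding compose_exp_blinfun
  unfolding exp_blinfun_def[abs_def]
  by (rule has_vector_derivative_at_within[OF exp_series_has_vector_derivative[OF norm_blinfun_pow]])

lemma exp_blinfun_reverse_has_vector_derivative: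
  "((\<lambda>t. exp_blinfun A (a - t)) has_vector_derivative - (A o\<^sub>L exp_blinfun A (a - t))) (at t within S)"
proof -
  have "((\<lambda>t. a - t) has_vector_derivative - 1) (at t within S)"
    by (auto intro!: derivative_eq_intros)
  from vector_diff_chain_within[OF this exp_blinfun_has_vector_derivative]
  show ?thesis by (simp add: o_def)
qed

text \<open>As a function of t the product has derivative zero, because A commutes with its
  exponential; its value at t = 0 identifies the constant. This gives the group law without
  multiplying series.\<close>

lemma exp_blinfun_diff_compose: "exp_blinfun A (a - t) o\<^sub>L exp_blinfun A t = exp_blinfun A a"
proof -
  have "((\<lambda>t. exp_blinfun A (a - t) o\<^sub>L exp_blinfun A t) has_vector_derivative 0) (at t within UNIV)" for t
    using bounded_bilinear.has_vector_derivative[OF bounded_bilinear_blinfun_compose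
        exp_blinfun_reverse_has_vector_derivative[of A a t UNIV] exp_blinfun_has_vector_derivative[of A t UNIV]]
    by (simp add: exp_blinfun_commute[of A "a - t"] blinfun_compose_assoc blinfun_compose_simps)
  then obtain c where c: "\<And>t. exp_blinfun A (a - t) o\<^sub>L exp_blinfun A t = c"
    using has_vector_derivative_zero_constant[of UNIV "\<lambda>t. exp_blinfun A (a - t) o\<^sub>L exp_blinfun A t"]
    by auto
  have "exp_blinfun A a o\<^sub>L id_blinfun = exp_blinfun A a"
    by (rule blinfun_eqI) simp
  then show ?thesis
    using c[of t] c[of 0] by simp
qed

lemma exp_blinfun_cancel: "exp_blinfun A t (exp_blinfun A (- t) x) = x"
proof -
  have "(exp_blinfun A t o\<^sub>L exp_blinfun A (- t)) x = x"
    using exp_blinfun_diff_compose[of A 0 "- t"] by simp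
  then show ?thesis by simp
qed

lemma exp_blinfun_diff: "exp_blinfun A (t - s) x = exp_blinfun A t (exp_blinfun A (- s) x)"
proof -
  have "exp_blinfun A (t - s) (exp_blinfun A s (exp_blinfun A (- s) x)) = exp_blinfun A t (exp_blinfun A (- s) x)"
    unfolding exp_blinfun_diff_compose[of A t s, symmetric] by simp
  then show ?thesis
    by (simp only: exp_blinfun_cancel)
qed

lemma continuous_on_exp_blinfun [continuous_intros]:
  assumes "continuous_on S f"
  shows "continuous_on S (\<lambda>t. exp_blinfun A (f t))"
proof -
  have "continuous_on UNIV (exp_blinfun A)"
    using has_vector_derivative_continuous[OF exp_blinfun_has_vector_derivative]
    by (rule continuous_at_imp_continuous_on[OF ballI])
  then show ?thesis
    using assms by (rule continuous_on_compose2) simp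
qed

section \<open>Variation of constants\<close>

lemma set_integral_exp_op:
  fixes h :: "real \<Rightarrow> 'x::complex_fd_space"
  assumes "continuous_on {a..t} h"
  shows "(LINT s:{a..t}|lborel. exp_op A (t - s) (h s))
    = exp_blinfun A t (LINT s:{a..t}|lborel. exp_blinfun A (- s) (h s))"
proof -
  have "set_integrable lborel {a..t} (\<lambda>s. exp_blinfun A (- s) (h s))"
    by (intro borel_integrable_atLeastAtMost' continuous_intros blinfun.continuous_on assms)
  from integral_bounded_linear[OF blinfun.bounded_linear_right this[unfolded set_integrable_def], of "exp_blinfun A t"]
  show ?thesis
    by (simp add: set_lebesgue_integral_def exp_op_conv_exp_blinfun exp_blinfun_diff blinfun.scaleR_right)
qed

lemma continuous_on_set_integral_exp_op:
  fixes h :: "real \<Rightarrow> 'x::complex_fd_space"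
  assumes h: "continuous_on {a..} h"
  shows "continuous_on {a..} (\<lambda>t. LINT s:{a..t}|lborel. exp_op A (t - s) (h s))"
proof -
  have "continuous_on {a..} (\<lambda>s. exp_blinfun A (- s) (h s))"
    by (intro continuous_intros blinfun.continuous_on h)
  then have "continuous_on {a..} (\<lambda>t. LINT s:{a..t}|lborel. exp_blinfun A (- s) (h s))"
    unfolding continuous_on_eq_continuous_within[of _ "\<lambda>t. set_lebesgue_integral lborel {a..t} _"]
    by (intro ballI has_vector_derivative_continuous[OF set_integral_has_vector_derivative]) simp_all
  then have "continuous_on {a..} (\<lambda>t. exp_blinfun A t (LINT s:{a..t}|lborel. exp_blinfun A (- s) (h s)))"
    by (intro continuous_intros blinfun.continuous_on)
  moreover have "continuous_on {a..t} h" for t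
    by (rule continuous_on_subset[OF h]) auto
  ultimately show ?thesis
    by (simp add: set_integral_exp_op)
qed

text \<open>The integrating factor exp(-A t) serves both directions. Splitting exp(A (t - s)) into
  exp(A t) exp(-A s) frees the integrand of the upper limit, so the fundamental theorem applies;
  conversely, exp(-A t) z(t) minus the integral has derivative zero.\<close>

proposition variation_of_constants:
  fixes h :: "real \<Rightarrow> 'x::complex_fd_space"
  assumes h: "continuous_on {a..} h"
  shows "(\<forall>t\<ge>a. z t = exp_op A (t - a) (z a) + (LINT s:{a..t}|lborel. exp_op A (t - s) (h s))) \<longleftrightarrow>
    (\<forall>t\<ge>a. (z has_vector_derivative A (z t) + h t) (at t within {a..}))"
    (is "?I \<longleftrightarrow> ?D")
proof -
  define I where "I t = (LINT s:{a..t}|lborel. exp_blinfun A (- s) (h s))" for t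
  have I: "(I has_vector_derivative exp_blinfun A (- t) (h t)) (at t within {a..})" if "a \<le> t" for t
    unfolding I_def
  proof (rule set_integral_has_vector_derivative[OF _ that])
    show "continuous_on {a..} (\<lambda>s. exp_blinfun A (- s) (h s))"
      by (intro continuous_intros blinfun.continuous_on h)
  qed
  have voc: "exp_op A (t - a) (z a) + (LINT s:{a..t}|lborel. exp_op A (t - s) (h s))
      = exp_blinfun A t (exp_blinfun A (- a) (z a) + I t)" for t
  proof -
    have "continuous_on {a..t} h"
      by (rule continuous_on_subset[OF h]) auto
    then show ?thesis
      by (simp only: set_integral_exp_op)
        (simp add: exp_op_conv_exp_blinfun exp_blinfun_diff I_def blinfun.add_right)
  qed
  show ?thesis
  proof
    assume ?I
    define z0 where "z0 = exp_blinfun A (- a) (z a)"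
    have z: "z t = exp_blinfun A t (z0 + I t)" if "t \<ge> a" for t
      using that \<open>?I\<close> voc z0_def by metis
    show ?D
    proof (intro allI impI)
      fix t assume t: "a \<le> t"
      have "((\<lambda>t. z0 + I t) has_vector_derivative exp_blinfun A (- t) (h t)) (at t within {a..})"
        using has_vector_derivative_add[OF has_vector_derivative_const I[OF t]] by simp
      from bounded_bilinear.has_vector_derivative[OF bounded_bilinear_blinfun_apply
          exp_blinfun_has_vector_derivative this, of A]
      have "((\<lambda>t. exp_blinfun A t (z0 + I t)) has_vector_derivative h t + A (exp_blinfun A t (z0 + I t))) (at t within {a..})"
        by (simp add: exp_blinfun_cancel)
      then have "((\<lambda>t. exp_blinfun A t (z0 + I t)) has_vector_derivative A (z t) + h t) (at t within {a..})"
        by (simp only: z[OF t] add.commute)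
      with t z show "(z has_vector_derivative A (z t) + h t) (at t within {a..})"
        by (intro has_vector_derivative_transform[of t "{a..}" z "\<lambda>t. exp_blinfun A t (z0 + I t)"]) simp_all
    qed
  next
    assume D: ?D
    have "((\<lambda>t. exp_blinfun A (- t) (z t) - I t) has_vector_derivative 0) (at t within {a..})" if t: "t \<in> {a..}" for t
    proof -
      have "(z has_vector_derivative A (z t) + h t) (at t within {a..})"
        using D t by simp
      from bounded_bilinear.has_vector_derivative[OF bounded_bilinear_blinfun_apply
          exp_blinfun_reverse_has_vector_derivative[of A 0] this]
      have "((\<lambda>t. exp_blinfun A (- t) (z t)) has_vector_derivative exp_blinfun A (- t) (h t)) (at t within {a..})"
        by (simp add: exp_blinfun_commute blinfun.minus_left blinfun.add_right)
      from has_vector_derivative_diff[OF this I] t show ?thesis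
        by simp
    qed
    then obtain c where c: "\<And>t. t \<in> {a..} \<Longrightarrow> exp_blinfun A (- t) (z t) - I t = c"
      using has_vector_derivative_zero_constant[OF convex_real_interval(1)] by blast
    have "I a = 0"
      using set_integral_norm_le[of a a "norm (exp_blinfun A (- a) (h a))" "{}" "\<lambda>s. exp_blinfun A (- s) (h s)"]
      by (simp add: I_def)
    then have "c = exp_blinfun A (- a) (z a)"
      using c[of a] by simp
    then have z: "exp_blinfun A (- a) (z a) + I t = exp_blinfun A (- t) (z t)" if "t \<ge> a" for t
      using c[of t] that by (simp add: algebra_simps)
    show ?I
      by (simp add: voc z exp_blinfun_cancel)
  qed
qed

section \<open>Integral operators with piecewise continuous kernels\<close>

text \<open>By continuity off N, a point violating the essential bound would come with a nonempty
  open subset of K on which the bound fails, and such a set is not null. Convexity and nonempty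
  interior of K cover violating points on its boundary, since interior points approach them.\<close>

lemma Linf_loc_bounded_off_closed:
  fixes F :: "real \<times> real \<Rightarrow> 'v::real_normed_vector"
  assumes F: "Linf_loc D F" "continuous_on (D - N) F" and N: "closed N"
    and K: "K \<subseteq> D" "compact K" "convex K" "interior K \<noteq> {}"
  obtains C where "0 \<le> C" "\<And>z. z \<in> K - N \<Longrightarrow> norm (F z) \<le> C"
proof -
  obtain C where C: "AE z in lebesgue. z \<in> K \<longrightarrow> norm (F z) \<le> C"
    using F K unfolding Linf_loc_def by blast
  have "norm (F z) \<le> C" if z: "z \<in> K - N" for z
  proof (rule ccontr)
    assume large: "\<not> norm (F z) \<le> C"
    then have "norm (F z) - C > 0" "z \<in> D - N"
      using z K(1) by auto
    then obtain d where d: "d > 0"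
      "\<And>w. w \<in> D - N \<Longrightarrow> dist w z < d \<Longrightarrow> dist (F w) (F z) < norm (F z) - C"
      using F(2) unfolding continuous_on_iff by blast
    obtain r where r: "r > 0" "ball z r \<subseteq> - N"
      using N z open_contains_ball[of "- N"] by auto
    define W where "W = ball z (min d r) \<inter> interior K"
    have "z \<in> closure (interior K)"
      using convex_closure_interior[OF K(3,4)] z closure_subset by blast
    moreover have "z \<in> ball z (min d r)"
      using d(1) r(1) by simp
    ultimately have "W \<noteq> {}"
      unfolding W_def using open_Int_closure_eq_empty[OF open_ball] by blast
    moreover have "open W"
      unfolding W_def by (intro open_Int open_ball open_interior)
    moreover have "W \<in> null_sets lebesgue"
    proof (subst AE_iff_null_sets)
      show "W \<in> sets lebesgue"
        using borel_open[OF \<open>open W\<close>] by simp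
      have "norm (F w) > C \<and> w \<in> K" if "w \<in> W" for w
      proof -
        have w: "w \<in> K" "dist w z < d" "w \<in> ball z r"
          using that interior_subset[of K] by (auto simp: W_def dist_commute)
        then have "dist (F w) (F z) < norm (F z) - C"
          using d(2) K(1) r(2) by blast
        then show ?thesis
          using w(1) norm_triangle_ineq2[of "F z" "F w"] by (simp add: dist_norm norm_minus_commute)
      qed
      then show "AE w in lebesgue. w \<notin> W"
        using C by (auto elim!: eventually_mono simp: not_le[symmetric])
    qed
    ultimately show False
      using open_not_negligible negligible_iff_null_sets by blast
  qed
  then show ?thesis
    using that[of "max 0 C"] by (meson dual_order.trans max.cobounded1 max.cobounded2)
qed

text \<open>Retains two features of the break lines: closedness keeps a regular point regular under
  small changes of t, and finiteness of each section in s makes the exceptional points negligible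
  for the integral.\<close>

locale kernel =
  fixes a b c d :: real and N :: "(real \<times> real) set" and F :: "real \<times> real \<Rightarrow> 'v::real_normed_vector" and C :: real
  assumes N_closed: "closed N" and N_finite: "\<And>t. finite {s. (t, s) \<in> N}"
    and F_continuous: "continuous_on ({a..b} \<times> {c..d} - N) F"
    and F_bound: "\<And>z. z \<in> {a..b} \<times> {c..d} - N \<Longrightarrow> norm (F z) \<le> C"
begin

lemma section_continuous:
  "t \<in> {a..b} \<Longrightarrow> continuous_on ({c..d} - {s. (t, s) \<in> N}) (\<lambda>s. F (t, s))"
  by (rule continuous_on_compose2[OF F_continuous]) (auto intro!: continuous_intros)

text \<open>Dominated convergence along sequences. Break lines may move with t, so convergence need
  not be uniform in s; but each fixed s outside the section at t stays regular for all nearby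
  times.\<close>

lemma L1_continuous:
  assumes t: "t \<in> {a..b}"
  shows "((\<lambda>t'. LINT s:{c..d}|lborel. norm (F (t', s) - F (t, s))) \<longlongrightarrow> 0) (at t within {a..b})"
  unfolding tendsto_at_iff_sequentially o_def
proof (intro allI impI)
  fix X assume X: "\<forall>i. X i \<in> {a..b} - {t}" "X \<longlonglongrightarrow> t"
  define h where "h i s = indicator {c..d} s *\<^sub>R norm (F (X i, s) - F (t, s))" for i s
  have C: "0 \<le> C \<or> {a..b} \<times> {c..d} - N = {}"
    using F_bound norm_ge_zero by (meson all_not_in_conv order_trans)
  have int: "set_integrable lborel {c..d} (\<lambda>s. norm (F (X i, s) - F (t, s)))" for i
  proof (rule set_integrable_piecewise)
    show "finite ({s. (X i, s) \<in> N} \<union> {s. (t, s) \<in> N})"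
      using N_finite by simp
    show "continuous_on ({c..d} - ({s. (X i, s) \<in> N} \<union> {s. (t, s) \<in> N})) (\<lambda>s. norm (F (X i, s) - F (t, s)))"
      using X(1) t by (intro continuous_intros) (auto intro: continuous_on_subset[OF section_continuous])
    fix s assume "s \<in> {c..d} - ({s. (X i, s) \<in> N} \<union> {s. (t, s) \<in> N})"
    then show "norm (norm (F (X i, s) - F (t, s))) \<le> C + C"
      using X(1) t F_bound[of "(X i, s)"] F_bound[of "(t, s)"] norm_triangle_ineq4[of "F (X i, s)" "F (t, s)"]
      by auto
  qed
  have "(\<lambda>i. integral\<^sup>L lborel (h i)) \<longlonglongrightarrow> integral\<^sup>L lborel (\<lambda>s::real. 0)"
  proof (rule integral_dominated_convergence[where w = "\<lambda>s. indicator {c..d} s * (C + C)"])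
    show "h i \<in> borel_measurable lborel" for i
      using int[of i] unfolding set_integrable_def h_def by (rule borel_measurable_integrable)
    have "emeasure lborel {c..d} < top"
      by (cases "c \<le> d") auto
    then have "integrable lborel (\<lambda>s. indicator {c..d} s :: real)"
      by (simp add: integrable_indicator_iff)
    then show "integrable lborel (\<lambda>s. indicator {c..d} s * (C + C))"
      by simp
    show "AE s in lborel. (\<lambda>i. h i s) \<longlonglongrightarrow> 0"
      using AE_not_in_finite[OF N_finite[of t]]
    proof eventually_elim
      case (elim s)
      show ?case
      proof (cases "s \<in> {c..d}")
        case True
        have lim: "(\<lambda>i. (X i, s)) \<longlonglongrightarrow> (t, s)"
          using X(2) by (intro tendsto_intros)
        have "\<forall>\<^sub>F i in sequentially. (X i, s) \<in> - N"
          using lim N_closed elim by (intro topological_tendstoD) auto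
        then have "\<forall>\<^sub>F i in sequentially. (X i, s) \<in> {a..b} \<times> {c..d} - N"
          by eventually_elim (use X(1) True in auto)
        then have "(\<lambda>i. F (X i, s)) \<longlonglongrightarrow> F (t, s)"
          using continuous_on_tendsto_compose[OF F_continuous lim] t True elim by auto
        then have "(\<lambda>i. norm (F (X i, s) - F (t, s))) \<longlonglongrightarrow> 0"
          by (simp add: tendsto_norm_zero LIM_zero)
        then show ?thesis
          using True by (simp add: h_def)
      qed (simp add: h_def)
    qed
    show "AE s in lborel. norm (h i s) \<le> indicator {c..d} s * (C + C)" for i
    proof -
      have "AE s in lborel. s \<notin> {s. (X i, s) \<in> N} \<union> {s. (t, s) \<in> N}"
        using N_finite by (intro AE_not_in_finite) simp
      then show ?thesis
      proof eventually_elim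
        case (elim s)
        then show ?case
          using X(1) t F_bound[of "(X i, s)"] F_bound[of "(t, s)"] norm_triangle_ineq4[of "F (X i, s)" "F (t, s)"]
          by (cases "s \<in> {c..d}") (auto simp: h_def)
      qed
    qed
  qed simp
  then show "(\<lambda>i. LINT s:{c..d}|lborel. norm (F (X i, s) - F (t, s))) \<longlonglongrightarrow> 0"
    by (simp add: h_def[abs_def] set_lebesgue_integral_def)
qed

end

section \<open>Estimates for a kernel applied to a function\<close>

lemma kernel_apply_integrable:
  fixes F :: "real \<times> real \<Rightarrow> 'v::real_normed_vector \<Rightarrow>\<^sub>L 'w::{banach, second_countable_topology}"
  assumes K: "kernel a b c d N F C" and t: "t \<in> {a..b}" and v: "continuous_on {c..d} v"
  shows "set_integrable lborel {c..d} (\<lambda>s. F (t, s) (v s))"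
proof -
  interpret kernel a b c d N F C
    by (rule K)
  have "bounded (v ` {c..d})"
    by (intro compact_imp_bounded compact_continuous_image v compact_Icc)
  then obtain M where M: "\<forall>s\<in>{c..d}. norm (v s) \<le> M"
    by (auto simp: bounded_iff)
  show ?thesis
  proof (rule set_integrable_piecewise[OF N_finite[of t]])
    show "continuous_on ({c..d} - {s. (t, s) \<in> N}) (\<lambda>s. F (t, s) (v s))"
      using t by (intro blinfun.continuous_on section_continuous continuous_on_subset[OF v]) auto
    fix s assume s: "s \<in> {c..d} - {s. (t, s) \<in> N}"
    then have "norm (F (t, s)) \<le> C" "norm (v s) \<le> M"
      using F_bound[of "(t, s)"] M t by auto
    then have "norm (F (t, s)) * norm (v s) \<le> C * M"
      by (meson mult_mono' norm_ge_zero)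
    then show "norm (F (t, s) (v s)) \<le> C * M"
      using norm_blinfun[of "F (t, s)" "v s"] by linarith
  qed
qed

lemma kernel_apply_bound:
  fixes F :: "real \<times> real \<Rightarrow> 'v::real_normed_vector \<Rightarrow>\<^sub>L 'w::{banach, second_countable_topology}"
  assumes K: "kernel a b c d N F C" and t: "t \<in> {a..b}" and "c \<le> d" "0 \<le> C" "0 \<le> M"
    and M: "\<And>s. s \<in> {c..d} \<Longrightarrow> norm (v s) \<le> M"
  shows "norm (LINT s:{c..d}|lborel. F (t, s) (v s)) \<le> C * M * (d - c)"
proof -
  interpret kernel a b c d N F C
    by (rule K)
  show ?thesis
  proof (rule set_integral_norm_le[OF _ _ N_finite[of t]])
    fix s assume s: "s \<in> {c..d} - {s. (t, s) \<in> N}"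
    then have "norm (F (t, s)) \<le> C" "norm (v s) \<le> M"
      using F_bound[of "(t, s)"] M t by auto
    then have "norm (F (t, s)) * norm (v s) \<le> C * M"
      by (meson mult_mono' norm_ge_zero)
    then show "norm (F (t, s) (v s)) \<le> C * M"
      using norm_blinfun[of "F (t, s)" "v s"] by linarith
  qed (use assms in auto)
qed

text \<open>Separates the size of v from a quantity of the kernel alone; with
  \<open>L1_continuous\<close> this gives a modulus of continuity common to all v in a ball.\<close>

lemma kernel_apply_diff_bound:
  fixes F :: "real \<times> real \<Rightarrow> 'v::real_normed_vector \<Rightarrow>\<^sub>L 'w::{banach, second_countable_topology}"
  assumes K: "kernel a b c d N F C" and t: "t \<in> {a..b}" "t' \<in> {a..b}"
    and v: "continuous_on {c..d} v" and M: "\<And>s. s \<in> {c..d} \<Longrightarrow> norm (v s) \<le> M"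
  shows "norm ((LINT s:{c..d}|lborel. F (t', s) (v s)) - (LINT s:{c..d}|lborel. F (t, s) (v s)))
    \<le> M * (LINT s:{c..d}|lborel. norm (F (t', s) - F (t, s)))"
proof -
  interpret kernel a b c d N F C
    by (rule K)
  have int: "set_integrable lborel {c..d} (\<lambda>s. norm (F (t', s) - F (t, s)))"
  proof (rule set_integrable_piecewise)
    show "finite ({s. (t', s) \<in> N} \<union> {s. (t, s) \<in> N})"
      using N_finite by simp
    show "continuous_on ({c..d} - ({s. (t', s) \<in> N} \<union> {s. (t, s) \<in> N})) (\<lambda>s. norm (F (t', s) - F (t, s)))"
      using t by (intro continuous_intros) (auto intro: continuous_on_subset[OF section_continuous])
    fix s assume "s \<in> {c..d} - ({s. (t', s) \<in> N} \<union> {s. (t, s) \<in> N})"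
    then show "norm (norm (F (t', s) - F (t, s))) \<le> C + C"
      using t F_bound[of "(t', s)"] F_bound[of "(t, s)"] norm_triangle_ineq4[of "F (t', s)" "F (t, s)"]
      by auto
  qed
  note intF = kernel_apply_integrable[OF K t(1) v] kernel_apply_integrable[OF K t(2) v]
  have "(LINT s:{c..d}|lborel. F (t', s) (v s)) - (LINT s:{c..d}|lborel. F (t, s) (v s))
      = (LINT s:{c..d}|lborel. F (t', s) (v s) - F (t, s) (v s))"
    using intF by (simp add: set_integral_diff)
  also have "\<dots> = (LINT s:{c..d}|lborel. (F (t', s) - F (t, s)) (v s))"
    by (simp add: blinfun.diff_left)
  also have "norm \<dots> \<le> (\<integral>s. norm (indicator {c..d} s *\<^sub>R (F (t', s) - F (t, s)) (v s)) \<partial>lborel)"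
    unfolding set_lebesgue_integral_def by (rule integral_norm_bound)
  also have "\<dots> \<le> (\<integral>s. M * (indicator {c..d} s *\<^sub>R norm (F (t', s) - F (t, s))) \<partial>lborel)"
  proof (rule integral_mono')
    show "integrable lborel (\<lambda>s. M * (indicator {c..d} s *\<^sub>R norm (F (t', s) - F (t, s))))"
      using int unfolding set_integrable_def by simp
    fix s
    show "norm (indicator {c..d} s *\<^sub>R (F (t', s) - F (t, s)) (v s)) \<le> M * (indicator {c..d} s *\<^sub>R norm (F (t', s) - F (t, s)))"
    proof (cases "s \<in> {c..d}")
      case True
      have "norm ((F (t', s) - F (t, s)) (v s)) \<le> norm (F (t', s) - F (t, s)) * norm (v s)"
        by (rule norm_blinfun)
      also have "\<dots> \<le> norm (F (t', s) - F (t, s)) * M"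
        using M[OF True] by (intro mult_left_mono) auto
      finally show ?thesis
        using True by (simp add: mult.commute)
    qed simp
    \<comment> \<open>M may be negative if \<open>{c..d}\<close> is empty, so the sign of the
      product is read off from the preceding estimate.\<close>
    then show "0 \<le> M * (indicator {c..d} s *\<^sub>R norm (F (t', s) - F (t, s)))"
      using norm_ge_zero order_trans by blast
  qed
  also have "\<dots> = M * (LINT s:{c..d}|lborel. norm (F (t', s) - F (t, s)))"
    by (simp add: set_lebesgue_integral_def)
  finally show ?thesis .
qed

section \<open>The delay equation\<close>

lemma kernel_mono:
  assumes "kernel a b c d N F C" "{c'..d'} \<subseteq> {c..d}"
  shows "kernel a b c' d' N F C"
proof -
  interpret kernel a b c d N F C
    by (rule assms)
  have "{a..b} \<times> {c'..d'} - N \<subseteq> {a..b} \<times> {c..d} - N"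
    using assms(2) by blast
  then show ?thesis
    using N_closed N_finite F_bound continuous_on_subset[OF F_continuous]
    by unfold_locales blast+
qed

lemma closed_break_lines: "closed (break_lines m \<tau>)"
proof -
  have "closed {(t, s). s = \<tau> m - \<tau> j \<or> s = t - \<tau> j}" for j
  proof -
    have "closed {z :: real \<times> real. snd z = \<tau> m - \<tau> j}" "closed {z :: real \<times> real. snd z = fst z - \<tau> j}"
      by (intro closed_Collect_eq continuous_intros)+
    from closed_Un[OF this] show ?thesis
      by (simp add: Collect_disj_eq[symmetric] case_prod_beta')
  qed
  then show ?thesis
    unfolding break_lines_def by (intro closed_UN) auto
qed

lemma finite_break_lines_section: "finite {s. (t, s) \<in> break_lines m \<tau>}"
proof (rule finite_subset)
  show "{s. (t, s) \<in> break_lines m \<tau>} \<subseteq> (\<lambda>j. \<tau> m - \<tau> j) ` {..m} \<union> (\<lambda>j. t - \<tau> j) ` {..m}"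
    by (auto simp: break_lines_def)
qed simp

section \<open>Complex homogeneity, and segments of functions\<close>

lemma HomC_scaleC: "F \<in> HomC \<Longrightarrow> F (c *\<^sub>C x) = c *\<^sub>C F x"
  by (simp add: HomC_def Vector_Spaces.linear_def module_hom.scale)

lemma bounded_linear_scaleC: "bounded_linear (\<lambda>x::'x::complex_fd_space. c *\<^sub>C x)"
proof
  show "c *\<^sub>C (r *\<^sub>R x) = r *\<^sub>R c *\<^sub>C x" for r and x :: 'x
    by (simp add: scaleR_scaleC scaleC_scaleC mult.commute)
  show "\<exists>K. \<forall>x::'x. norm (c *\<^sub>C x) \<le> norm x * K"
    by (rule exI[of _ "cmod c"]) (simp add: norm_scaleC)
qed (simp add: scaleC_add_right)

lemmas scaleC_zero_right [simp] = linear_0[OF bounded_linear.linear[OF bounded_linear_scaleC]]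

lemma scaleC_zero_left [simp]: "0 *\<^sub>C (x::'x::complex_fd_space) = 0"
  using scaleR_scaleC[of 0 x] by simp

text \<open>For c \<noteq> 0 scaling is invertible and preserves integrability both ways, so the
  identity holds for every h.\<close>

lemma set_integral_scaleC:
  fixes h :: "real \<Rightarrow> 'x::complex_fd_space"
  shows "(LINT s:S|lborel. c *\<^sub>C h s) = c *\<^sub>C (LINT s:S|lborel. h s)"
proof (cases "c = 0")
  case False
  have "(\<integral>s. c *\<^sub>C (indicator S s *\<^sub>R h s) \<partial>lborel) = c *\<^sub>C (\<integral>s. indicator S s *\<^sub>R h s \<partial>lborel)"
  proof (rule integral_bounded_linear'[OF bounded_linear_scaleC bounded_linear_scaleC])
    show "\<forall>x::'x. inverse c *\<^sub>C c *\<^sub>C x = x"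
      using False by (simp add: scaleC_scaleC scaleC_one)
  qed
  moreover have "c *\<^sub>C (indicator S s *\<^sub>R h s) = indicator S s *\<^sub>R c *\<^sub>C h s" for s
    by (rule linear_cmul[OF bounded_linear.linear[OF bounded_linear_scaleC]])
  ultimately show ?thesis
    by (simp add: set_lebesgue_integral_def)
qed simp

lemma C0_bounded:
  assumes "v \<in> C0 T"
  obtains M where "0 \<le> M" "\<And>s. norm (v s) \<le> M"
proof -
  have "bounded (v ` {0..T})"
    using assms by (intro compact_imp_bounded compact_continuous_image compact_Icc) (simp add: C0_def)
  then obtain M where M: "\<forall>s\<in>{0..T}. norm (v s) \<le> M"
    by (auto simp: bounded_iff)
  show ?thesis
  proof (rule that[of "max 0 M"])
    show "norm (v s) \<le> max 0 M" for s
      using M assms by (cases "s \<in> {0..T}") (auto simp: C0_def le_max_iff_disj)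
  qed simp
qed

lemma C0_continuous: "v \<in> C0 T \<Longrightarrow> continuous_on {0..T} v"
  by (simp add: C0_def)

text \<open>Consecutive segments share an endpoint: the value at T of one is the value at 0 of the
  next.\<close>

definition segment :: "real \<Rightarrow> nat \<Rightarrow> (real \<Rightarrow> 'v::real_normed_vector) \<Rightarrow> real \<Rightarrow> 'v" where
  "segment T k y = (\<lambda>t. if t \<in> {0..T} then y (real k * T + t) else 0)"

lemma segment_C0:
  assumes "0 \<le> T" "continuous_on {0..} y"
  shows "segment T k y \<in> C0 T"
proof -
  have "continuous_on {0..T} (\<lambda>t. y (real k * T + t))"
    using assms by (intro continuous_on_compose2[OF assms(2)] continuous_intros) auto
  then have "continuous_on {0..T} (segment T k y)"
    by (rule continuous_on_eq) (simp add: segment_def)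
  then show ?thesis
    by (simp add: C0_def segment_def)
qed

section \<open>Delay systems and existence of solutions\<close>

locale delay_system =
  fixes m :: nat and \<tau> :: "nat \<Rightarrow> real"
    and A :: "nat \<Rightarrow> 'x::complex_fd_space \<Rightarrow>\<^sub>L 'x"
    and B :: "nat \<Rightarrow> 'u::complex_fd_space \<Rightarrow>\<^sub>L 'x"
  assumes m: "m \<ge> 1" and \<tau>0: "\<tau> 0 = 0" and \<tau>_mono: "strict_mono_on {0..m} \<tau>"
    and A_HomC: "\<And>j. j \<le> m \<Longrightarrow> A j \<in> HomC" and B_HomC: "\<And>j. j \<le> m \<Longrightarrow> B j \<in> HomC"
begin

abbreviation T :: real where "T \<equiv> \<tau> m"

lemma \<tau>_le: "i \<le> j \<Longrightarrow> j \<le> m \<Longrightarrow> \<tau> i \<le> \<tau> j"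
  using strict_mono_on_imp_mono_on[OF \<tau>_mono] by (auto simp: monotone_on_def)

lemma \<tau>1_pos: "0 < \<tau> 1"
  using strict_mono_onD[OF \<tau>_mono, of 0 1] m by (simp add: \<tau>0)

lemma T_pos: "0 < T"
  using \<tau>1_pos \<tau>_le[of 1 m] m by simp

definition delay_rhs :: "(real \<Rightarrow> 'u) \<Rightarrow> (real \<Rightarrow> 'x) \<Rightarrow> real \<Rightarrow> 'x" where
  "delay_rhs u x t = (\<Sum>j\<le>m. A j (x (t - \<tau> j)) + B j (u (t - \<tau> j)))"

text \<open>Weaker than membership in \<open>delay_relation\<close>: with derivatives within
  \<open>{T..}\<close>, x need not be differentiable on the initial interval, nor from the left at
  T. In this form the equation makes sense for merely continuous data.\<close>

definition delay_ode :: "(real \<Rightarrow> 'u) \<Rightarrow> (real \<Rightarrow> 'x) \<Rightarrow> bool" where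
  "delay_ode u x \<longleftrightarrow> (\<forall>t\<ge>T. (x has_vector_derivative delay_rhs u x t) (at t within {T..}))"

lemma continuous_on_delayed:
  assumes "continuous_on {0..} y" "j \<le> m"
  shows "continuous_on {T..} (\<lambda>s. y (s - \<tau> j))"
proof (rule continuous_on_compose2[OF assms(1)])
  show "continuous_on {T..} (\<lambda>s. s - \<tau> j)"
    by (intro continuous_intros)
  show "(\<lambda>s. s - \<tau> j) ` {T..} \<subseteq> {0..}"
    using \<tau>_le[OF assms(2) order_refl] by auto
qed

lemma continuous_on_delayed_sum:
  fixes F :: "nat \<Rightarrow> 'v::real_normed_vector \<Rightarrow>\<^sub>L 'x"
  assumes "continuous_on {0..} y" "J \<subseteq> {..m}"
  shows "continuous_on {T..} (\<lambda>s. \<Sum>j\<in>J. F j (y (s - \<tau> j)))"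
proof (rule continuous_on_sum)
  fix j assume "j \<in> J"
  then have "j \<le> m"
    using assms(2) by auto
  then show "continuous_on {T..} (\<lambda>s. F j (y (s - \<tau> j)))"
    by (rule bounded_linear.continuous_on[OF blinfun.bounded_linear_right continuous_on_delayed[OF assms(1)]])
qed

text \<open>Variation of constants with the undelayed \<open>A 0\<close> as generator and all other
  terms as forcing. The forcing is continuous on \<open>{T..}\<close> because no delay exceeds
  T.\<close>

lemma integrated_delay_eq_iff:
  assumes u: "continuous_on {0..} u" and x: "continuous_on {0..} x"
  shows "integrated_delay_eq m \<tau> A B u x \<longleftrightarrow> delay_ode u x"
proof -
  define h1 where "h1 s = (\<Sum>j=1..m. A j (x (s - \<tau> j)))" for s
  define h2 where "h2 s = (\<Sum>j=0..m. B j (u (s - \<tau> j)))" for s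
  have h1: "continuous_on {T..} h1"
    unfolding h1_def[abs_def] using x by (intro continuous_on_delayed_sum) auto
  have h2: "continuous_on {T..} h2"
    unfolding h2_def[abs_def] using u by (intro continuous_on_delayed_sum) auto
  have int: "set_integrable lborel {T..t} (\<lambda>s. exp_op (A 0) (t - s) (h s))"
    if "continuous_on {T..} h" for h t
  proof -
    have "continuous_on {T..t} h"
      by (rule continuous_on_subset[OF that]) auto
    then show ?thesis
      unfolding exp_op_conv_exp_blinfun
      by (intro borel_integrable_atLeastAtMost' continuous_intros blinfun.continuous_on)
  qed
  have "(LINT s:{T..t}|lborel. exp_op (A 0) (t - s) (h1 s)) + (LINT s:{T..t}|lborel. exp_op (A 0) (t - s) (h2 s))
      = (LINT s:{T..t}|lborel. exp_op (A 0) (t - s) (h1 s + h2 s))" for t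
    unfolding set_integral_add(2)[OF int[OF h1] int[OF h2], symmetric]
    by (simp add: exp_op_conv_exp_blinfun blinfun.add_right)
  moreover have "delay_rhs u x t = A 0 (x t) + (h1 t + h2 t)" for t
  proof -
    have "(\<Sum>j\<le>m. A j (x (t - \<tau> j))) = A 0 (x t) + h1 t"
      by (simp add: h1_def sum.atLeast_Suc_atMost[of 0] \<tau>0 flip: atLeast0AtMost)
    then show ?thesis
      by (simp add: delay_rhs_def sum.distrib h2_def atLeast0AtMost)
  qed
  moreover have "continuous_on {T..} (\<lambda>s. h1 s + h2 s)"
    by (intro continuous_intros h1 h2)
  ultimately show ?thesis
    using variation_of_constants[of T "\<lambda>s. h1 s + h2 s" x "A 0"]
    unfolding integrated_delay_eq_def delay_ode_def
    by (simp add: add.assoc h1_def h2_def)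
qed

lemma delay_ode_shift:
  assumes "delay_ode u x" "0 \<le> a"
  shows "delay_ode (\<lambda>t. u (a + t)) (\<lambda>t. x (a + t))"
  unfolding delay_ode_def
proof (intro allI impI)
  fix t assume t: "T \<le> t"
  have "(x has_vector_derivative delay_rhs u x (a + t)) (at (a + t) within {T..})"
    using assms t by (simp add: delay_ode_def)
  then have "(x has_vector_derivative delay_rhs u x (a + t)) (at (a + t) within (\<lambda>t. a + t) ` {T..})"
    by (rule has_vector_derivative_within_subset) (use assms(2) in auto)
  moreover have "((\<lambda>t. a + t) has_vector_derivative 1) (at t within {T..})"
    by (auto intro!: derivative_eq_intros)
  ultimately have "((x \<circ> (\<lambda>t. a + t)) has_vector_derivative 1 *\<^sub>R delay_rhs u x (a + t)) (at t within {T..})"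
    by (intro vector_diff_chain_within)
  then show "((\<lambda>t. x (a + t)) has_vector_derivative delay_rhs (\<lambda>t. u (a + t)) (\<lambda>t. x (a + t)) t) (at t within {T..})"
    by (simp add: o_def delay_rhs_def add_diff_eq)
qed

text \<open>Method of steps: the delayed terms on \<open>[T, T + (n + 1) \<tau>\<^sub>1]\<close> only involve values on
  \<open>[0, T + n \<tau>\<^sub>1]\<close>, so the fixed-point iteration becomes stationary on every bounded interval.\<close>

lemma delay_solution_exists:
  assumes v: "continuous_on {0..T} v"
  obtains x where "continuous_on {0..} x" "\<And>t. t \<in> {0..T} \<Longrightarrow> x t = v t"
    "integrated_delay_eq m \<tau> A B (\<lambda>_. 0) x"
proof -
  define G where "G x t = exp_op (A 0) (t - T) (v T)
    + (LINT s:{T..t}|lborel. exp_op (A 0) (t - s) (\<Sum>j=1..m. A j (x (s - \<tau> j))))" for x t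
  define \<Phi> where "\<Phi> x t = (if t \<le> T then v t else G x t)" for x t
  \<comment> \<open>The constant continuation of v is just a continuous start; each application of
    \<Phi> makes a further stretch of length \<open>\<tau> 1\<close> correct.\<close>
  define X where "X n = (\<Phi> ^^ n) (\<lambda>t. v (min t T))" for n
  have X_Suc: "X (Suc n) = \<Phi> (X n)" for n
    by (simp add: X_def)
  have G_T: "G x T = v T" for x
  proof -
    have "norm (LINT s:{T..T}|lborel. h s) \<le> norm (h T) * (T - T)" for h :: "real \<Rightarrow> 'x"
      by (rule set_integral_norm_le[where Z = "{}"]) auto
    then show ?thesis
      by (simp add: G_def exp_op_conv_exp_blinfun)
  qed
  have X_cont: "continuous_on {0..} (X n)" for n
  proof (induction n)
    case 0
    show ?case
      unfolding X_def funpow_0 using T_pos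
      by (intro continuous_on_compose2[OF v] continuous_intros) auto
  next
    case (Suc n)
    have "continuous_on {T..} (G (X n))"
      unfolding G_def[abs_def] exp_op_conv_exp_blinfun[of _ _ "v T"]
      by (intro continuous_intros blinfun.continuous_on continuous_on_set_integral_exp_op continuous_on_delayed_sum Suc)
        auto
    moreover have "{t \<in> {0..}. t \<le> T} = {0..T}" "{t \<in> {0..}. T \<le> t} = {T..}"
      using T_pos by auto
    ultimately show ?case
      unfolding X_Suc \<Phi>_def[abs_def] using v
      by (intro continuous_on_cases_le) (auto simp: G_T)
  qed
  \<comment> \<open>The undelayed term is absorbed by the exponential, so G looks back by at least
    \<open>\<tau> 1\<close>.\<close>
  have G_cong: "G x t = G y t" if "\<And>s. s \<le> t - \<tau> 1 \<Longrightarrow> x s = y s" for x y t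
    unfolding G_def
  proof (intro arg_cong2[of _ _ _ _ "(+)"] refl set_lebesgue_integral_cong allI impI arg_cong[of _ _ "exp_op (A 0) _"] sum.cong)
    fix s j assume "s \<in> {T..t}" "j \<in> {1..m}"
    then have "s - \<tau> j \<le> t - \<tau> 1"
      using \<tau>_le[of 1 j] by auto
    then show "A j (x (s - \<tau> j)) = A j (y (s - \<tau> j))"
      using that by simp
  qed auto
  have X_step: "t \<le> T + real n * \<tau> 1 \<Longrightarrow> X (Suc n) t = X n t" for n t
  proof (induction n arbitrary: t)
    case 0
    then show ?case
      by (simp add: X_def \<Phi>_def)
  next
    case (Suc n)
    have "G (X (Suc n)) t = G (X n) t"
      using Suc by (intro G_cong Suc.IH) (simp add: algebra_simps)
    then show ?case
      unfolding X_Suc[of "Suc n"] by (simp add: \<Phi>_def X_Suc[of n])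
  qed
  have X_stable: "X k t = X n t" if "n \<le> k" "t \<le> T + real n * \<tau> 1" for n k t
    using that(1)
  proof (induction k rule: dec_induct)
    case (step k)
    have "real n * \<tau> 1 \<le> real k * \<tau> 1"
      using step.hyps \<tau>1_pos by (intro mult_right_mono) auto
    then show ?case
      using X_step[of t k] step.IH that(2) by simp
  qed simp
  \<comment> \<open>At t the iterate of this index is already stationary: the index times
    \<open>\<tau> 1\<close> is at least t, and T is positive.\<close>
  define x where "x t = X (nat \<lceil>t / \<tau> 1\<rceil>) t" for t
  have x_eq: "x t = X n t" if "t \<le> T + real n * \<tau> 1" for t n
  proof -
    define k where "k = nat \<lceil>t / \<tau> 1\<rceil>"
    have "t / \<tau> 1 \<le> real k"
      unfolding k_def by (rule real_nat_ceiling_ge)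
    then have "t \<le> T + real k * \<tau> 1"
      using \<tau>1_pos T_pos by (simp add: pos_divide_le_eq)
    then have "X (max k n) t = X k t" "X (max k n) t = X n t"
      using that by (auto intro!: X_stable)
    then show ?thesis
      by (simp add: x_def k_def)
  qed
  have reach: "\<exists>n. t < T + real n * \<tau> 1" for t
  proof -
    obtain n where "t - T < real n * \<tau> 1"
      using reals_Archimedean3[OF \<tau>1_pos] by blast
    then show ?thesis
      by (auto simp: algebra_simps)
  qed
  show ?thesis
  proof (rule that[of x])
    show "continuous_on {0..} x"
      unfolding continuous_on_eq_continuous_within
    proof
      fix t :: real assume t: "t \<in> {0..}"
      obtain n where n: "t < T + real n * \<tau> 1"
        using reach by blast
      have "continuous (at t within {0..}) (X n)"
        using X_cont t by (simp add: continuous_on_eq_continuous_within)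
      then show "continuous (at t within {0..}) x"
      proof (rule continuous_transform_within)
        show "0 < T + real n * \<tau> 1 - t"
          using n by simp
        show "X n s = x s" if "s \<in> {0..}" "dist s t < T + real n * \<tau> 1 - t" for s
          using that by (intro x_eq[symmetric]) (auto simp: dist_real_def)
      qed (rule t)
    qed
    show "x t = v t" if "t \<in> {0..T}" for t
      using that x_eq[of t 0] by (simp add: X_def)
    have "x t = G x t" if t: "t \<ge> T" for t
    proof -
      obtain n where n: "t < T + real n * \<tau> 1"
        using reach by blast
      have "x t = X (Suc n) t"
        using n \<tau>1_pos by (intro x_eq) (simp add: algebra_simps)
      also have "\<dots> = G (X n) t"
        using t G_T by (cases "t = T") (auto simp: X_Suc \<Phi>_def)
      also have "\<dots> = G x t"
        using n \<tau>1_pos by (intro G_cong x_eq[symmetric]) simp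
      finally show ?thesis .
    qed
    moreover have "x T = v T"
      using x_eq[of T 0] by (simp add: X_def)
    ultimately show "integrated_delay_eq m \<tau> A B (\<lambda>_. 0) x"
      by (simp add: integrated_delay_eq_def G_def exp_op_conv_exp_blinfun)
  qed
qed

end

section \<open>The discrete-time operators\<close>

lemma sup_norm_upper:
  assumes v: "v \<in> C0 T" and T: "0 \<le> T"
  shows "norm (v t) \<le> sup_norm T v"
proof -
  obtain M where M: "0 \<le> M" "\<And>s. norm (v s) \<le> M"
    using C0_bounded[OF v] by blast
  have bdd: "bdd_above ((\<lambda>t. norm (v t)) ` {0..T})"
    using M(2) by (intro bdd_aboveI2[where M = M])
  have upper: "norm (v s) \<le> sup_norm T v" if "s \<in> {0..T}" for s
    unfolding sup_norm_def using that by (intro cSUP_upper bdd)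
  show ?thesis
  proof (cases "t \<in> {0..T}")
    case False
    then have "v t = 0"
      using v by (simp add: C0_def)
    moreover have "0 \<le> sup_norm T v"
      using upper[of 0] T by (auto intro: order_trans[OF norm_ge_zero])
    ultimately show ?thesis
      by simp
  qed (rule upper)
qed

lemma sup_norm_least: "0 \<le> T \<Longrightarrow> (\<And>t. t \<in> {0..T} \<Longrightarrow> norm (v t) \<le> M) \<Longrightarrow> sup_norm T v \<le> M"
  unfolding sup_norm_def by (intro cSUP_least) auto

lemma C0_zero: "(\<lambda>_. 0) \<in> C0 T"
  by (simp add: C0_def)

lemma C0_scaleC: "v \<in> C0 T \<Longrightarrow> (\<lambda>t. c *\<^sub>C v t) \<in> C0 T"
  by (auto simp: C0_def intro!: bounded_linear.continuous_on[OF bounded_linear_scaleC])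

locale delay_kernels = delay_system m \<tau> A B
  for m \<tau> and A :: "nat \<Rightarrow> 'x::complex_fd_space \<Rightarrow>\<^sub>L 'x"
    and B :: "nat \<Rightarrow> 'u::complex_fd_space \<Rightarrow>\<^sub>L 'x" +
  fixes p :: "real \<Rightarrow> 'x \<Rightarrow>\<^sub>L 'x"
    and f :: "real \<times> real \<Rightarrow> 'x \<Rightarrow>\<^sub>L 'x"
    and g :: "real \<times> real \<Rightarrow> 'u \<Rightarrow>\<^sub>L 'x"
  assumes kernels: "solution_kernels m \<tau> A B p f g"
begin

abbreviation N :: "(real \<times> real) set" where "N \<equiv> break_lines m \<tau>"

lemma p_continuous: "continuous_on {T..} p"
  using kernels by (simp add: solution_kernels_def)

lemma p_HomC: "t \<ge> T \<Longrightarrow> p t \<in> HomC"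
  using kernels by (auto simp: solution_kernels_def)

lemma f_HomC: "t \<ge> T \<Longrightarrow> s \<in> {0..T} \<Longrightarrow> f (t, s) \<in> HomC"
proof -
  assume "t \<ge> T" "s \<in> {0..T}"
  then have "f (t, s) \<in> f ` ({T..} \<times> {0..T})"
    by (intro imageI) auto
  then show ?thesis
    using kernels unfolding solution_kernels_def by blast
qed

lemma solution_formula:
  assumes "continuous_on {0..} u" "continuous_on {0..} x"
  shows "delay_ode u x \<longleftrightarrow> (\<forall>t\<ge>T. x t = p t (x T)
    + (LINT s:{0..T}|lborel. f (t, s) (x s)) + (LINT s:{0..t}|lborel. g (t, s) (u s)))"
  unfolding integrated_delay_eq_iff[OF assms, symmetric]
proof -
  have "\<forall>u x. continuous_on {0..} u \<longrightarrow> continuous_on {0..} x \<longrightarrow>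
      (integrated_delay_eq m \<tau> A B u x \<longleftrightarrow> (\<forall>t\<ge>T. x t = p t (x T)
        + (LINT s:{0..T}|lborel. f (t, s) (x s)) + (LINT s:{0..t}|lborel. g (t, s) (u s))))"
    using kernels unfolding solution_kernels_def by (elim conjE)
  then show "integrated_delay_eq m \<tau> A B u x \<longleftrightarrow> (\<forall>t\<ge>T. x t = p t (x T)
      + (LINT s:{0..T}|lborel. f (t, s) (x s)) + (LINT s:{0..t}|lborel. g (t, s) (u s)))"
    using assms by (elim allE impE)
qed

text \<open>The operators evaluate kernels at times T + t with t in [0, T]. On the compact rectangle
  over these times the local essential bound becomes a pointwise bound off the break lines.\<close>

lemma rectangle_kernel:
  fixes F :: "real \<times> real \<Rightarrow> 'v::real_normed_vector"
  assumes "Linf_loc D F" "continuous_on (D - N) F" "{T..2 * T} \<times> {0..S} \<subseteq> D" "0 < S"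
  shows "\<exists>C\<ge>0. kernel T (2 * T) 0 S N F C"
proof -
  have "interior ({T..2 * T} \<times> {0..S}) \<noteq> {}"
    using T_pos assms(4) by (simp add: interior_Times)
  then obtain C where C: "0 \<le> C" "\<And>z. z \<in> {T..2 * T} \<times> {0..S} - N \<Longrightarrow> norm (F z) \<le> C"
    using Linf_loc_bounded_off_closed[OF assms(1,2) closed_break_lines assms(3)]
    by (metis compact_Icc compact_Times convex_Times convex_real_interval(5))
  moreover have "continuous_on ({T..2 * T} \<times> {0..S} - N) F"
    using assms(3) by (intro continuous_on_subset[OF assms(2)]) blast
  ultimately have "kernel T (2 * T) 0 S N F C"
    using closed_break_lines finite_break_lines_section by unfold_locales auto
  then show ?thesis
    using C(1) by blast
qed

lemma f_kernel: obtains C where "C \<ge> 0" "kernel T (2 * T) 0 T N f C"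
proof -
  have "\<exists>C\<ge>0. kernel T (2 * T) 0 T N f C"
  proof (rule rectangle_kernel)
    show "Linf_loc ({T..} \<times> {0..T}) f" "continuous_on ({T..} \<times> {0..T} - N) f"
      using kernels by (simp_all add: solution_kernels_def)
  qed (use T_pos in auto)
  then show ?thesis
    using that by blast
qed

text \<open>The second argument ranges up to 2 T: \<open>opQ\<close> integrates over [0, T] and
  \<open>opR\<close>, after a shift, over [T, T + t].\<close>

lemma g_kernel: obtains C where "C \<ge> 0" "kernel T (2 * T) 0 (2 * T) N g C"
proof -
  have "\<exists>C\<ge>0. kernel T (2 * T) 0 (2 * T) N g C"
  proof (rule rectangle_kernel)
    show "Linf_loc ({T..} \<times> {0..}) g" "continuous_on ({T..} \<times> {0..} - N) g"
      using kernels by (simp_all add: solution_kernels_def)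
  qed (use T_pos in auto)
  then show ?thesis
    using that by blast
qed

lemma f_integrable:
  assumes "t \<in> {T..2 * T}" "continuous_on {0..T} v"
  shows "set_integrable lborel {0..T} (\<lambda>s. f (t, s) (v s))"
  using f_kernel kernel_apply_integrable[OF _ assms] by metis

lemma g_integrable:
  assumes "t \<in> {T..2 * T}" "continuous_on {0..2 * T} v"
  shows "set_integrable lborel {0..2 * T} (\<lambda>s. g (t, s) (v s))"
  using g_kernel kernel_apply_integrable[OF _ assms] by metis

lemma opR_shift:
  "(LINT s:{0..t}|lborel. g (T + t, s + T) (v s)) = (LINT s:{T..T + t}|lborel. g (T + t, s) (v (s - T)))"
proof -
  have "(\<integral>s. indicator {T..T + t} s *\<^sub>R g (T + t, s) (v (s - T)) \<partial>lborel)
      = (\<integral>s. indicator {T..T + t} (T + 1 * s) *\<^sub>R g (T + t, T + 1 * s) (v (T + 1 * s - T)) \<partial>lborel)"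
    using lborel_integral_real_affine[of 1 "\<lambda>s. indicator {T..T + t} s *\<^sub>R g (T + t, s) (v (s - T))" T] by simp
  also have "\<dots> = (\<integral>s. indicator {0..t} s *\<^sub>R g (T + t, s + T) (v s) \<partial>lborel)"
    by (rule Bochner_Integration.integral_cong) (auto simp: indicator_def add.commute)
  finally show ?thesis
    by (simp add: set_lebesgue_integral_def)
qed

text \<open>A time shift by k T reduces everything to the first step. There the input integral over
  [0, T + t] splits at T: the earlier part is \<open>opQ\<close> of the current segment, the later
  part, shifted back, is \<open>opR\<close> of the next one.\<close>

lemma segments_discrete:
  assumes u: "continuous_on {0..} u" and x: "continuous_on {0..} x" and ode: "delay_ode u x"
  shows "((\<lambda>k. segment T k u), (\<lambda>k. segment T k x)) \<in> discrete_relation T p f g"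
proof -
  have "segment T (Suc k) x t = (opP T p f (segment T k x) + opQ T g (segment T k u) + opR T g (segment T (Suc k) u)) t"
    for k t
  proof (cases "t \<in> {0..T}")
    case True
    define a where "a = real k * T"
    have a: "0 \<le> a"
      using T_pos by (simp add: a_def)
    define u' where "u' s = u (a + s)" for s
    define x' where "x' s = x (a + s)" for s
    have u': "continuous_on {0..} u'" and x': "continuous_on {0..} x'"
      unfolding u'_def x'_def
      by (auto intro!: continuous_intros continuous_on_compose2[OF u] continuous_on_compose2[OF x] simp: a)
    have "delay_ode u' x'"
      unfolding u'_def x'_def using ode a by (rule delay_ode_shift)
    then have "\<forall>t\<ge>T. x' t = p t (x' T)
        + (LINT s:{0..T}|lborel. f (t, s) (x' s)) + (LINT s:{0..t}|lborel. g (t, s) (u' s))"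
      unfolding solution_formula[OF u' x'] .
    moreover have "T \<le> T + t"
      using True by simp
    ultimately have "x' (T + t) = p (T + t) (x' T) + (LINT s:{0..T}|lborel. f (T + t, s) (x' s))
        + (LINT s:{0..T + t}|lborel. g (T + t, s) (u' s))"
      by blast
    also have "(LINT s:{0..T + t}|lborel. g (T + t, s) (u' s))
        = (LINT s:{0..T}|lborel. g (T + t, s) (u' s)) + (LINT s:{T..T + t}|lborel. g (T + t, s) (u' s))"
    proof (rule set_integral_split)
      have "continuous_on {0..2 * T} u'"
        by (rule continuous_on_subset[OF u']) auto
      then have "set_integrable lborel {0..2 * T} (\<lambda>s. g (T + t, s) (u' s))"
        using True by (intro g_integrable) auto
      then show "set_integrable lborel {0..T + t} (\<lambda>s. g (T + t, s) (u' s))"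
        by (rule set_integrable_subset) (use True in auto)
    qed (use True T_pos in auto)
    also have "(LINT s:{T..T + t}|lborel. g (T + t, s) (u' s)) = opR T g (segment T (Suc k) u) t"
    proof -
      have "(LINT s:{T..T + t}|lborel. g (T + t, s) (u' s))
          = (LINT s:{T..T + t}|lborel. g (T + t, s) (segment T (Suc k) u (s - T)))"
        using True by (intro set_lebesgue_integral_cong) (auto simp: segment_def u'_def a_def algebra_simps)
      then show ?thesis
        using True by (simp only: opR_def opR_shift if_True)
    qed
    also have "(LINT s:{0..T}|lborel. g (T + t, s) (u' s)) = opQ T g (segment T k u) t"
    proof -
      have "(LINT s:{0..T}|lborel. g (T + t, s) (u' s)) = (LINT s:{0..T}|lborel. g (T + t, s) (segment T k u s))"
        by (intro set_lebesgue_integral_cong) (auto simp: segment_def u'_def a_def)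
      then show ?thesis
        using True by (simp add: opQ_def)
    qed
    also have "p (T + t) (x' T) + (LINT s:{0..T}|lborel. f (T + t, s) (x' s)) = opP T p f (segment T k x) t"
    proof -
      have "(LINT s:{0..T}|lborel. f (T + t, s) (x' s)) = (LINT s:{0..T}|lborel. f (T + t, s) (segment T k x s))"
        by (intro set_lebesgue_integral_cong) (auto simp: segment_def x'_def a_def)
      moreover have "x' T = segment T k x T"
        using T_pos by (simp add: segment_def x'_def a_def)
      ultimately show ?thesis
        using True by (simp add: opP_def)
    qed
    also have "x' (T + t) = segment T (Suc k) x t"
      using True by (simp add: segment_def x'_def a_def algebra_simps)
    finally show ?thesis
      by (simp add: add.assoc)
  next
    case False
    then show ?thesis
      by (simp only: plus_fun_apply opP_def opQ_def opR_def segment_def if_False) simp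
  qed
  then show ?thesis
    using u x T_pos by (auto simp: discrete_relation_def intro!: segment_C0)
qed

lemma opQ_zero: "opQ T g (\<lambda>_. 0) = (\<lambda>_. 0)"
  by (simp add: opQ_def blinfun.zero_right fun_eq_iff)

lemma opR_zero: "opR T g (\<lambda>_. 0) = (\<lambda>_. 0)"
  by (simp add: opR_def blinfun.zero_right fun_eq_iff)

lemma discrete_relation_zero_input:
  "((\<lambda>_. 0), x) \<in> discrete_relation T p f g \<longleftrightarrow> (\<forall>k. x k \<in> C0 T) \<and> (\<forall>k. x (Suc k) = opP T p f (x k))"
  by (simp add: discrete_relation_def zero_fun_def opQ_zero opR_zero C0_zero plus_fun_def)

text \<open>Recognises \<open>opP\<close> as the time shift by T along an actual solution with zero
  input. Continuity of the image, as used in \<open>opP_C0\<close>, is inherited from that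
  solution.\<close>

lemma solution_from_initial:
  assumes v: "v \<in> C0 T"
  obtains x where "continuous_on {0..} x" "delay_ode (\<lambda>_. 0) x" "segment T 0 x = v"
    "segment T 1 x = opP T p f v"
proof -
  obtain x where x: "continuous_on {0..} x" "\<And>t. t \<in> {0..T} \<Longrightarrow> x t = v t"
    "integrated_delay_eq m \<tau> A B (\<lambda>_. 0) x"
    using delay_solution_exists[OF C0_continuous[OF v]] by blast
  have ode: "delay_ode (\<lambda>_. 0) x"
    using integrated_delay_eq_iff[OF continuous_on_const x(1)] x(3) by simp
  have seg0: "segment T 0 x = v"
    using v x(2) by (auto simp: segment_def C0_def)
  have "(\<lambda>k. segment T k (\<lambda>_. 0 :: 'u)) = (\<lambda>_. 0)"
    by (simp add: segment_def zero_fun_def fun_eq_iff)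
  then have "segment T (Suc 0) x = opP T p f (segment T 0 x)"
    using segments_discrete[OF continuous_on_const x(1) ode] discrete_relation_zero_input by simp
  then show ?thesis
    using that[OF x(1) ode seg0] seg0 by simp
qed

lemma opP_C0: "v \<in> C0 T \<Longrightarrow> opP T p f v \<in> C0 T"
  using solution_from_initial segment_C0 T_pos by (metis less_imp_le)

section \<open>Linearity, boundedness and equicontinuity of the operators\<close>

lemma opP_add:
  assumes "v \<in> C0 T" "w \<in> C0 T"
  shows "opP T p f (v + w) = opP T p f v + opP T p f w"
proof
  fix t
  show "opP T p f (v + w) t = (opP T p f v + opP T p f w) t"
    using set_integral_add(2)[OF f_integrable[OF _ C0_continuous[OF assms(1)]] f_integrable[OF _ C0_continuous[OF assms(2)]], of "T + t" "T + t"]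
    by (auto simp: opP_def blinfun.add_right)
qed

lemma opP_scaleC: "opP T p f (\<lambda>s. c *\<^sub>C v s) = (\<lambda>t. c *\<^sub>C opP T p f v t)"
proof
  fix t
  show "opP T p f (\<lambda>s. c *\<^sub>C v s) t = c *\<^sub>C opP T p f v t"
  proof (cases "t \<in> {0..T}")
    case True
    then have "(LINT s:{0..T}|lborel. f (T + t, s) (c *\<^sub>C v s)) = (LINT s:{0..T}|lborel. c *\<^sub>C f (T + t, s) (v s))"
      using HomC_scaleC[OF f_HomC] by (intro set_lebesgue_integral_cong) auto
    then show ?thesis
      using True HomC_scaleC[OF p_HomC] by (simp add: opP_def set_integral_scaleC scaleC_add_right)
  qed (simp only: opP_def if_False scaleC_zero_right)
qed

lemma opP_bound:
  obtains C where "C \<ge> 0" "\<And>v M t. 0 \<le> M \<Longrightarrow> (\<And>s. norm (v s) \<le> M) \<Longrightarrow> norm (opP T p f v t) \<le> C * M"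
proof -
  obtain Cf where Cf: "Cf \<ge> 0" "kernel T (2 * T) 0 T N f Cf"
    using f_kernel by blast
  have "bounded (p ` {T..2 * T})"
    by (intro compact_imp_bounded compact_continuous_image compact_Icc continuous_on_subset[OF p_continuous]) auto
  then obtain Cp where Cp: "\<forall>t\<in>{T..2 * T}. norm (p t) \<le> Cp"
    by (auto simp: bounded_iff)
  have "norm (p T) \<le> Cp"
    using Cp T_pos by simp
  then have "0 \<le> Cp"
    by (rule order_trans[OF norm_ge_zero])
  show ?thesis
  proof (rule that[of "Cp + Cf * T"])
    show "0 \<le> Cp + Cf * T"
      using \<open>0 \<le> Cp\<close> Cf(1) T_pos by simp
    fix v :: "real \<Rightarrow> 'x" and M t assume M: "0 \<le> M" "\<And>s. norm (v s) \<le> M"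
    show "norm (opP T p f v t) \<le> (Cp + Cf * T) * M"
    proof (cases "t \<in> {0..T}")
      case True
      have "norm (p (T + t) (v T)) \<le> norm (p (T + t)) * norm (v T)"
        by (rule norm_blinfun)
      also have "\<dots> \<le> Cp * M"
        using Cp M True \<open>0 \<le> Cp\<close> by (intro mult_mono) auto
      finally have "norm (p (T + t) (v T)) \<le> Cp * M" .
      moreover have "norm (LINT s:{0..T}|lborel. f (T + t, s) (v s)) \<le> Cf * M * (T - 0)"
        using True T_pos M Cf by (intro kernel_apply_bound[OF Cf(2)]) auto
      ultimately show ?thesis
        using True norm_triangle_ineq[of "p (T + t) (v T)" "LINT s:{0..T}|lborel. f (T + t, s) (v s)"]
        by (simp add: opP_def algebra_simps)
    next
      case False
      then have "opP T p f v t = 0"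
        by (simp only: opP_def if_False)
      then show ?thesis
        using \<open>0 \<le> Cp + Cf * T\<close> M by simp
    qed
  qed
qed

text \<open>The modulus of continuity comes from p and from the L1 modulus of f alone, so one d
  serves the whole unit ball. This is the compactness of P in the form that Arzela-Ascoli
  takes.\<close>

lemma opP_equicontinuous:
  assumes t: "t \<in> {0..T}" and e: "0 < e"
  obtains d where "0 < d" "\<And>v t'. v \<in> C0 T \<Longrightarrow> (\<And>s. norm (v s) \<le> 1) \<Longrightarrow> t' \<in> {0..T} \<Longrightarrow> \<bar>t - t'\<bar> < d \<Longrightarrow>
    norm (opP T p f v t - opP T p f v t') < e"
proof -
  obtain Cf where Cf: "Cf \<ge> 0" "kernel T (2 * T) 0 T N f Cf"
    using f_kernel by blast
  interpret f: kernel T "2 * T" 0 T N f Cf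
    by (rule Cf)
  define L where "L t' = (LINT s:{0..T}|lborel. norm (f (t', s) - f (T + t, s)))" for t'
  have "(L \<longlongrightarrow> 0) (at (T + t) within {T..2 * T})"
    unfolding L_def using t by (intro f.L1_continuous) auto
  moreover have "(p \<longlongrightarrow> p (T + t)) (at (T + t) within {T..2 * T})"
  proof (rule tendsto_within_subset)
    show "(p \<longlongrightarrow> p (T + t)) (at (T + t) within {T..})"
      using p_continuous t by (simp add: continuous_on_def)
  qed auto
  ultimately have "((\<lambda>t'. norm (p t' - p (T + t)) + L t') \<longlongrightarrow> 0 + 0) (at (T + t) within {T..2 * T})"
    by (intro tendsto_add tendsto_norm_zero LIM_zero)
  then have "\<forall>\<^sub>F t' in at (T + t) within {T..2 * T}. norm (p t' - p (T + t)) + L t' < e"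
    using e by (simp add: order_tendsto_iff)
  then obtain d where d: "0 < d" "\<And>t'. t' \<in> {T..2 * T} \<Longrightarrow> t' \<noteq> T + t \<Longrightarrow> dist t' (T + t) < d \<Longrightarrow>
      norm (p t' - p (T + t)) + L t' < e"
    by (auto simp: eventually_at)
  show ?thesis
  proof (rule that[OF d(1)])
    fix v :: "real \<Rightarrow> 'x" and t' assume v: "v \<in> C0 T" "\<And>s. norm (v s) \<le> 1" and t': "t' \<in> {0..T}" "\<bar>t - t'\<bar> < d"
    show "norm (opP T p f v t - opP T p f v t') < e"
    proof (cases "t' = t")
      case False
      have "norm ((p (T + t') - p (T + t)) (v T)) \<le> norm (p (T + t') - p (T + t)) * norm (v T)"
        by (rule norm_blinfun)
      also have "\<dots> \<le> norm (p (T + t') - p (T + t))"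
        using v(2)[of T] by (simp add: mult_left_le)
      finally have P: "norm (p (T + t') (v T) - p (T + t) (v T)) \<le> norm (p (T + t') - p (T + t))"
        by (simp add: blinfun.diff_left)
      have F: "norm ((LINT s:{0..T}|lborel. f (T + t', s) (v s)) - (LINT s:{0..T}|lborel. f (T + t, s) (v s))) \<le> 1 * L (T + t')"
        unfolding L_def using t t' v C0_continuous[OF v(1)] by (intro kernel_apply_diff_bound[OF Cf(2)]) auto
      have "opP T p f v t - opP T p f v t' = - ((p (T + t') (v T) - p (T + t) (v T))
          + ((LINT s:{0..T}|lborel. f (T + t', s) (v s)) - (LINT s:{0..T}|lborel. f (T + t, s) (v s))))"
        using t t' by (simp add: opP_def)
      then have "norm (opP T p f v t - opP T p f v t') = norm ((p (T + t') (v T) - p (T + t) (v T))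
          + ((LINT s:{0..T}|lborel. f (T + t', s) (v s)) - (LINT s:{0..T}|lborel. f (T + t, s) (v s))))"
        by (simp only: norm_minus_cancel)
      also have "\<dots> \<le> norm (p (T + t') - p (T + t)) + L (T + t')"
        using P F by (intro norm_triangle_le) simp
      also have "\<dots> < e"
        using d(2)[of "T + t'"] False t' by (auto simp: dist_real_def)
      finally show ?thesis .
    qed (use e in simp)
  qed
qed

lemma input_bound:
  obtains C where "C \<ge> 0"
    "\<And>v M t. 0 \<le> M \<Longrightarrow> (\<And>s. norm (v s) \<le> M) \<Longrightarrow> norm (opQ T g v t) \<le> C * M"
    "\<And>v M t. 0 \<le> M \<Longrightarrow> (\<And>s. norm (v s) \<le> M) \<Longrightarrow> norm (opR T g v t) \<le> C * M"
proof -
  obtain C where C: "C \<ge> 0" "kernel T (2 * T) 0 (2 * T) N g C"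
    using g_kernel by blast
  have CT: "0 \<le> C * T"
    using C(1) T_pos by simp
  have Q: "norm (opQ T g v t) \<le> C * T * M" if M: "0 \<le> M" "\<And>s. norm (v s) \<le> M" for v M t
  proof (cases "t \<in> {0..T}")
    case True
    have "kernel T (2 * T) 0 T N g C"
      using T_pos by (intro kernel_mono[OF C(2)]) auto
    then have "norm (LINT s:{0..T}|lborel. g (T + t, s) (v s)) \<le> C * M * (T - 0)"
      using True T_pos M C(1) by (intro kernel_apply_bound) auto
    then show ?thesis
      using True by (simp add: opQ_def mult_ac)
  next
    case False
    then have "opQ T g v t = 0"
      by (simp only: opQ_def if_False)
    then show ?thesis
      using CT M by simp
  qed
  have R: "norm (opR T g v t) \<le> C * T * M" if M: "0 \<le> M" "\<And>s. norm (v s) \<le> M" for v M t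
  proof (cases "t \<in> {0..T}")
    case True
    have "kernel T (2 * T) T (T + t) N g C"
      using T_pos True by (intro kernel_mono[OF C(2)]) auto
    then have "norm (LINT s:{T..T + t}|lborel. g (T + t, s) (v (s - T))) \<le> C * M * (T + t - T)"
      using True T_pos M C(1) by (intro kernel_apply_bound) auto
    also have "\<dots> \<le> C * M * T"
      using True C(1) M(1) by (intro mult_left_mono) auto
    finally show ?thesis
      using True by (simp add: opR_def opR_shift mult_ac)
  next
    case False
    then have "opR T g v t = 0"
      by (simp only: opR_def if_False)
    then show ?thesis
      using CT M by simp
  qed
  show ?thesis
    using that[OF CT Q R] .
qed

end

section \<open>Stability in discrete time\<close>

instance bcontfun :: (metric_space, banach) banach ..

text \<open>Constant continuation beyond both ends of [0, T] keeps v continuous and bounded on the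
  line; \<open>restrict_C0\<close> undoes it.\<close>

definition extend :: "real \<Rightarrow> (real \<Rightarrow> 'v::real_normed_vector) \<Rightarrow> real \<Rightarrow>\<^sub>C 'v" where
  "extend T v = Bcontfun (\<lambda>t. v (max 0 (min T t)))"

definition restrict_C0 :: "real \<Rightarrow> (real \<Rightarrow>\<^sub>C 'v::real_normed_vector) \<Rightarrow> real \<Rightarrow> 'v" where
  "restrict_C0 T y = (\<lambda>t. if t \<in> {0..T} then y t else 0)"

lemma extend_apply:
  assumes "v \<in> C0 T" "0 \<le> T"
  shows "extend T v t = v (max 0 (min T t))"
proof -
  obtain M where "\<And>s. norm (v s) \<le> M"
    using C0_bounded[OF assms(1)] by blast
  moreover have "continuous_on UNIV (\<lambda>t. v (max 0 (min T t)))"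
    by (rule continuous_on_compose2[OF C0_continuous[OF assms(1)]]) (use assms(2) in \<open>auto intro!: continuous_intros\<close>)
  ultimately have "(\<lambda>t. v (max 0 (min T t))) \<in> bcontfun"
    by (intro bcontfun_normI)
  then show ?thesis
    by (simp add: extend_def Bcontfun_inverse)
qed

lemma restrict_C0_in_C0: "restrict_C0 T y \<in> C0 T"
proof -
  have "continuous_on {0..T} (restrict_C0 T y)"
    by (rule continuous_on_eq[OF continuous_on_apply_bcontfun]) (simp add: restrict_C0_def)
  then show ?thesis
    by (simp add: C0_def restrict_C0_def)
qed

lemma norm_restrict_C0: "norm (restrict_C0 T y t) \<le> norm y"
  by (simp add: restrict_C0_def norm_bounded)

lemma restrict_extend: "v \<in> C0 T \<Longrightarrow> 0 \<le> T \<Longrightarrow> restrict_C0 T (extend T v) = v"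
  by (auto simp: restrict_C0_def extend_apply C0_def fun_eq_iff)

lemma sup_norm_le_extend: "v \<in> C0 T \<Longrightarrow> 0 \<le> T \<Longrightarrow> sup_norm T v \<le> norm (extend T v)"
  using norm_restrict_C0[of T "extend T v"] by (intro sup_norm_least) (simp_all add: restrict_extend)

definition bcontfun_scaleC :: "complex \<Rightarrow> ('a::metric_space \<Rightarrow>\<^sub>C 'x::complex_fd_space) \<Rightarrow> 'a \<Rightarrow>\<^sub>C 'x" where
  "bcontfun_scaleC c y = Bcontfun (\<lambda>t. c *\<^sub>C y t)"

lemma bcontfun_scaleC_apply: "bcontfun_scaleC c y t = c *\<^sub>C y t"
proof -
  have "(\<lambda>t. c *\<^sub>C y t) \<in> bcontfun"
  proof (rule bcontfun_normI)
    show "continuous_on UNIV (\<lambda>t. c *\<^sub>C y t)"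
      by (rule bounded_linear.continuous_on[OF bounded_linear_scaleC continuous_on_apply_bcontfun])
    show "norm (c *\<^sub>C y t) \<le> cmod c * norm y" for t
      by (simp add: norm_scaleC mult_left_mono norm_bounded)
  qed
  then show ?thesis
    by (simp add: bcontfun_scaleC_def Bcontfun_inverse)
qed

lemma restrict_bcontfun_scaleC: "restrict_C0 T (bcontfun_scaleC c y) = (\<lambda>t. c *\<^sub>C restrict_C0 T y t)"
  by (simp add: restrict_C0_def bcontfun_scaleC_apply fun_eq_iff)

lemma complex_scaling_bcontfun: "complex_scaling (bcontfun_scaleC :: complex \<Rightarrow> ('a::metric_space \<Rightarrow>\<^sub>C 'x::complex_fd_space) \<Rightarrow> _)"
proof
  fix c d :: complex and r :: real and y z :: "'a \<Rightarrow>\<^sub>C 'x"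
  show "bcontfun_scaleC c (y + z) = bcontfun_scaleC c y + bcontfun_scaleC c z"
    by (rule bcontfun_eqI) (simp add: bcontfun_scaleC_apply plus_bcontfun.rep_eq scaleC_add_right)
  show "bcontfun_scaleC (c + d) y = bcontfun_scaleC c y + bcontfun_scaleC d y"
    by (rule bcontfun_eqI) (simp add: bcontfun_scaleC_apply plus_bcontfun.rep_eq scaleC_add_left)
  show sc_sc: "bcontfun_scaleC c (bcontfun_scaleC d y) = bcontfun_scaleC (c * d) y" for c d and y :: "'a \<Rightarrow>\<^sub>C 'x"
    by (rule bcontfun_eqI) (simp add: bcontfun_scaleC_apply scaleC_scaleC)
  show "r *\<^sub>R y = bcontfun_scaleC (complex_of_real r) y"
    by (rule bcontfun_eqI) (simp add: bcontfun_scaleC_apply scaleR_bcontfun.rep_eq scaleR_scaleC)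
  have le: "norm (bcontfun_scaleC c y) \<le> cmod c * norm y" for c and y :: "'a \<Rightarrow>\<^sub>C 'x"
    by (rule norm_bound) (simp add: bcontfun_scaleC_apply norm_scaleC mult_left_mono norm_bounded)
  show "norm (bcontfun_scaleC c y) = cmod c * norm y"
  proof (cases "c = 0")
    case True
    then show ?thesis
      using le[of c y] by simp
  next
    case False
    \<comment> \<open>The lower bound for the norm is the upper bound applied to the inverse
      scaling.\<close>
    have "bcontfun_scaleC (inverse c) (bcontfun_scaleC c y) = y"
      using False by (intro bcontfun_eqI) (simp add: bcontfun_scaleC_apply scaleC_scaleC scaleC_one)
    then have "norm y \<le> inverse (cmod c) * norm (bcontfun_scaleC c y)"
      using le[of "inverse c" "bcontfun_scaleC c y"] by (simp add: norm_inverse)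
    then have "cmod c * norm y \<le> norm (bcontfun_scaleC c y)"
      using False by (simp add: field_simps)
    then show ?thesis
      using le[of c y] by simp
  qed
qed

context delay_kernels
begin

text \<open>P transported to the whole Banach space. \<open>K\<close> sees y only through its
  restriction to [0, T], so the added directions lie in its null space and create no nonzero
  eigenvalue.\<close>

definition K :: "(real \<Rightarrow>\<^sub>C 'x) \<Rightarrow> real \<Rightarrow>\<^sub>C 'x" where
  "K y = extend T (opP T p f (restrict_C0 T y))"

lemma T_nonneg: "0 \<le> T"
  using T_pos by simp

lemma K_apply: "K y t = opP T p f (restrict_C0 T y) (max 0 (min T t))"
  unfolding K_def by (intro extend_apply opP_C0 restrict_C0_in_C0 T_nonneg)

lemma restrict_K: "restrict_C0 T (K y) = opP T p f (restrict_C0 T y)"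
  unfolding K_def by (intro restrict_extend opP_C0 restrict_C0_in_C0 T_nonneg)

lemma K_compact_operator: "compact_operator bcontfun_scaleC K"
proof -
  interpret complex_scaling "bcontfun_scaleC :: complex \<Rightarrow> (real \<Rightarrow>\<^sub>C 'x) \<Rightarrow> _"
    by (rule complex_scaling_bcontfun)
  have K_sc: "K (bcontfun_scaleC c y) = bcontfun_scaleC c (K y)" for c y
  proof (rule bcontfun_eqI)
    show "K (bcontfun_scaleC c y) t = bcontfun_scaleC c (K y) t" for t
      by (simp add: K_apply bcontfun_scaleC_apply restrict_bcontfun_scaleC opP_scaleC)
  qed
  obtain C where C: "C \<ge> 0" "\<And>v M t. 0 \<le> M \<Longrightarrow> (\<And>s. norm (v s) \<le> M) \<Longrightarrow> norm (opP T p f v t) \<le> C * M"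
    using opP_bound by blast
  show ?thesis
  proof (rule compact_operator.intro[OF complex_scaling_bcontfun compact_operator_axioms.intro])
    show "bounded_linear K"
    proof
      fix y z :: "real \<Rightarrow>\<^sub>C 'x"
      have "restrict_C0 T (y + z) = restrict_C0 T y + restrict_C0 T z"
        by (auto simp: restrict_C0_def plus_bcontfun.rep_eq)
      then show "K (y + z) = K y + K z"
        by (intro bcontfun_eqI) (simp add: K_apply plus_bcontfun.rep_eq opP_add restrict_C0_in_C0)
      show "K (r *\<^sub>R y) = r *\<^sub>R K y" for r
        by (simp only: scaleR_sc K_sc)
      show "\<exists>C. \<forall>y. norm (K y) \<le> norm y * C"
      proof (intro exI allI)
        fix y
        show "norm (K y) \<le> norm y * C"
          unfolding mult.commute[of _ C]
          by (intro norm_bound) (simp add: K_apply C(2) norm_restrict_C0)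
      qed
    qed
    fix Y :: "nat \<Rightarrow> real \<Rightarrow>\<^sub>C 'x" assume Y: "\<And>n. norm (Y n) \<le> 1"
    define F where "F n = opP T p f (restrict_C0 T (Y n))" for n
    have Y1: "norm (restrict_C0 T (Y n) s) \<le> 1" for n s
      using norm_restrict_C0 Y by (rule order_trans)
    obtain G k where G: "continuous_on {0..T} G" "strict_mono (k :: nat \<Rightarrow> nat)"
      "\<And>e. 0 < e \<Longrightarrow> \<exists>N. \<forall>n x. n \<ge> N \<and> x \<in> {0..T} \<longrightarrow> norm (F (k n) x - G x) < e"
    proof (rule Arzela_Ascoli[of "{0..T}" F "C * 1"])
      show "norm (F n x) \<le> C * 1" for n x
        unfolding F_def by (rule C(2)) (simp_all add: Y1)
      fix x e :: real assume x: "x \<in> {0..T}" and e: "0 < e"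
      show "\<exists>d>0. \<forall>n y. y \<in> {0..T} \<and> norm (x - y) < d \<longrightarrow> norm (F n x - F n y) < e"
        using opP_equicontinuous[OF x e] restrict_C0_in_C0 Y1 unfolding F_def real_norm_def by metis
    qed auto
    \<comment> \<open>Arzela-Ascoli controls the limit on [0, T] only; cutting it off yields an
      element of \<open>C0 T\<close>.\<close>
    define g where "g t = (if t \<in> {0..T} then G t else 0)" for t
    have g: "g \<in> C0 T"
      using G(1) continuous_on_eq[of "{0..T}" G g] by (auto simp: C0_def g_def)
    have "(\<lambda>n. K (Y (k n))) \<longlonglongrightarrow> extend T g"
    proof (rule LIMSEQ_I)
      fix e :: real assume "0 < e"
      then obtain N where N: "\<And>n x. n \<ge> N \<Longrightarrow> x \<in> {0..T} \<Longrightarrow> norm (F (k n) x - G x) < e / 2"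
        using G(3)[of "e / 2"] by auto
      have close: "norm (K (Y (k n)) - extend T g) \<le> e / 2" if "n \<ge> N" for n
      proof (rule norm_bound)
        fix t
        have "max 0 (min T t) \<in> {0..T}"
          using T_nonneg by auto
        then show "norm ((K (Y (k n)) - extend T g) t) \<le> e / 2"
          using less_imp_le[OF N[OF that, of "max 0 (min T t)"]]
          by (simp add: minus_bcontfun.rep_eq K_apply extend_apply[OF g T_nonneg] F_def g_def)
      qed
      moreover have "e / 2 < e"
        using \<open>0 < e\<close> by simp
      ultimately show "\<exists>N. \<forall>n\<ge>N. norm (K (Y (k n)) - extend T g) < e"
        by (meson le_less_trans)
    qed
    then show "\<exists>l r. strict_mono r \<and> (\<lambda>n. K (Y (r n))) \<longlonglongrightarrow> l"
      using G(2) by blast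
  qed (rule K_sc)
qed

lemma mode_in_discrete_relation:
  assumes v: "v \<in> C0 T" "opP T p f v = (\<lambda>t. z *\<^sub>C v t)"
  shows "((\<lambda>_. 0), (\<lambda>k t. z ^ k *\<^sub>C v t)) \<in> discrete_relation T p f g"
  unfolding discrete_relation_zero_input opP_scaleC v(2)
  by (auto simp: C0_scaleC[OF v(1)] scaleC_scaleC mult.commute)

lemma no_unstable_modes_imp_VIVO:
  assumes modes: "no_unstable_modes (discrete_relation T p f g)"
  shows "VIVO (vanishing_seq T) (vanishing_seq T) (discrete_relation T p f g)"
proof -
  interpret K: compact_operator bcontfun_scaleC K
    by (rule K_compact_operator)
  obtain q where q: "q < 1" "K.growth q"
  proof (rule K.exponentially_stable)
    fix z y assume z: "cmod z \<ge> 1" and y: "K y = bcontfun_scaleC z y"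
    define v where "v = restrict_C0 T y"
    have v: "v \<in> C0 T" "opP T p f v = (\<lambda>t. z *\<^sub>C v t)"
      using restrict_K[of y] unfolding y restrict_bcontfun_scaleC v_def by (simp_all add: restrict_C0_in_C0)
    define x where "x = (\<lambda>k t. z ^ k *\<^sub>C v t)"
    have "((\<lambda>_. 0), x) \<in> discrete_relation T p f g"
      unfolding x_def using v by (rule mode_in_discrete_relation)
    moreover have "x (Suc k) = (\<lambda>t. z *\<^sub>C x k t)" for k
      by (simp add: x_def scaleC_scaleC)
    ultimately have "x = (\<lambda>_. 0)"
      using modes z unfolding no_unstable_modes_def by blast
    then have "x 0 t = 0" for t
      by (simp add: zero_fun_def)
    then have "v = (\<lambda>t. 0 *\<^sub>C v t)"
      by (simp add: x_def scaleC_one fun_eq_iff)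
    \<comment> \<open>v = 0 means only that y vanishes on [0, T]. Still, homogeneity of P gives K y
      = 0, and then y = 0 because K y is z times y with z \<noteq> 0.\<close>
    then have "K y = bcontfun_scaleC 0 (K y)"
      unfolding v_def by (intro bcontfun_eqI) (metis K_apply bcontfun_scaleC_apply opP_scaleC)
    then have "cmod z * norm y = 0"
      using y K.norm_sc by (metis mult_zero_left norm_zero)
    then show "y = 0"
      using z by auto
  qed
  obtain C where C: "C \<ge> 0"
    "\<And>v M t. 0 \<le> M \<Longrightarrow> (\<And>s. norm (v s) \<le> M) \<Longrightarrow> norm (opQ T g v t) \<le> C * M"
    "\<And>v M t. 0 \<le> M \<Longrightarrow> (\<And>s. norm (v s) \<le> M) \<Longrightarrow> norm (opR T g v t) \<le> C * M"
    using input_bound by blast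
  have "vanishing_seq T x" if ux: "(u, x) \<in> discrete_relation T p f g" and u: "vanishing_seq T u" for u x
  proof -
    have uC0: "u k \<in> C0 T" and xC0: "x k \<in> C0 T"
      and step: "x (Suc k) = opP T p f (x k) + opQ T g (u k) + opR T g (u (Suc k))" for k
      using ux by (auto simp: discrete_relation_def)
    have u_nonneg: "0 \<le> sup_norm T (u k)" for k
      using sup_norm_upper[OF uC0 T_nonneg] norm_ge_zero by (rule order_trans[rotated])
    define X where "X k = extend T (x k)" for k
    \<comment> \<open>The contribution of the two input operators, viewed as a perturbation of an
      orbit of K.\<close>
    define w where "w k = X (Suc k) - K (X k)" for k
    have w_bound: "norm (w k) \<le> C * sup_norm T (u k) + C * sup_norm T (u (Suc k))" for k
    proof (rule norm_bound)
      fix t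
      define s where "s = max 0 (min T t)"
      have "w k t = x (Suc k) s - opP T p f (x k) s"
        by (simp add: w_def minus_bcontfun.rep_eq X_def extend_apply[OF xC0 T_nonneg] K_apply
            restrict_extend[OF xC0 T_nonneg] s_def)
      then have w: "w k t = opQ T g (u k) s + opR T g (u (Suc k)) s"
        by (simp add: step)
      show "norm (w k t) \<le> C * sup_norm T (u k) + C * sup_norm T (u (Suc k))"
        unfolding w by (intro norm_triangle_le add_mono C(2,3) u_nonneg sup_norm_upper uC0 T_nonneg)
    qed
    have u_lim: "(\<lambda>k. sup_norm T (u k)) \<longlonglongrightarrow> 0"
      using u by (simp add: vanishing_seq_def)
    have "(\<lambda>k. C * sup_norm T (u k) + C * sup_norm T (u (Suc k))) \<longlonglongrightarrow> C * 0 + C * 0"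
      by (intro tendsto_add tendsto_mult tendsto_const u_lim LIMSEQ_Suc[OF u_lim])
    then have "(\<lambda>k. C * sup_norm T (u k) + C * sup_norm T (u (Suc k))) \<longlonglongrightarrow> 0"
      by simp
    then have w_lim: "w \<longlonglongrightarrow> 0"
      by (rule Lim_null_comparison[OF always_eventually[OF allI[OF w_bound]]])
    have "X (Suc k) = K (X k) + w k" for k
      by (simp add: w_def)
    then have "X \<longlonglongrightarrow> 0"
      using w_lim by (rule K.perturbed_orbit_tendsto_zero[OF q])
    then have "(\<lambda>k. norm (X k)) \<longlonglongrightarrow> 0"
      by (rule tendsto_norm_zero)
    moreover have x_bound: "norm (sup_norm T (x k)) \<le> norm (X k)" for k
      using sup_norm_le_extend[OF xC0 T_nonneg] order_trans[OF norm_ge_zero sup_norm_upper[OF xC0 T_nonneg]]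
      by (simp add: X_def)
    ultimately show ?thesis
      unfolding vanishing_seq_def by (intro Lim_null_comparison[OF always_eventually[OF allI[OF x_bound]]])
  qed
  then show ?thesis
    by (auto simp: VIVO_def)
qed

lemma vanishing_seq_zero: "vanishing_seq T (\<lambda>_. 0 :: real \<Rightarrow> 'v::real_normed_vector)"
proof -
  have "sup_norm T (0 :: real \<Rightarrow> 'v::real_normed_vector) = 0"
    using T_nonneg by (simp add: sup_norm_def)
  then show ?thesis
    by (simp add: vanishing_seq_def)
qed

lemma VIVO_imp_stable:
  assumes "VIVO (vanishing_seq T) (vanishing_seq T) (discrete_relation T p f g)"
  shows "rel_stable (vanishing_seq T) (discrete_relation T p f g)"
  using assms vanishing_seq_zero by (auto simp: VIVO_def rel_stable_def)

text \<open>Along a mode with modulus at least 1 the pointwise norms never decrease, so they can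
  tend to 0 only if they are 0.\<close>

lemma stable_imp_no_unstable_modes:
  assumes stable: "rel_stable (vanishing_seq T) (discrete_relation T p f g)"
  shows "no_unstable_modes (discrete_relation T p f g)"
  unfolding no_unstable_modes_def
proof (intro allI impI, elim exE conjE)
  fix x z assume x: "((\<lambda>_. 0), x) \<in> discrete_relation T p f g"
    and z: "cmod z \<ge> 1" and mode: "\<forall>k. x (Suc k) = (\<lambda>t. z *\<^sub>C x k t)"
  have xC0: "x k \<in> C0 T" for k
    using x by (simp add: discrete_relation_def)
  have lim: "(\<lambda>k. sup_norm T (x k)) \<longlonglongrightarrow> 0"
    using stable x by (simp add: rel_stable_def vanishing_seq_def)
  have "norm (x k t) \<le> 0" for k t
  proof (rule LIMSEQ_le_const[OF LIMSEQ_ignore_initial_segment[OF lim, of k]])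
    have "norm (x k t) \<le> norm (x (n + k) t)" for n
    proof (induction n)
      case (Suc n)
      have "1 * norm (x (n + k) t) \<le> cmod z * norm (x (n + k) t)"
        using z by (intro mult_right_mono) auto
      then show ?case
        using Suc mode by (simp add: norm_scaleC)
    qed simp
    then show "\<exists>N. \<forall>n\<ge>N. norm (x k t) \<le> sup_norm T (x (n + k))"
      using sup_norm_upper[OF xC0 T_nonneg] order_trans by blast
  qed
  then show "x = (\<lambda>_. 0)"
    by (simp add: fun_eq_iff zero_fun_def)
qed

end

section \<open>Smooth solutions\<close>

lemma at_within_atLeast_nontrivial: "a \<le> t \<Longrightarrow> at (t::real) within {a..} \<noteq> bot"
proof -
  assume "a \<le> t"
  then have "at_right t \<le> at t within {a..}"
    by (intro at_le) auto
  then show ?thesis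
    using trivial_limit_at_right_real[of t] bot.extremum_uniqueI[of "at_right t"] by metis
qed

lemma nderiv_0 [simp]: "nderiv 0 f = f"
  by (simp add: nderiv_def)

lemma nderiv_Suc: "nderiv (Suc k) f t = vector_derivative (nderiv k f) (at t within {0..})"
  by (simp add: nderiv_def)

lemma nderiv_Suc_eq:
  assumes "0 \<le> t" "(nderiv k f has_vector_derivative D) (at t within {0..})"
  shows "nderiv (Suc k) f t = D"
  unfolding nderiv_Suc by (rule vector_derivative_within[OF at_within_atLeast_nontrivial[OF assms(1)] assms(2)])

lemma Cinf_has_vector_derivative:
  assumes "f \<in> Cinf" "0 \<le> t"
  shows "(nderiv k f has_vector_derivative nderiv (Suc k) f t) (at t within {0..})"
  using assms unfolding nderiv_Suc vector_derivative_works[symmetric] Cinf_def by blast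

lemma CinfI:
  assumes "\<And>t. t < 0 \<Longrightarrow> f t = 0"
    and "\<And>k t. 0 \<le> t \<Longrightarrow> (nderiv k f has_vector_derivative nderiv (Suc k) f t) (at t within {0..})"
  shows "f \<in> Cinf"
  unfolding Cinf_def mem_Collect_eq
  by (intro conjI allI impI assms(1) differentiableI_vector[OF assms(2)])

lemma Cinf_continuous:
  assumes "f \<in> Cinf"
  shows "continuous_on {0..} f"
  unfolding continuous_on_eq_continuous_within
proof
  fix t :: real assume "t \<in> {0..}"
  then show "continuous (at t within {0..}) f"
    using Cinf_has_vector_derivative[OF assms, of t 0] by (intro has_vector_derivative_continuous) simp
qed

text \<open>Restricted to 0 \<le> t because for t < 0 the filter within \<open>{0..}\<close> is
  trivial and \<open>vector_derivative\<close> is an unspecified value, even for the zero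
  function.\<close>

lemma nderiv_zero:
  assumes "0 \<le> t"
  shows "nderiv k (\<lambda>_. 0 :: 'v::real_normed_vector) t = 0"
    and "(nderiv k (\<lambda>_. 0 :: 'v) has_vector_derivative 0) (at t within {0..})"
proof -
  have step: "(nderiv k (\<lambda>_. 0 :: 'v) has_vector_derivative 0) (at s within {0..})"
    if "\<forall>t\<ge>0. nderiv k (\<lambda>_. 0 :: 'v) t = 0" "0 \<le> s" for k s
    using that by (intro has_vector_derivative_transform[OF _ _ has_vector_derivative_const[of 0]]) auto
  have zero: "\<forall>t\<ge>0. nderiv k (\<lambda>_. 0 :: 'v) t = 0" for k
  proof (induction k)
    case (Suc k)
    then show ?case
      using nderiv_Suc_eq step by blast
  qed simp
  show "nderiv k (\<lambda>_. 0 :: 'v) t = 0"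
    using zero assms by blast
  show "(nderiv k (\<lambda>_. 0 :: 'v) has_vector_derivative 0) (at t within {0..})"
    by (rule step[OF zero assms])
qed

lemma zero_Cinf: "(\<lambda>_. 0) \<in> Cinf"
proof (rule CinfI)
  fix k and t :: real assume "0 \<le> t"
  then show "(nderiv k (\<lambda>_. 0 :: 'a) has_vector_derivative nderiv (Suc k) (\<lambda>_. 0) t) (at t within {0..})"
    unfolding nderiv_zero(1)[OF \<open>0 \<le> t\<close>, of "Suc k"] by (rule nderiv_zero(2))
qed simp

lemma smoothly_vanishing_imp_vanishing: "smoothly_vanishing f \<Longrightarrow> vanishing f"
  unfolding smoothly_vanishing_def vanishing_def by (drule spec[of _ 0]) simp

lemma VIVO_D: "VIVO P Q \<R> \<Longrightarrow> (u, y) \<in> \<R> \<Longrightarrow> P u \<Longrightarrow> Q y"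
  by (auto simp: VIVO_def)

lemma smoothly_vanishing_zero: "smoothly_vanishing (\<lambda>_. 0 :: 'v::real_normed_vector)"
  unfolding smoothly_vanishing_def
proof
  fix k
  have "\<forall>\<^sub>F t in at_top. (0 :: 'v) = nderiv k (\<lambda>_. 0) t"
    using eventually_ge_at_top[of 0] by eventually_elim (simp add: nderiv_zero)
  then show "(nderiv k (\<lambda>_. 0 :: 'v) \<longlongrightarrow> 0) at_top"
    by (rule Lim_transform_eventually[OF tendsto_const])
qed

text \<open>The strict inequality puts t - a in the interior of the half-line, where the one-sided
  derivative is two-sided.\<close>

lemma has_vector_derivative_delayed:
  fixes F :: "'v::real_normed_vector \<Rightarrow>\<^sub>L 'w::real_normed_vector"
  assumes "a < t" "(y has_vector_derivative D) (at (t - a) within {0..})"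
  shows "((\<lambda>s. F (y (s - a))) has_vector_derivative F D) (at t)"
proof -
  have "t - a \<in> interior {0..}"
    using assms(1) by simp
  then have "(y has_vector_derivative D) (at (t - a))"
    using assms(2) at_within_interior by metis
  then have "(y has_vector_derivative D) (at (t - a) within (\<lambda>s. s - a) ` UNIV)"
    by (rule has_vector_derivative_at_within)
  moreover have "((\<lambda>s. s - a) has_vector_derivative 1) (at t)"
    by (auto intro!: derivative_eq_intros)
  ultimately have "((y \<circ> (\<lambda>s. s - a)) has_vector_derivative 1 *\<^sub>R D) (at t)"
    by (intro vector_diff_chain_within)
  then have "((\<lambda>s. y (s - a)) has_vector_derivative D) (at t)"
    by (simp add: o_def)
  from bounded_linear.has_vector_derivative[OF blinfun.bounded_linear_right this]
  show ?thesis .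
qed

section \<open>Regularity of solutions\<close>

context delay_system
begin

text \<open>Differentiates the equation once more: its right side at level k is differentiable
  because the delayed functions are. Working on the open half-line T < t allows two-sided
  derivatives and replacing the left side by the right side near t.\<close>

lemma delay_bootstrap:
  assumes x: "\<And>t. 0 \<le> t \<Longrightarrow> (nderiv k x has_vector_derivative nderiv (Suc k) x t) (at t within {0..})"
    and u: "\<And>t. 0 \<le> t \<Longrightarrow> (nderiv k u has_vector_derivative nderiv (Suc k) u t) (at t within {0..})"
    and eq: "\<And>t. T < t \<Longrightarrow> nderiv (Suc k) x t = delay_rhs (nderiv k u) (nderiv k x) t"
    and t: "T < t"
  shows "(nderiv (Suc k) x has_vector_derivative delay_rhs (nderiv (Suc k) u) (nderiv (Suc k) x) t) (at t within {0..})"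
proof -
  have "((\<lambda>t. delay_rhs (nderiv k u) (nderiv k x) t) has_vector_derivative
      delay_rhs (nderiv (Suc k) u) (nderiv (Suc k) x) t) (at t)"
    unfolding delay_rhs_def
  proof (intro has_vector_derivative_sum has_vector_derivative_add)
    fix j assume "j \<in> {..m}"
    then have j: "\<tau> j < t"
      using \<tau>_le[of j m] t by auto
    show "((\<lambda>t. A j (nderiv k x (t - \<tau> j))) has_vector_derivative A j (nderiv (Suc k) x (t - \<tau> j))) (at t)"
      using j by (intro has_vector_derivative_delayed x) auto
    show "((\<lambda>t. B j (nderiv k u (t - \<tau> j))) has_vector_derivative B j (nderiv (Suc k) u (t - \<tau> j))) (at t)"
      using j by (intro has_vector_derivative_delayed u) auto
  qed
  then have "(nderiv (Suc k) x has_vector_derivative delay_rhs (nderiv (Suc k) u) (nderiv (Suc k) x) t) (at t)"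
    by (rule has_vector_derivative_transform_within_open[of _ _ _ "{T<..}"]) (use t eq in auto)
  then show ?thesis
    by (rule has_vector_derivative_at_within)
qed

lemma delay_relation_iff:
  "(u, x) \<in> delay_relation m \<tau> A B \<longleftrightarrow> u \<in> Cinf \<and> x \<in> Cinf \<and>
    (\<forall>t\<ge>T. (x has_vector_derivative delay_rhs u x t) (at t within {0..}))"
  by (simp add: delay_relation_def delay_rhs_def)

lemma delay_relation_ode:
  assumes "(u, x) \<in> delay_relation m \<tau> A B"
  shows "delay_ode u x"
  unfolding delay_ode_def
proof (intro allI impI)
  fix t assume "T \<le> t"
  then have "(x has_vector_derivative delay_rhs u x t) (at t within {0..})"
    using assms by (simp add: delay_relation_iff)
  then show "(x has_vector_derivative delay_rhs u x t) (at t within {T..})"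
    by (rule has_vector_derivative_within_subset) (use T_pos in auto)
qed

lemma delay_rhs_vanishing:
  assumes "(u \<longlongrightarrow> 0) at_top" "(x \<longlongrightarrow> 0) at_top"
  shows "(delay_rhs u x \<longlongrightarrow> 0) at_top"
proof -
  have shift: "((\<lambda>t. F (y (t - a))) \<longlongrightarrow> F 0) at_top" if "(y \<longlongrightarrow> 0) at_top"
    for F :: "'v::real_normed_vector \<Rightarrow>\<^sub>L 'w::real_normed_vector" and y :: "real \<Rightarrow> 'v" and a :: real
  proof -
    have "filterlim (\<lambda>t::real. - a + t) at_top at_top"
      by (rule filterlim_tendsto_add_at_top[OF tendsto_const filterlim_ident])
    then have "((\<lambda>t. y (- a + t)) \<longlongrightarrow> 0) at_top"
      by (rule filterlim_compose[OF that])
    from bounded_linear.tendsto[OF blinfun.bounded_linear_right this] show ?thesis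
      by simp
  qed
  have "((\<lambda>t. \<Sum>j\<le>m. A j (x (t - \<tau> j)) + B j (u (t - \<tau> j))) \<longlongrightarrow> (\<Sum>j\<le>m. A j 0 + B j 0)) at_top"
    by (intro tendsto_sum tendsto_add shift assms)
  then show ?thesis
    by (simp add: delay_rhs_def[abs_def] blinfun.zero_right)
qed

lemma VIVO_imp_smoothly_VIVO:
  assumes "VIVO vanishing vanishing (delay_relation m \<tau> A B)"
  shows "VIVO smoothly_vanishing smoothly_vanishing (delay_relation m \<tau> A B)"
  unfolding VIVO_def
proof (intro ballI, clarify)
  fix u x assume ux: "(u, x) \<in> delay_relation m \<tau> A B" and u: "smoothly_vanishing u"
  have x: "(x \<longlongrightarrow> 0) at_top"
    using VIVO_D[OF assms, OF ux, OF smoothly_vanishing_imp_vanishing[OF u]] by (simp add: vanishing_def)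
  have smooth: "u \<in> Cinf" "x \<in> Cinf"
    and eq: "\<And>t. t \<ge> T \<Longrightarrow> (x has_vector_derivative delay_rhs u x t) (at t within {0..})"
    using ux by (auto simp: delay_relation_iff)
  \<comment> \<open>The differentiated equation is carried along with the limit, since it is what
    makes the next derivative vanish.\<close>
  have "(nderiv k x \<longlongrightarrow> 0) at_top \<and> (\<forall>t>T. nderiv (Suc k) x t = delay_rhs (nderiv k u) (nderiv k x) t)" for k
  proof (induction k)
    case 0
    then show ?case
      using x eq T_pos by (auto intro!: nderiv_Suc_eq)
  next
    case (Suc k)
    have "\<forall>\<^sub>F t in at_top. delay_rhs (nderiv k u) (nderiv k x) t = nderiv (Suc k) x t"
      using eventually_gt_at_top[of T] by eventually_elim (use Suc in simp)
    moreover have "(delay_rhs (nderiv k u) (nderiv k x) \<longlongrightarrow> 0) at_top"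
      using u Suc by (intro delay_rhs_vanishing) (auto simp: smoothly_vanishing_def)
    ultimately have "(nderiv (Suc k) x \<longlongrightarrow> 0) at_top"
      by (rule Lim_transform_eventually[rotated])
    moreover have "nderiv (Suc (Suc k)) x t = delay_rhs (nderiv (Suc k) u) (nderiv (Suc k) x) t" if "t > T" for t
    proof (rule nderiv_Suc_eq)
      show "(nderiv (Suc k) x has_vector_derivative delay_rhs (nderiv (Suc k) u) (nderiv (Suc k) x) t) (at t within {0..})"
        using that Suc by (intro delay_bootstrap Cinf_has_vector_derivative smooth) auto
    qed (use that T_pos in simp)
    ultimately show ?case
      by blast
  qed
  then show "smoothly_vanishing x"
    by (simp add: smoothly_vanishing_def)
qed

lemma smoothly_VIVO_imp_stable:
  assumes "VIVO smoothly_vanishing smoothly_vanishing (delay_relation m \<tau> A B)"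
  shows "rel_stable vanishing (delay_relation m \<tau> A B)"
  unfolding rel_stable_def
proof (intro allI impI)
  fix x assume "((\<lambda>_. 0), x) \<in> delay_relation m \<tau> A B"
  from smoothly_vanishing_imp_vanishing[OF VIVO_D[OF assms, OF this, OF smoothly_vanishing_zero]]
  show "vanishing x" .
qed

text \<open>A solution that is multiplied by \<open>z\<close> over each period is smooth on all of \<open>[0, \<infinity>)\<close>, because
  it inherits on \<open>[0, T]\<close> the regularity that the equation provides at later times.\<close>

lemma periodic_mode_smooth:
  assumes x: "continuous_on {0..} x" "delay_ode (\<lambda>_. 0) x"
    and mode: "\<And>t. 0 \<le> t \<Longrightarrow> x (T + t) = z *\<^sub>C x t" and z: "z \<noteq> 0"
  defines "X \<equiv> (\<lambda>t. if t < 0 then 0 else x t)"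
  shows "((\<lambda>_. 0), X) \<in> delay_relation m \<tau> A B"
proof -
  \<comment> \<open>y on [0, \<infinity>) is the rescaled copy of its values from T on, so a
    derivative at T + t yields one at t, including the one-sided derivative at 0.\<close>
  have propagate: "(y has_vector_derivative inverse z *\<^sub>C D) (at t within {0..})"
    if "\<And>s. 0 \<le> s \<Longrightarrow> y (T + s) = z *\<^sub>C y s" "0 \<le> t" "(y has_vector_derivative D) (at (T + t) within {0..})"
    for y :: "real \<Rightarrow> 'x" and D t
  proof -
    have "(y has_vector_derivative D) (at (T + t) within (\<lambda>s. T + s) ` {0..})"
      using that(3) by (rule has_vector_derivative_within_subset) (use T_pos in auto)
    moreover have "((\<lambda>s. T + s) has_vector_derivative 1) (at t within {0..})"
      by (auto intro!: derivative_eq_intros)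
    ultimately have "((y \<circ> (\<lambda>s. T + s)) has_vector_derivative 1 *\<^sub>R D) (at t within {0..})"
      by (intro vector_diff_chain_within)
    then have "((\<lambda>s. y (T + s)) has_vector_derivative D) (at t within {0..})"
      by (simp add: o_def)
    then have "((\<lambda>s. inverse z *\<^sub>C y (T + s)) has_vector_derivative inverse z *\<^sub>C D) (at t within {0..})"
      by (rule bounded_linear.has_vector_derivative[OF bounded_linear_scaleC])
    then show ?thesis
      by (rule has_vector_derivative_transform[rotated 2])
        (use that z in \<open>auto simp: scaleC_scaleC scaleC_one\<close>)
  qed
  have rhs_X: "delay_rhs (\<lambda>_. 0) X t = delay_rhs (\<lambda>_. 0) x t" if "T \<le> t" for t
    unfolding delay_rhs_def
  proof (rule sum.cong[OF refl])
    fix j assume "j \<in> {..m}"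
    then have "\<tau> j \<le> t"
      using \<tau>_le[of j m] that by auto
    then show "A j (X (t - \<tau> j)) + B j 0 = A j (x (t - \<tau> j)) + B j 0"
      by (simp add: X_def)
  qed
  have X_ode: "(X has_vector_derivative delay_rhs (\<lambda>_. 0) X t) (at t within {0..})" if "T < t" for t
  proof -
    have "(x has_vector_derivative delay_rhs (\<lambda>_. 0) x t) (at t within {T..})"
      using x(2) that by (simp add: delay_ode_def)
    moreover have "t \<in> interior {T..}"
      using that by simp
    ultimately have "(x has_vector_derivative delay_rhs (\<lambda>_. 0) X t) (at t)"
      using that rhs_X at_within_interior by (metis less_imp_le)
    then have "(X has_vector_derivative delay_rhs (\<lambda>_. 0) X t) (at t)"
      by (rule has_vector_derivative_transform_within_open[of _ _ _ "{T<..}"]) (use that T_pos in \<open>auto simp: X_def\<close>)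
    then show ?thesis
      by (rule has_vector_derivative_at_within)
  qed
  \<comment> \<open>Differentiability is known strictly after T. One step back by T reaches only t >
    0; the second step is what includes t = 0.\<close>
  have smooth_step: "(y has_vector_derivative vector_derivative y (at t within {0..})) (at t within {0..})"
    if y: "\<And>s. 0 \<le> s \<Longrightarrow> y (T + s) = z *\<^sub>C y s" and D: "\<And>s. T < s \<Longrightarrow> (y has_vector_derivative D s) (at s within {0..})"
      and "0 \<le> t" for y D :: "real \<Rightarrow> 'x" and t
  proof -
    have once: "(y has_vector_derivative inverse z *\<^sub>C D (T + (T + t))) (at (T + t) within {0..})"
      using T_pos \<open>0 \<le> t\<close> by (intro propagate[where y = y, OF y _ D]) auto
    have "(y has_vector_derivative inverse z *\<^sub>C inverse z *\<^sub>C D (T + (T + t))) (at t within {0..})"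
      by (intro propagate[where y = y] once y \<open>0 \<le> t\<close>)
    then show ?thesis
      unfolding vector_derivative_works[symmetric] by (rule differentiableI_vector)
  qed
  have X_mode: "X (T + t) = z *\<^sub>C X t" if "0 \<le> t" for t
    using that mode T_pos by (simp add: X_def)
  \<comment> \<open>The three facts are proved together: scaling and the equation give
    differentiability at the next level, and differentiability transfers the scaling to the next
    derivative.\<close>
  have main: "(\<forall>t\<ge>0. nderiv k X (T + t) = z *\<^sub>C nderiv k X t) \<and>
      (\<forall>t\<ge>0. (nderiv k X has_vector_derivative nderiv (Suc k) X t) (at t within {0..})) \<and>
      (\<forall>t>T. nderiv (Suc k) X t = delay_rhs (nderiv k (\<lambda>_. 0)) (nderiv k X) t)" for k
  proof (induction k)
    case 0
    have "(X has_vector_derivative nderiv 1 X t) (at t within {0..})" if "0 \<le> t" for t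
      using smooth_step[where y = X, OF X_mode X_ode that] by (simp add: nderiv_Suc)
    moreover have "nderiv (Suc 0) X t = delay_rhs (\<lambda>_. 0) X t" if "T < t" for t
    proof (rule nderiv_Suc_eq)
      show "(nderiv 0 X has_vector_derivative delay_rhs (\<lambda>_. 0) X t) (at t within {0..})"
        using X_ode[OF that] by simp
    qed (use that T_pos in simp)
    ultimately show ?case
      using X_mode by simp
  next
    case (Suc k)
    note IH = Suc.IH[THEN conjunct1, rule_format] Suc.IH[THEN conjunct2, THEN conjunct1, rule_format]
      Suc.IH[THEN conjunct2, THEN conjunct2, rule_format]
    have scale: "nderiv (Suc k) X (T + t) = z *\<^sub>C nderiv (Suc k) X t" if "0 \<le> t" for t
    proof -
      have "(nderiv k X has_vector_derivative inverse z *\<^sub>C nderiv (Suc k) X (T + t)) (at t within {0..})"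
        using that T_pos by (intro propagate[where y = "nderiv k X", OF IH(1) _ IH(2)]) auto
      then have "nderiv (Suc k) X t = inverse z *\<^sub>C nderiv (Suc k) X (T + t)"
        by (rule nderiv_Suc_eq[OF that])
      then show ?thesis
        using z by (simp add: scaleC_scaleC scaleC_one)
    qed
    have ode: "(nderiv (Suc k) X has_vector_derivative
        delay_rhs (nderiv (Suc k) (\<lambda>_. 0)) (nderiv (Suc k) X) t) (at t within {0..})" if "T < t" for t
      using Cinf_has_vector_derivative[OF zero_Cinf] IH(2,3) that by (intro delay_bootstrap)
    have "(nderiv (Suc k) X has_vector_derivative nderiv (Suc (Suc k)) X t) (at t within {0..})" if "0 \<le> t" for t
      unfolding nderiv_Suc[of "Suc k"] using scale ode that by (rule smooth_step)
    moreover have "nderiv (Suc (Suc k)) X t = delay_rhs (nderiv (Suc k) (\<lambda>_. 0)) (nderiv (Suc k) X) t" if "T < t" for t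
      using that T_pos by (intro nderiv_Suc_eq[OF _ ode]) auto
    ultimately show ?case
      using scale by blast
  qed
  \<comment> \<open>At t = T a derivative within \<open>{0..}\<close> includes the left side, which
    the equation does not provide directly; it is pulled back from time T + t, where the right side
    is z times as large.\<close>
  have "(X has_vector_derivative delay_rhs (\<lambda>_. 0) X t) (at t within {0..})" if t: "T \<le> t" for t
  proof -
    have "delay_rhs (\<lambda>_. 0) X (T + t) = z *\<^sub>C delay_rhs (\<lambda>_. 0) X t"
    proof -
      have "A j (X (T + t - \<tau> j)) = z *\<^sub>C A j (X (t - \<tau> j))" if "j \<in> {..m}" for j
        using X_mode[of "t - \<tau> j"] \<tau>_le[of j m] that t HomC_scaleC[OF A_HomC]
        by (simp add: add_diff_eq)
      then show ?thesis
        by (simp add: delay_rhs_def blinfun.zero_right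
            linear_sum[OF bounded_linear.linear[OF bounded_linear_scaleC]])
    qed
    moreover have "(X has_vector_derivative inverse z *\<^sub>C delay_rhs (\<lambda>_. 0) X (T + t)) (at t within {0..})"
      using t T_pos by (intro propagate[where y = X, OF X_mode _ X_ode]) auto
    ultimately show ?thesis
      using z by (simp add: scaleC_scaleC scaleC_one)
  qed
  moreover have "X \<in> Cinf"
    using main by (intro CinfI) (auto simp: X_def)
  ultimately show ?thesis
    using zero_Cinf by (simp add: delay_relation_iff)
qed

end

section \<open>Between segments and continuous time\<close>

context delay_kernels
begin

text \<open>Segments cover the half-line, so a continuous signal vanishes exactly when the sup norms
  of its segments do; \<open>segments_discrete\<close> carries the property over.\<close>

lemma VIVO_discrete_imp_VIVO:
  assumes V: "VIVO (vanishing_seq T) (vanishing_seq T) (discrete_relation T p f g)"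
  shows "VIVO vanishing vanishing (delay_relation m \<tau> A B)"
  unfolding VIVO_def
proof (intro ballI, clarify)
  fix u x assume ux: "(u, x) \<in> delay_relation m \<tau> A B" and u: "vanishing u"
  have cont: "continuous_on {0..} u" "continuous_on {0..} x"
    using ux Cinf_continuous by (auto simp: delay_relation_iff)
  have "vanishing_seq T (\<lambda>k. segment T k u)"
    unfolding vanishing_seq_def
  proof (rule LIMSEQ_I)
    fix e :: real assume e: "0 < e"
    then obtain a where a: "\<And>t. t \<ge> a \<Longrightarrow> norm (u t) < e / 2"
      using u tendstoD[of u 0 at_top "e / 2"] by (auto simp: vanishing_def eventually_at_top_linorder)
    obtain n where n: "a < real n * T"
      using reals_Archimedean3[OF T_pos] by blast
    have "norm (sup_norm T (segment T k u)) < e" if "k \<ge> n" for k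
    proof -
      have "real n * T \<le> real k * T"
        using that T_pos by (intro mult_right_mono) auto
      then have "norm (segment T k u t) \<le> e / 2" if "t \<in> {0..T}" for t
        using a[of "real k * T + t"] n that by (simp add: segment_def)
      then have "sup_norm T (segment T k u) \<le> e / 2"
        by (rule sup_norm_least[OF T_nonneg])
      moreover have "0 \<le> sup_norm T (segment T k u)"
        using sup_norm_upper[OF segment_C0[OF T_nonneg cont(1)] T_nonneg, of k 0]
        by (rule order_trans[OF norm_ge_zero])
      ultimately show ?thesis
        using e by simp
    qed
    then show "\<exists>n. \<forall>k\<ge>n. norm (sup_norm T (segment T k u) - 0) < e"
      by auto
  qed
  then have "vanishing_seq T (\<lambda>k. segment T k x)"
    by (rule VIVO_D[OF V, OF segments_discrete[OF cont delay_relation_ode[OF ux]]])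
  then have lim: "(\<lambda>k. sup_norm T (segment T k x)) \<longlonglongrightarrow> 0"
    by (simp add: vanishing_seq_def)
  show "vanishing x"
    unfolding vanishing_def
  proof (rule tendstoI)
    fix e :: real assume "0 < e"
    then obtain n where n: "\<And>k. k \<ge> n \<Longrightarrow> sup_norm T (segment T k x) < e"
      using order_tendstoD(2)[OF lim] by (auto simp: eventually_sequentially)
    have "norm (x t) < e" if t: "t \<ge> real n * T" for t
    proof -
      \<comment> \<open>The index of the segment containing t; the position t - k T within it lies
        in [0, T).\<close>
      define k where "k = nat \<lfloor>t / T\<rfloor>"
      have tT: "real n \<le> t / T"
        using t T_pos by (simp add: pos_le_divide_eq)
      then have fl: "real k = of_int \<lfloor>t / T\<rfloor>"
        unfolding k_def by (simp add: order_trans[OF of_nat_0_le_iff])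
      have "real k \<le> t / T" "t / T < real k + 1"
        unfolding fl by linarith+
      then have "real k * T \<le> t" "t < (real k + 1) * T"
        using T_pos by (simp_all add: pos_le_divide_eq pos_divide_less_eq)
      then have "x t = segment T k x (t - real k * T)"
        by (simp add: segment_def algebra_simps)
      moreover have "n \<le> k"
        using tT unfolding k_def by (simp add: le_nat_floor le_floor_iff nat_le_iff)
      ultimately show ?thesis
        using n[of k] sup_norm_upper[OF segment_C0[OF T_nonneg cont(2)] T_nonneg, of k "t - real k * T"]
        by simp
    qed
    then show "\<forall>\<^sub>F t in at_top. dist (x t) 0 < e"
      using eventually_at_top_linorder by auto
  qed
qed

text \<open>The eigenvalue equation gives the scaling on the first segment only. Beyond it, the
  solution formula with zero input determines both the shifted solution and x from their first
  segments, complex-linearly, so the factor z persists.\<close>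

lemma mode_solution:
  assumes v: "v \<in> C0 T" and mode: "opP T p f v = (\<lambda>t. z *\<^sub>C v t)"
  obtains x where "continuous_on {0..} x" "delay_ode (\<lambda>_. 0) x" "segment T 0 x = v"
    "\<And>t. 0 \<le> t \<Longrightarrow> x (T + t) = z *\<^sub>C x t"
proof -
  obtain x where x: "continuous_on {0..} x" "delay_ode (\<lambda>_. 0) x" "segment T 0 x = v"
    "segment T 1 x = opP T p f v"
    using solution_from_initial[OF v] by blast
  define y where "y t = x (T + t)" for t
  have y_cont: "continuous_on {0..} y"
    unfolding y_def by (rule continuous_on_compose2[OF x(1)]) (use T_pos in \<open>auto intro!: continuous_intros\<close>)
  have y_ode: "delay_ode (\<lambda>_. 0) y"
    using delay_ode_shift[OF x(2) T_nonneg] by (simp add: y_def[abs_def])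
  have y_short: "y t = z *\<^sub>C x t" if "t \<in> {0..T}" for t
  proof -
    have "y t = segment T 1 x t" "x t = segment T 0 x t"
      using that by (simp_all add: y_def segment_def)
    then show ?thesis
      using x(3,4) mode by simp
  qed
  have formula: "w t = p t (w T) + (LINT s:{0..T}|lborel. f (t, s) (w s))"
    if "continuous_on {0..} w" "delay_ode (\<lambda>_. 0) w" "T \<le> t" for w t
  proof -
    have "\<forall>t\<ge>T. w t = p t (w T) + (LINT s:{0..T}|lborel. f (t, s) (w s)) + (LINT s:{0..t}|lborel. g (t, s) 0)"
      using that(2) unfolding solution_formula[OF continuous_on_const that(1)] .
    then have "w t = p t (w T) + (LINT s:{0..T}|lborel. f (t, s) (w s)) + (LINT s:{0..t}|lborel. g (t, s) 0)"
      using that(3) by blast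
    then show ?thesis
      by (simp add: blinfun.zero_right)
  qed
  have "y t = z *\<^sub>C x t" if t: "0 \<le> t" for t
  proof (cases "t \<le> T")
    case False
    then have t: "T \<le> t" by simp
    have "(LINT s:{0..T}|lborel. f (t, s) (y s)) = (LINT s:{0..T}|lborel. z *\<^sub>C f (t, s) (x s))"
      using y_short HomC_scaleC[OF f_HomC[OF t]] by (intro set_lebesgue_integral_cong) auto
    then have "y t = z *\<^sub>C (p t (x T) + (LINT s:{0..T}|lborel. f (t, s) (x s)))"
      unfolding formula[OF y_cont y_ode t] using y_short[of T] T_nonneg HomC_scaleC[OF p_HomC[OF t]]
      by (simp add: set_integral_scaleC scaleC_add_right)
    then show ?thesis
      by (simp only: formula[OF x(1,2) t, symmetric])
  qed (use t y_short in simp)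
  then show ?thesis
    using that x by (simp add: y_def)
qed

lemma stable_imp_no_unstable_discrete_modes:
  assumes stable: "rel_stable vanishing (delay_relation m \<tau> A B)"
  shows "no_unstable_modes (discrete_relation T p f g)"
  unfolding no_unstable_modes_def
proof (intro allI impI, elim exE conjE)
  fix xd z assume xd: "((\<lambda>_. 0), xd) \<in> discrete_relation T p f g"
    and z: "cmod z \<ge> 1" and mode: "\<forall>k. xd (Suc k) = (\<lambda>t. z *\<^sub>C xd k t)"
  \<comment> \<open>Each entry of the sequence is itself mapped by P to z times itself, so each is
    extended to a solution of its own.\<close>
  have "xd k = 0" for k
  proof -
    have v: "xd k \<in> C0 T" "opP T p f (xd k) = (\<lambda>t. z *\<^sub>C xd k t)"
      using xd mode unfolding discrete_relation_zero_input by metis+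
    obtain x where x: "continuous_on {0..} x" "delay_ode (\<lambda>_. 0) x" "segment T 0 x = xd k"
      "\<And>t. 0 \<le> t \<Longrightarrow> x (T + t) = z *\<^sub>C x t"
      using mode_solution[OF v] by blast
    have "z \<noteq> 0"
      using z by auto
    with x have "((\<lambda>_. 0), (\<lambda>t. if t < 0 then 0 else x t)) \<in> delay_relation m \<tau> A B"
      by (intro periodic_mode_smooth)
    then have lim: "((\<lambda>t. if t < 0 then 0 else x t) \<longlongrightarrow> 0) at_top"
      using stable by (simp add: rel_stable_def vanishing_def)
    have "x t = 0" if t: "0 \<le> t" for t
    proof -
      \<comment> \<open>Sampling at spacing T multiplies the norm by a factor at least 1, so
        convergence to 0 along the samples forces the first one to be 0.\<close>
      have grow: "norm (x t) \<le> norm (x (real n * T + t))" for n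
      proof (induction n)
        case (Suc n)
        define s where "s = real n * T + t"
        have "0 \<le> s"
          using t T_pos by (simp add: s_def)
        then have "norm (x (T + s)) = cmod z * norm (x s)"
          using x(4) by (simp add: norm_scaleC)
        moreover have "1 * norm (x s) \<le> cmod z * norm (x s)"
          using z by (intro mult_right_mono) auto
        moreover have eq: "real (Suc n) * T + t = T + s"
          by (simp add: s_def algebra_simps)
        ultimately show ?case
          using Suc unfolding eq s_def[symmetric] by simp
      qed simp
      have "filterlim (\<lambda>n. real n * T + t) at_top sequentially"
        using T_pos by real_asymp
      then have "(\<lambda>n. if real n * T + t < 0 then 0 else x (real n * T + t)) \<longlonglongrightarrow> 0"
        by (rule filterlim_compose[OF lim])
      moreover have "\<not> real n * T + t < 0" for n
        using t T_pos by (simp add: not_less)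
      ultimately have "(\<lambda>n. x (real n * T + t)) \<longlonglongrightarrow> 0"
        by simp
      then have "(\<lambda>n. norm (x (real n * T + t))) \<longlonglongrightarrow> 0"
        by (rule tendsto_norm_zero)
      then have "norm (x t) \<le> 0"
        using grow by (intro LIMSEQ_le_const) blast+
      then show ?thesis by simp
    qed
    then have "segment T 0 x = 0"
      by (simp add: segment_def fun_eq_iff)
    then show ?thesis
      using x(3) by simp
  qed
  then show "xd = (\<lambda>_. 0)"
    by auto
qed

end

theorem theorem6p3:
  fixes m :: nat and \<tau> :: "nat \<Rightarrow> real"
    and A :: "nat \<Rightarrow> 'x::complex_fd_space \<Rightarrow>\<^sub>L 'x"
    and B :: "nat \<Rightarrow> 'u::complex_fd_space \<Rightarrow>\<^sub>L 'x"
    and p :: "real \<Rightarrow> 'x \<Rightarrow>\<^sub>L 'x"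
    and f :: "real \<times> real \<Rightarrow> 'x \<Rightarrow>\<^sub>L 'x"
    and g :: "real \<times> real \<Rightarrow> 'u \<Rightarrow>\<^sub>L 'x"
  assumes "m \<ge> 1" and "\<tau> 0 = 0" and "strict_mono_on {0..m} \<tau>"
    and "\<And>j. j \<le> m \<Longrightarrow> A j \<in> HomC" and "\<And>j. j \<le> m \<Longrightarrow> B j \<in> HomC"
    and "solution_kernels m \<tau> A B p f g"
  shows "(no_unstable_modes (discrete_relation (\<tau> m) p f g) \<longleftrightarrow>
            rel_stable (vanishing_seq (\<tau> m)) (discrete_relation (\<tau> m) p f g))
    \<and> (rel_stable (vanishing_seq (\<tau> m)) (discrete_relation (\<tau> m) p f g) \<longleftrightarrow>
            VIVO (vanishing_seq (\<tau> m)) (vanishing_seq (\<tau> m)) (discrete_relation (\<tau> m) p f g))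
    \<and> (VIVO (vanishing_seq (\<tau> m)) (vanishing_seq (\<tau> m)) (discrete_relation (\<tau> m) p f g) \<longleftrightarrow>
            VIVO vanishing vanishing (delay_relation m \<tau> A B))
    \<and> (VIVO vanishing vanishing (delay_relation m \<tau> A B) \<longleftrightarrow>
            VIVO smoothly_vanishing smoothly_vanishing (delay_relation m \<tau> A B))
    \<and> (VIVO smoothly_vanishing smoothly_vanishing (delay_relation m \<tau> A B) \<longleftrightarrow>
            rel_stable vanishing (delay_relation m \<tau> A B))"
proof -
  interpret delay_kernels m \<tau> A B p f g
    using assms by unfold_locales
  \<comment> \<open>Two cycles close the equivalences: absence of modes, discrete VIVO, discrete
    stability and back; and absence of modes, discrete VIVO, VIVO, smooth VIVO, stability and
    back.\<close>
  show ?thesis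
    using no_unstable_modes_imp_VIVO VIVO_imp_stable stable_imp_no_unstable_modes
      VIVO_discrete_imp_VIVO VIVO_imp_smoothly_VIVO smoothly_VIVO_imp_stable
      stable_imp_no_unstable_discrete_modes by blast
qed

end
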